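(* Fix constants $B,C>0$ and $\varepsilon>0$, and let $B_c=1+\sqrt{1+1/C}$. For $0\le\delta\le 1$ and $n\ge1$ let $X=(X_{ij})$ be sampled uniformly at random from $\mathcal{M}_{n,\delta}(B,C)$. Then, as $n\to\infty$: (i) [bottom right] For all $0\le\delta\le1$, $$d_{TV}\bigl(X_{n+1,n+1},\mathrm{Geom}(C)\bigr)=O\bigl(n^{\delta-1}+n^{-1/2+\varepsilon}\bigr).$$ (ii) [sides] For all $0<\delta\le1$ and $B\ne B_c$, $$d_{TV}\bigl(X_{1,n+1},\mathrm{Geom}(R)\bigr)=O\bigl(n^{\delta-1}+n^{-\delta/2+\varepsilon}\bigr),$$ where $R=BC$ if $B<B_c$, and $R=B_cC$ if $B>B_c$. (iii) [top left] For all $1/2<\delta<1$ and $B\neq B_c$, $$d_{TV}\bigl(X_{11},\mathrm{Geom}(R)\bigr)=O\bigl(n^{\delta-1}+n^{1/2-\delta+\varepsilon}\bigr),$$ where $R=\dfrac{B^2(1+C)}{(B_c-B)(B+B_c-2)}$ if $B<B_c$, and $R=R_n=C(B-B_c)n^{1-\delta}+O(1)$ if $B>B_c$ (that is, in the case $B>B_c$ there is a sequence $R_n$ with $R_n-C(B-B_c)n^{1-\delta}$ bounded in $n$ for which the bound holds).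
   Context: $\mathbb{N}=\{0,1,2,\dots\}$. For $n\ge1$, $0\le\delta\le1$, $B,C\ge0$, $\mathcal{M}_{n,\delta}(B,C)$ is the set of all square matrices of size $\lfloor n^\delta\rfloor+n$ with entries in $\mathbb{N}$ whose first $\lfloor n^\delta\rfloor$ row sums and column sums equal $\lfloor BCn\rfloor$ and whose last $n$ row sums and column sums equal $\lfloor Cn\rfloor$. For $\lambda>0$, $\mathrm{Geom}(\lambda)$ is the distribution on $\mathbb{N}$ with $\mathbb{P}(Y=k)=\frac{1}{1+\lambda}\left(\frac{\lambda}{1+\lambda}\right)^k$ (so its mean is $\lambda$). For distributions $\mu_1,\mu_2$ on a countable set $\Omega$, $d_{TV}(\mu_1,\mu_2)=\sum_{x\in\Omega}|\mu_1(x)-\mu_2(x)|$ (no factor $1/2$); a random variable in an argument of $d_{TV}$ stands for its distribution. The constants in $O(\cdot)$ may depend on $\delta,B,C,\varepsilon$. *)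

theory Defs
  imports "HOL-Probability.Probability" "HOL-Library.Landau_Symbols" "Jordan_Normal_Form.Matrix"
begin

definition num_heavy :: "nat \<Rightarrow> real \<Rightarrow> nat" where
  "num_heavy n \<delta> = nat \<lfloor>real n powr \<delta>\<rfloor>"

definition margin :: "nat \<Rightarrow> real \<Rightarrow> real \<Rightarrow> real \<Rightarrow> nat \<Rightarrow> nat" where
  "margin n \<delta> B C i =
     (if i < num_heavy n \<delta> then nat \<lfloor>B * C * real n\<rfloor> else nat \<lfloor>C * real n\<rfloor>)"

definition contingency_tables :: "nat \<Rightarrow> real \<Rightarrow> real \<Rightarrow> real \<Rightarrow> nat mat set" where
  "contingency_tables n \<delta> B C =
     (let m = num_heavy n \<delta> + n in
       {X \<in> carrier_mat m m.
          (\<forall>i<m. (\<Sum>j<m. X $$ (i, j)) = margin n \<delta> B C i) \<and>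
          (\<forall>j<m. (\<Sum>i<m. X $$ (i, j)) = margin n \<delta> B C j)})"

text \<open>Finiteness and nonemptiness make \<open>pmf_of_set (contingency_tables n \<delta> B C)\<close> the uniform
  distribution; otherwise it would be unspecified.\<close>

lemma finite_contingency_tables: "finite (contingency_tables n \<delta> B C)"
proof -
  define m where "m = num_heavy n \<delta> + n"
  define K where "K = nat \<lfloor>B * C * real n\<rfloor> + nat \<lfloor>C * real n\<rfloor>"
  have "contingency_tables n \<delta> B C \<subseteq>
      (\<lambda>f. mat m m f) ` (({..<m} \<times> {..<m}) \<rightarrow>\<^sub>E {..K})"
  proof
    fix X assume X: "X \<in> contingency_tables n \<delta> B C"
    have dim: "dim_row X = m" "dim_col X = m"
      and row: "\<And>i. i < m \<Longrightarrow> (\<Sum>j<m. X $$ (i, j)) = margin n \<delta> B C i"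
      using X by (auto simp: contingency_tables_def Let_def m_def)
    define f where "f = restrict (\<lambda>p. X $$ p) ({..<m} \<times> {..<m})"
    have "X $$ (i, j) \<le> K" if "i < m" "j < m" for i j
    proof -
      have "X $$ (i, j) \<le> (\<Sum>j<m. X $$ (i, j))"
        by (rule member_le_sum) (use that in auto)
      also have "\<dots> \<le> K"
        using row[OF that(1)] by (simp add: margin_def K_def)
      finally show ?thesis .
    qed
    then have "f \<in> ({..<m} \<times> {..<m}) \<rightarrow>\<^sub>E {..K}"
      by (auto simp: f_def)
    moreover have "X = mat m m f"
      by (rule eq_matI) (auto simp: dim f_def)
    ultimately show "X \<in> (\<lambda>f. mat m m f) ` (({..<m} \<times> {..<m}) \<rightarrow>\<^sub>E {..K})"
      by blast
  qed
  then show ?thesis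
    by (rule finite_subset) (intro finite_imageI finite_PiE; simp)
qed

lemma contingency_tables_nonempty: "contingency_tables n \<delta> B C \<noteq> {}"
proof -
  define m where "m = num_heavy n \<delta> + n"
  have "mat m m (\<lambda>(i, j). if i = j then margin n \<delta> B C i else 0) \<in> contingency_tables n \<delta> B C"
    by (auto simp: contingency_tables_def Let_def m_def[symmetric])
  then show ?thesis by blast
qed

text \<open>Distribution of \<open>X\<^sub>i\<^sub>j\<close>. The arguments \<open>i, j \<ge> 1\<close> are counted from one, whereas the entries of
  a \<^typ>\<open>'a mat\<close> are counted from zero.\<close>

definition entry_pmf :: "nat \<Rightarrow> real \<Rightarrow> real \<Rightarrow> real \<Rightarrow> nat \<Rightarrow> nat \<Rightarrow> nat pmf" where
  "entry_pmf n \<delta> B C i j =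
     map_pmf (\<lambda>X. X $$ (i - 1, j - 1)) (pmf_of_set (contingency_tables n \<delta> B C))"

text \<open>Geometric distribution on \<open>{0, 1, 2, \<dots>}\<close> with mean \<open>l\<close> (not success probability \<open>l\<close>).\<close>

definition Geom :: "real \<Rightarrow> nat pmf" where
  "Geom l = geometric_pmf (1 / (1 + l))"

lemma pmf_Geom:
  assumes "l > 0"
  shows "pmf (Geom l) k = 1 / (1 + l) * (l / (1 + l)) ^ k"
proof -
  have "1 - 1 / (1 + l) = l / (1 + l)"
    using assms by (simp add: field_simps)
  then show ?thesis
    using assms by (simp add: Geom_def)
qed

text \<open>Total variation distance without the factor \<open>1/2\<close>.\<close>

definition dTV :: "'a pmf \<Rightarrow> 'a pmf \<Rightarrow> real" where
  "dTV p q = (\<Sum>\<^sub>\<infinity>x. \<bar>pmf p x - pmf q x\<bar>)"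

definition Bcrit :: "real \<Rightarrow> real" where
  "Bcrit C = 1 + sqrt (1 + 1 / C)"

end

theory Submission
  imports Defs "HOL-Combinatorics.Permutations" "HOL-Real_Asymp.Real_Asymp"
begin

text \<open>Let \<open>m = num_heavy n \<delta>\<close> and call the first \<open>m\<close> rows and columns heavy, the others light. Fill a square
  table with independent geometric variables, where entry \<open>(i, j)\<close> has ratio \<open>w i * w j\<close>, with
  \<open>w = x\<close> on heavy and \<open>w = y\<close> on light indices. A table with row sums \<open>r\<close> and column sums \<open>c\<close> then has
  probability proportional to \<open>(\<Prod>i. w i ^ r i) * (\<Prod>j. w j ^ c j)\<close>, which depends on the margins alone; so,
  conditioned on its margins, the random table is uniform (\<open>card_ratio_eq_prob_ratio\<close>).

  By symmetry, an entry \<open>X\<^sub>i\<^sub>j\<close> of the uniform table has the same law as every other entry of its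
  block, so \<open>P(X\<^sub>i\<^sub>j \<in> S)\<close> is the expected fraction of the entries of the block that lie in \<open>S\<close>. In the
  independent table this fraction is within \<open>s\<close> of its mean up to probability \<open>exp (- 2 * k * s\<^sup>2)\<close>,
  where \<open>k\<close> is the number of entries in the block. Conditioning multiplies the failure probability by at
  most the inverse of the probability of the prescribed margins, whence
  \<open>dTV X\<^sub>i\<^sub>j (Geom z) \<le> 2 * (s + exp (- 2 * k * s\<^sup>2) / P(margins))\<close> (\<open>dTV_entry_le\<close>). If
  \<open>P(margins) \<ge> exp (- A * n * ln n)\<close>, then \<open>s = n powr \<epsilon> * sqrt (n / k)\<close> is admissible, and \<open>k = n\<^sup>2\<close>,
  \<open>m * n\<close> and \<open>m\<^sup>2\<close> give the three exponents \<open>- 1/2\<close>, \<open>- \<delta>/2\<close> and \<open>1/2 - \<delta>\<close> of the theorem.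

  The lower bound on \<open>P(margins)\<close> is the heart of the proof. Moving one unit from a row to a row whose sum
  is smaller by at least two does not decrease the number of tables: when everything but these two rows is
  fixed, the number of ways to split their sum is a coefficient of a product of polynomials
  \<open>1 + t + \<dots> + t ^ u\<close>, which is symmetric and unimodal (\<open>card_tables_transfer_row\<close>). Adding a unit to one
  row sum and one column sum does not decrease the number either. Hence the prescribed margins, which are
  constant on each block, admit at least as many tables as any margins whose block totals are not larger
  (\<open>card_tables_le_block_margins\<close>). By Chebyshev's inequality the block totals of the independent table are,
  with probability at least \<open>1/2\<close>, at most the prescribed ones and smaller by only \<open>O(n)\<close>, provided that
  the means are chosen slightly too small. That event is covered by \<open>exp (O(n * ln n))\<close> possible
  margins, and none of them is much more probable than the prescribed ones (\<open>prob_near_margins_le\<close>).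

  It remains to choose the means \<open>zh\<close>, \<open>h\<close>, \<open>zl\<close> of the heavy-heavy, heavy-light and light-light entries.
  With \<open>q z = z / (1 + z)\<close> they have to satisfy \<open>q zh * q zl = (q h)\<^sup>2\<close> and two linear margin equations;
  the intermediate value theorem solves this system (\<open>balanced_means_exist\<close>). As \<open>m / n\<close> tends to \<open>0\<close>, \<open>zl\<close>
  tends to \<open>C\<close>. If \<open>(q (B * C))\<^sup>2 < q C\<close>, that is \<open>B < Bcrit C\<close>, then \<open>zh\<close> stays bounded and \<open>h\<close> tends to
  \<open>B * C\<close>. If \<open>B > Bcrit C\<close>, then \<open>h\<close> cannot exceed \<open>Bcrit C * C\<close>, the solution of \<open>(q h)\<^sup>2 = q C\<close>; it tends to this
  value, and the heavy entries absorb the excess \<open>(B - Bcrit C) * C * n\<close>, of order \<open>n / m\<close> in each.\<close>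

section \<open>Counting tables with prescribed margins\<close>

definition tables :: "'a set \<Rightarrow> 'b set \<Rightarrow> ('a \<Rightarrow> nat) \<Rightarrow> ('b \<Rightarrow> nat) \<Rightarrow> ('a \<times> 'b \<Rightarrow> nat) set" where
  "tables I J r c = {f. (\<forall>p. p \<notin> I \<times> J \<longrightarrow> f p = 0) \<and>
     (\<forall>i\<in>I. (\<Sum>j\<in>J. f (i, j)) = r i) \<and> (\<forall>j\<in>J. (\<Sum>i\<in>I. f (i, j)) = c j)}"

text \<open>The cardinality of this set is the coefficient of \<open>t ^ k\<close> in \<open>\<Prod>j\<in>J. 1 + t + \<dots> + t ^ u j\<close>. The index is
  an integer so that convolutions need no case distinction at \<open>0\<close>.\<close>

definition subvectors :: "'b set \<Rightarrow> ('b \<Rightarrow> nat) \<Rightarrow> int \<Rightarrow> ('b \<Rightarrow> nat) set" where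
  "subvectors J u k = {v. (\<forall>j. j \<notin> J \<longrightarrow> v j = 0) \<and> (\<forall>j\<in>J. v j \<le> u j) \<and> int (sum v J) = k}"

text \<open>A function that only decreases with the distance from \<open>U / 2\<close>; symmetry about \<open>U / 2\<close> is included, since
  the hypothesis can hold in both directions.\<close>

definition central_unimodal :: "(int \<Rightarrow> nat) \<Rightarrow> int \<Rightarrow> bool" where
  "central_unimodal f U \<longleftrightarrow> (\<forall>k l. \<bar>2 * k - U\<bar> \<le> \<bar>2 * l - U\<bar> \<longrightarrow> f l \<le> f k)"

lemma central_unimodalI:
  assumes sym: "\<And>k. f k = f (U - k)"
      and up: "\<And>k. 2 * k + 1 \<le> U \<Longrightarrow> f k \<le> f (k + 1)"
  shows "central_unimodal f U"
proof -
  have mono: "l \<le> k \<Longrightarrow> 2 * k \<le> U \<Longrightarrow> f l \<le> f k" for k l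
  proof (induction k rule: int_ge_induct)
    case base then show ?case by simp
  next
    case (step i)
    have "f l \<le> f i" by (rule step.IH) (use step.prems in simp)
    also have "f i \<le> f (i + 1)" by (rule up) (use step.prems in simp)
    finally show ?case .
  qed
  have "f l \<le> f k" if h: "\<bar>2 * k - U\<bar> \<le> \<bar>2 * l - U\<bar>" for k l
  proof -
    define k' where "k' = min k (U - k)"
    define l' where "l' = min l (U - l)"
    have "f k = f k'" "f l = f l'"
      using sym[of k] sym[of l] by (auto simp: k'_def l'_def min_def)
    moreover have "f l' \<le> f k'"
      by (rule mono) (use h in \<open>auto simp: k'_def l'_def min_def\<close>)
    ultimately show ?thesis by simp
  qed
  then show ?thesis by (auto simp: central_unimodal_def)
qed

text \<open>Multiplication by \<open>1 + t + \<dots> + t ^ u\<close>: passing from \<open>k\<close> to \<open>k + 1\<close> exchanges the value at \<open>k - u\<close> for the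
  value at \<open>k + 1\<close>, and left of the new centre the latter index is nearer to the old centre.\<close>

lemma central_unimodal_window_sum:
  assumes f: "central_unimodal f U"
  shows "central_unimodal (\<lambda>k. \<Sum>s\<le>u. f (k - int s)) (U + int u)"
proof (rule central_unimodalI)
  fix k
  have "(\<Sum>s\<le>u. f (k - int s)) = (\<Sum>s\<le>u. f (k - int (u - s)))"
    by (rule sum.reindex_bij_witness[of _ "\<lambda>s. u - s" "\<lambda>s. u - s"]) auto
  also have "\<dots> = (\<Sum>s\<le>u. f (U + int u - k - int s))"
  proof (rule sum.cong[OF refl])
    fix s assume s: "s \<in> {..u}"
    have "\<bar>2 * (k - int (u - s)) - U\<bar> = \<bar>2 * (U + int u - k - int s) - U\<bar>"
      using s by (auto simp: of_nat_diff)
    then show "f (k - int (u - s)) = f (U + int u - k - int s)"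
      using f by (metis central_unimodal_def order.antisym order.refl)
  qed
  finally show "(\<Sum>s\<le>u. f (k - int s)) = (\<Sum>s\<le>u. f (U + int u - k - int s))" .
next
  fix k assume k: "2 * k + 1 \<le> U + int u"
  have le: "f (k - int u) \<le> f (k + 1)"
    using f k unfolding central_unimodal_def by auto
  have "(\<Sum>s\<le>u. f (k - int s)) + f (k + 1) = (\<Sum>s\<le>Suc u. f (k + 1 - int s))"
    by (subst sum.atMost_Suc_shift) (simp add: algebra_simps)
  also have "\<dots> = (\<Sum>s\<le>u. f (k + 1 - int s)) + f (k - int u)"
    by simp
  finally show "(\<Sum>s\<le>u. f (k - int s)) \<le> (\<Sum>s\<le>u. f (k + 1 - int s))"
    using le by linarith
qed

lemma finite_subvectors:
  assumes "finite J" shows "finite (subvectors J u k)"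
proof -
  have "inj_on (\<lambda>v. restrict v J) (subvectors J u k)"
    unfolding subvectors_def by (intro inj_onI ext) (metis (mono_tags, lifting) mem_Collect_eq restrict_apply')
  moreover have "(\<lambda>v. restrict v J) ` subvectors J u k \<subseteq> (\<Pi>\<^sub>E j\<in>J. {..u j})"
    by (auto simp: subvectors_def)
  ultimately show ?thesis
    using assms by (meson finite_PiE finite_atMost finite_imageD finite_subset)
qed

lemma card_subvectors_insert:
  assumes "finite J" "a \<notin> J"
  shows "card (subvectors (insert a J) u k) = (\<Sum>s\<le>u a. card (subvectors J u (k - int s)))"
proof -
  have bij: "bij_betw (\<lambda>(s, v). v(a := s)) (SIGMA s:{..u a}. subvectors J u (k - int s))
    (subvectors (insert a J) u k)"
  proof (rule bij_betw_byWitness[where f' = "\<lambda>v. (v a, v(a := 0))"])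
    show "\<forall>x\<in>SIGMA s:{..u a}. subvectors J u (k - int s).
       (\<lambda>v. (v a, v(a := 0))) ((\<lambda>(s, v). v(a := s)) x) = x"
      using assms by (auto simp: subvectors_def fun_eq_iff)
    show "\<forall>v\<in>subvectors (insert a J) u k. (\<lambda>(s, v). v(a := s)) (v a, v(a := 0)) = v"
      by auto
    have sm: "sum (v(a := x)) J = sum v J" for v :: "'a \<Rightarrow> nat" and x
      using assms by (intro sum.cong) auto
    have sm': "(\<Sum>j\<in>J. if j = a then x else v j) = sum v J" for v :: "'a \<Rightarrow> nat" and x
      using assms by (intro sum.cong) auto
    have sm'': "(\<Sum>j\<in>J. int (if j = a then x else v j)) = (\<Sum>j\<in>J. int (v j))" for v :: "'a \<Rightarrow> nat" and x
      using assms by (intro sum.cong) auto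
    show "(\<lambda>(s, v). v(a := s)) ` (SIGMA s:{..u a}. subvectors J u (k - int s))
        \<subseteq> subvectors (insert a J) u k"
      using assms by (auto simp: subvectors_def sm sm' sm'')
    show "(\<lambda>v. (v a, v(a := 0))) ` subvectors (insert a J) u k
        \<subseteq> (SIGMA s:{..u a}. subvectors J u (k - int s))"
      using assms by (auto simp: subvectors_def sm sm' sm'')
  qed
  show ?thesis
    using bij_betw_same_card[OF bij] assms finite_subvectors by (subst (asm) card_SigmaI) auto
qed

lemma card_subvectors_central_unimodal:
  assumes "finite J"
  shows "central_unimodal (\<lambda>k. card (subvectors J u k)) (int (sum u J))"
  using assms
proof (induction J rule: finite_induct)
  case empty
  have "subvectors {} u k = (if k = 0 then {\<lambda>_. 0} else {})" for k
    by (auto simp: subvectors_def)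
  then show ?case by (auto simp: central_unimodal_def)
next
  case (insert a J)
  from central_unimodal_window_sum[OF insert.IH, of "u a"] insert.hyps show ?case
    by (simp add: card_subvectors_insert add.commute)
qed

lemma finite_tables:
  assumes "finite I" "finite J" shows "finite (tables I J r c)"
proof -
  have "f p \<le> (if p \<in> I \<times> J then r (fst p) else 0)" if "f \<in> tables I J r c" for f p
  proof (cases "p \<in> I \<times> J")
    case True
    then have "f p \<le> (\<Sum>j\<in>J. f (fst p, j))"
      using assms member_le_sum[of "snd p" J "\<lambda>j. f (fst p, j)"] by auto
    then show ?thesis using that True by (auto simp: tables_def)
  next
    case False
    then have "f p = 0" using that unfolding tables_def by blast
    then show ?thesis by simp
  qed
  note * = this
  have "tables I J r c \<subseteq> (\<lambda>f p. if p \<in> I \<times> J then f p else 0) ` (\<Pi>\<^sub>E p\<in>I \<times> J. {..r (fst p)})"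
  proof (intro subsetI)
    fix f assume f: "f \<in> tables I J r c"
    have "f p \<le> r (fst p)" if "p \<in> I \<times> J" for p
      using *[OF f, of p] that by simp
    then have "restrict f (I \<times> J) \<in> (\<Pi>\<^sub>E p\<in>I \<times> J. {..r (fst p)})"
      by (simp add: restrict_PiE_iff)
    moreover have "f = (\<lambda>p. if p \<in> I \<times> J then restrict f (I \<times> J) p else 0)"
      using f by (auto simp: tables_def fun_eq_iff)
    ultimately show "f \<in> (\<lambda>f p. if p \<in> I \<times> J then f p else 0) ` (\<Pi>\<^sub>E p\<in>I \<times> J. {..r (fst p)})"
      by blast
  qed
  then show ?thesis
    using assms by (meson finite_PiE finite_SigmaI finite_atMost finite_imageI finite_subset)
qed

lemma card_tables_transpose:
  "card (tables I J r c) = card (tables J I c r)"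
proof -
  have *: "f \<circ> prod.swap \<in> tables J I c r" if "f \<in> tables I J r c"
    for f :: "'a \<times> 'b \<Rightarrow> nat" and I J r c
    using that by (auto simp: tables_def prod.swap_def)
  have **: "f \<circ> prod.swap \<in> tables I J r c" if "f \<in> tables J I c r"
    for f :: "'b \<times> 'a \<Rightarrow> nat" and I J r c
    using that by (auto simp: tables_def prod.swap_def)
  have "bij_betw (\<lambda>f. f \<circ> prod.swap) (tables I J r c) (tables J I c r)"
    by (rule bij_betw_byWitness[where f' = "\<lambda>f. f \<circ> prod.swap"]) (auto simp: * ** fun_eq_iff)
  then show ?thesis by (rule bij_betw_same_card)
qed

text \<open>Tables with the same image differ only in how the merged row is split between \<open>a\<close> and \<open>b\<close>, so that
  the fibres of this map are sets of subvectors.\<close>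

definition merge_rows :: "'a \<Rightarrow> 'a \<Rightarrow> ('a \<times> 'b \<Rightarrow> nat) \<Rightarrow> 'a \<times> 'b \<Rightarrow> nat" where
  "merge_rows a b f = (\<lambda>(i, j). if i = a then f (a, j) + f (b, j) else if i = b then 0 else f (i, j))"

lemma sum_two_rows:
  fixes h :: "'a \<Rightarrow> nat"
  assumes "finite I" "a \<in> I" "b \<in> I" "a \<noteq> b"
  shows "sum h I = h a + h b + sum h (I - {a, b})"
proof -
  have "sum h I = h a + sum h (I - {a})" using assms by (simp add: sum.remove)
  also have "sum h (I - {a}) = h b + sum h (I - {a} - {b})" using assms by (simp add: sum.remove)
  also have "I - {a} - {b} = I - {a, b}" by auto
  finally show ?thesis by simp
qed

lemma card_merge_rows_fibre:
  assumes fin: "finite I" "finite J" and ab: "a \<in> I" "b \<in> I" "a \<noteq> b"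
    and f0: "f0 \<in> tables I J r0 c" "merge_rows a b f0 = g"
    and r: "\<And>i. i \<noteq> a \<Longrightarrow> i \<noteq> b \<Longrightarrow> r i = r0 i" "r a + r b = r0 a + r0 b"
  shows "card {f \<in> tables I J r c. merge_rows a b f = g} = card (subvectors J (\<lambda>j. g (a, j)) (int (r a)))"
proof -
  define u where "u = (\<lambda>j. g (a, j))"
  define split where "split = (\<lambda>v (i, j). if i = a then v j else if i = b then u j - v j else g (i, j) :: nat)"
  have u: "u j = f0 (a, j) + f0 (b, j)" for j
    using f0 by (auto simp: u_def merge_rows_def)
  have g: "g (i, j) = f0 (i, j)" if "i \<noteq> a" "i \<noteq> b" for i j
    using f0 that by (auto simp: merge_rows_def)
  have gb: "g (b, j) = 0" for j
    using f0 ab by (auto simp: merge_rows_def)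
  have sumu: "sum u J = r a + r b"
    using f0 ab r(2) by (simp add: u sum.distrib tables_def)
  have bij: "bij_betw split (subvectors J u (int (r a))) {f \<in> tables I J r c. merge_rows a b f = g}"
  proof (rule bij_betw_byWitness[where f' = "\<lambda>f j. f (a, j)"])
    show "\<forall>v\<in>subvectors J u (int (r a)). (\<lambda>j. split v (a, j)) = v"
      by (simp add: split_def)
    show "\<forall>f\<in>{f \<in> tables I J r c. merge_rows a b f = g}. split (\<lambda>j. f (a, j)) = f"
      using ab by (fastforce simp: split_def u_def merge_rows_def fun_eq_iff)
    show "(\<lambda>f j. f (a, j)) ` {f \<in> tables I J r c. merge_rows a b f = g} \<subseteq> subvectors J u (int (r a))"
      using ab by (auto simp: subvectors_def u_def merge_rows_def tables_def simp flip: of_nat_sum)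
    show "split ` subvectors J u (int (r a)) \<subseteq> {f \<in> tables I J r c. merge_rows a b f = g}"
    proof safe
      fix v assume v: "v \<in> subvectors J u (int (r a))"
      have vu: "v j \<le> u j" for j
        using v by (cases "j \<in> J") (auto simp: subvectors_def)
      show "merge_rows a b (split v) = g"
        using ab vu gb by (auto simp: merge_rows_def split_def fun_eq_iff u_def)
      have u0: "u j = 0" if "j \<notin> J" for j
        using f0 that by (auto simp: u tables_def)
      have sv: "sum v J = r a" using v by (simp add: subvectors_def flip: of_nat_sum)
      have sr: "(\<Sum>j\<in>J. split v (i, j)) = r i" if "i \<in> I" for i
      proof -
        consider "i = a" | "i = b" | "i \<noteq> a" "i \<noteq> b" by blast
        then show ?thesis
        proof cases
          case 1 then show ?thesis using sv by (simp add: split_def)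
        next
          case 2
          have "(\<Sum>j\<in>J. u j - v j) = sum u J - sum v J"
            using vu by (intro sum_subtractf_nat) auto
          then show ?thesis using 2 ab sv sumu by (simp add: split_def)
        next
          case 3 then show ?thesis using f0 that r(1) by (simp add: split_def g tables_def)
        qed
      qed
      have sc: "(\<Sum>i\<in>I. split v (i, j)) = c j" if "j \<in> J" for j
      proof -
        have "(\<Sum>i\<in>I. split v (i, j)) = split v (a, j) + split v (b, j) + (\<Sum>i\<in>I-{a,b}. split v (i, j))"
          by (rule sum_two_rows) (use fin ab in auto)
        also have "split v (a, j) + split v (b, j) = f0 (a, j) + f0 (b, j)"
          using vu[of j] ab by (simp add: split_def u)
        also have "(\<Sum>i\<in>I-{a,b}. split v (i, j)) = (\<Sum>i\<in>I-{a,b}. f0 (i, j))"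
          by (intro sum.cong) (auto simp: split_def g)
        also have "f0 (a, j) + f0 (b, j) + \<dots> = (\<Sum>i\<in>I. f0 (i, j))"
          by (rule sum_two_rows[symmetric]) (use fin ab in auto)
        finally show ?thesis using f0 that by (simp add: tables_def)
      qed
      have "split v p = 0" if "p \<notin> I \<times> J" for p
      proof -
        obtain i j where p: "p = (i, j)" by force
        have "f0 (i, j) = 0" "v j = 0 \<or> j \<in> J" using that f0 v p by (auto simp: tables_def subvectors_def)
        then show ?thesis using that ab p u0 by (auto simp: split_def g)
      qed
      then show "split v \<in> tables I J r c" using sr sc by (auto simp: tables_def)
    qed
  qed
  then show ?thesis using bij_betw_same_card[OF bij] by (simp add: u_def)
qed

text \<open>Fibrewise over \<open>merge_rows\<close>, the two sides count the subvectors of one vector \<open>u\<close> with sums \<open>r a\<close> and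
  \<open>r a - 1\<close>; the latter is nearer to half of the total \<open>r a + r b\<close> of \<open>u\<close>.\<close>

lemma card_tables_transfer_row:
  assumes fin: "finite I" "finite J" and ab: "a \<in> I" "b \<in> I" and r: "r a \<ge> r b + 2"
  shows "card (tables I J r c) \<le> card (tables I J (r(a := r a - 1, b := r b + 1)) c)"
proof -
  define r' where "r' = r(a := r a - 1, b := r b + 1)"
  have ne: "a \<noteq> b" using r by auto
  define \<Phi> where "\<Phi> = (merge_rows a b :: ('a \<times> 'b \<Rightarrow> nat) \<Rightarrow> _)"
  have fib: "card (tables I J s c) = (\<Sum>g\<in>G. card {f \<in> tables I J s c. \<Phi> f = g})"
    if "finite G" "\<Phi> ` tables I J s c \<subseteq> G" for s G
    using that finite_tables[OF fin]
    using sum.group[of "tables I J s c" G \<Phi> "\<lambda>_. 1 :: nat"] by simp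
  define G where "G = \<Phi> ` tables I J r c \<union> \<Phi> ` tables I J r' c"
  have G: "finite G" unfolding G_def using finite_tables[OF fin] by auto
  have "card (tables I J r c) = (\<Sum>g\<in>G. card {f \<in> tables I J r c. \<Phi> f = g})"
    by (rule fib) (use G in \<open>auto simp: G_def\<close>)
  also have "\<dots> \<le> (\<Sum>g\<in>G. card {f \<in> tables I J r' c. \<Phi> f = g})"
  proof (rule sum_mono)
    fix g
    show "card {f \<in> tables I J r c. \<Phi> f = g} \<le> card {f \<in> tables I J r' c. \<Phi> f = g}"
    proof (cases "{f \<in> tables I J r c. \<Phi> f = g} = {}")
      case True then show ?thesis by (simp only: card.empty le0)
    next
      case False
      then obtain f0 where f0: "f0 \<in> tables I J r c" "merge_rows a b f0 = g" by (auto simp: \<Phi>_def)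
      define u where "u = (\<lambda>j. g (a, j))"
      have "sum u J = r a + r b"
        using f0 ab by (auto simp: u_def merge_rows_def tables_def sum.distrib)
      then have le: "card (subvectors J u (int (r a))) \<le> card (subvectors J u (int (r' a)))"
        using card_subvectors_central_unimodal[OF fin(2), of u] r ne
        unfolding central_unimodal_def by (auto simp: r'_def of_nat_diff)
      show ?thesis
        unfolding \<Phi>_def
        using card_merge_rows_fibre[OF fin ab ne f0, of r] card_merge_rows_fibre[OF fin ab ne f0, of r'] le r ne
        by (auto simp: r'_def u_def)
    qed
  qed
  also have "\<dots> = card (tables I J r' c)"
    by (rule fib[symmetric]) (use G in \<open>auto simp: G_def\<close>)
  finally show ?thesis by (simp add: r'_def)
qed

text \<open>Adding one to the entry \<open>(a, b)\<close> is an injection.\<close>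

lemma card_tables_add_unit:
  assumes fin: "finite I" "finite J" and "a \<in> I" "b \<in> J"
  shows "card (tables I J r c) \<le> card (tables I J (r(a := Suc (r a))) (c(b := Suc (c b))))"
proof (rule card_inj_on_le)
  show "inj_on (\<lambda>f. f((a, b) := Suc (f (a, b)))) (tables I J r c)"
    by (rule inj_onI) (metis Suc_inject fun_upd_eqD fun_upd_triv fun_upd_upd)
  show "(\<lambda>f. f((a, b) := Suc (f (a, b)))) ` tables I J r c \<subseteq> tables I J (r(a := Suc (r a))) (c(b := Suc (c b)))"
  proof safe
    fix f assume f: "f \<in> tables I J r c"
    have 1: "(\<Sum>j\<in>J. (f((a, b) := Suc (f (a, b)))) (i, j)) = (\<Sum>j\<in>J. f (i, j)) + (if i = a then 1 else 0)" for i
    proof -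
      have "(\<Sum>j\<in>J. (f((a, b) := Suc (f (a, b)))) (i, j)) = (\<Sum>j\<in>J. f (i, j) + (if j = b \<and> i = a then 1 else 0))"
        by (intro sum.cong) auto
      also have "\<dots> = (\<Sum>j\<in>J. f (i, j)) + (\<Sum>j\<in>J. (if j = b \<and> i = a then 1 else 0))" by (rule sum.distrib)
      finally show ?thesis using assms by (cases "i = a") auto
    qed
    have 2: "(\<Sum>i\<in>I. (f((a, b) := Suc (f (a, b)))) (i, j)) = (\<Sum>i\<in>I. f (i, j)) + (if j = b then 1 else 0)" for j
    proof -
      have "(\<Sum>i\<in>I. (f((a, b) := Suc (f (a, b)))) (i, j)) = (\<Sum>i\<in>I. f (i, j) + (if i = a \<and> j = b then 1 else 0))"
        by (intro sum.cong) auto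
      also have "\<dots> = (\<Sum>i\<in>I. f (i, j)) + (\<Sum>i\<in>I. (if i = a \<and> j = b then 1 else 0))" by (rule sum.distrib)
      finally show ?thesis using assms by (cases "j = b") auto
    qed
    show "f((a, b) := Suc (f (a, b))) \<in> tables I J (r(a := Suc (r a))) (c(b := Suc (c b)))"
      using f assms unfolding tables_def mem_Collect_eq 1 2 by auto
  qed
qed (use finite_tables[OF fin] in auto)

text \<open>If the average of \<open>r\<close> over \<open>H\<close> is at most \<open>t\<close> and some value exceeds \<open>t\<close>, then another one is below \<open>t\<close>,
  and a unit can be moved between them without decreasing \<open>F\<close>; the total excess over \<open>t\<close> drops each time.\<close>

lemma exists_balanced_below:
  fixes F :: "('a \<Rightarrow> nat) \<Rightarrow> nat"
  assumes fin: "finite H"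
    and transfer: "\<And>r a b. a \<in> H \<Longrightarrow> b \<in> H \<Longrightarrow> r a \<ge> r b + 2 \<Longrightarrow> F r \<le> F (r(a := r a - 1, b := r b + 1))"
    and "sum r H \<le> card H * t"
  shows "\<exists>r'. (\<forall>i\<in>H. r' i \<le> t) \<and> (\<forall>i. i \<notin> H \<longrightarrow> r' i = r i) \<and> sum r' H = sum r H \<and> F r \<le> F r'"
  using assms(3)
proof (induction "\<Sum>i\<in>H. r i - t" arbitrary: r rule: less_induct)
  case less
  show ?case
  proof (cases "\<forall>i\<in>H. r i \<le> t")
    case True then show ?thesis by auto
  next
    case False
    then obtain a where a: "a \<in> H" "r a > t" by auto
    have "\<exists>b\<in>H. r b < t"
    proof (rule ccontr)
      assume *: "\<not> ?thesis"
 have "(\<Sum>i\<in>H. t) < sum r H"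
        by (rule sum_strict_mono_ex1) (use a fin * in \<open>auto simp: not_less\<close>)
      then show False using less.prems by simp
    qed
    then obtain b where b: "b \<in> H" "r b < t" by auto
    define r1 where "r1 = r(a := r a - 1, b := r b + 1)"
    have ne: "a \<noteq> b" using a b by auto
    have sums: "sum h H = h a + h b + sum h (H - {a, b})" for h :: "'a \<Rightarrow> nat"
      by (rule sum_two_rows) (use fin a b ne in auto)
    have eq1: "sum r1 (H - {a,b}) = sum r (H - {a,b})"
      by (intro sum.cong) (auto simp: r1_def)
    have eq2: "(\<Sum>i\<in>H-{a,b}. r1 i - t) = (\<Sum>i\<in>H-{a,b}. r i - t)"
      by (intro sum.cong) (auto simp: r1_def)
    have s1: "sum r1 H = sum r H"
      using sums[of r1] sums[of r] eq1 a b ne by (simp add: r1_def)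
    have lt: "(\<Sum>i\<in>H. r1 i - t) < (\<Sum>i\<in>H. r i - t)"
      using sums[of "\<lambda>i. r1 i - t"] sums[of "\<lambda>i. r i - t"] eq2 a b ne by (simp add: r1_def)
    obtain r' where r': "\<forall>i\<in>H. r' i \<le> t" "\<forall>i. i \<notin> H \<longrightarrow> r' i = r1 i" "sum r' H = sum r1 H" "F r1 \<le> F r'"
      using less.hyps[OF lt] less.prems s1 by auto
    have "F r \<le> F r1" unfolding r1_def using transfer a b by auto
    then have "F r \<le> F r'" using r' by linarith
    moreover have "\<forall>i. i \<notin> H \<longrightarrow> r' i = r i" using r' a b by (auto simp: r1_def)
    ultimately show ?thesis using r' s1 by auto
  qed
qed

lemma card_tables_mono_margins:
  assumes fin: "finite I" "finite J"
    and "\<And>i. i \<in> I \<Longrightarrow> r i \<le> s i" "\<And>j. j \<in> J \<Longrightarrow> c j \<le> d j"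
    and "sum r I = sum c J" "sum s I = sum d J"
  shows "card (tables I J r c) \<le> card (tables I J s d)"
  using assms(3-)
proof (induction "\<Sum>i\<in>I. s i - r i" arbitrary: r c rule: less_induct)
  case less
  have total: "sum r I \<le> sum s I" by (rule sum_mono) (use less.prems in auto)
  show ?case
  proof (cases "sum r I = sum s I")
    case True
    have "r i = s i" if "i \<in> I" for i
      using True less.prems(1) fin that by (metis sum_mono_inv)
    moreover have "c j = d j" if "j \<in> J" for j
    proof -
      have "sum c J = sum d J" using True less.prems by simp
      then show ?thesis using less.prems(2) fin that by (metis sum_mono_inv)
    qed
    ultimately have "tables I J r c = tables I J s d" by (auto simp: tables_def)
    then show ?thesis by simp
  next
    case False
    have "\<exists>a\<in>I. r a < s a"
    proof (rule ccontr)
      assume "\<not> ?thesis"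
      then have "sum s I \<le> sum r I" by (intro sum_mono) (auto simp: not_less)
      then show False using total False by simp
    qed
    then obtain a where a: "a \<in> I" "r a < s a" by auto
    have "\<exists>b\<in>J. c b < d b"
    proof (rule ccontr)
      assume "\<not> ?thesis"
      then have "sum d J \<le> sum c J" by (intro sum_mono) (auto simp: not_less)
      then show False using total False less.prems(3,4) by simp
    qed
    then obtain b where b: "b \<in> J" "c b < d b" by auto
    have upd: "sum (h(x := Suc (h x))) X = Suc (sum h X)" if "finite X" "x \<in> X" for h :: "'c \<Rightarrow> nat" and x X
    proof -
      have "sum (h(x := Suc (h x))) X = Suc (h x) + sum (h(x := Suc (h x))) (X - {x})"
        using that by (simp add: sum.remove)
      also have "sum (h(x := Suc (h x))) (X - {x}) = sum h (X - {x})"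
        by (intro sum.cong) auto
      finally show ?thesis using that by (simp add: sum.remove)
    qed
    have "card (tables I J r c) \<le> card (tables I J (r(a := Suc (r a))) (c(b := Suc (c b))))"
      by (rule card_tables_add_unit) (use fin a b in auto)
    also have "\<dots> \<le> card (tables I J s d)"
    proof (rule less.hyps)
      show "(\<Sum>i\<in>I. s i - (r(a := Suc (r a))) i) < (\<Sum>i\<in>I. s i - r i)"
        by (rule sum_strict_mono_ex1) (use fin a in \<open>auto intro!: bexI[of _ a]\<close>)
      show "sum (r(a := Suc (r a))) I = sum (c(b := Suc (c b))) J"
        using upd[OF fin(1) a(1), of r] upd[OF fin(2) b(1), of c] less.prems(3) by (simp only:)
      show "sum s I = sum d J" by (rule less.prems)
      show "(r(a := Suc (r a))) i \<le> s i" if "i \<in> I" for i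
        using less.prems(1)[OF that] a by simp
      show "(c(b := Suc (c b))) j \<le> d j" if "j \<in> J" for j
        using less.prems(2)[OF that] b by simp
    qed
    finally show ?thesis .
  qed
qed

definition by_block :: "'a set \<Rightarrow> 'b \<Rightarrow> 'b \<Rightarrow> 'a \<Rightarrow> 'b" where
  "by_block H u v i = (if i \<in> H then u else v)"

lemma sum_tables_total:
  assumes "f \<in> tables I J r c" shows "sum r I = sum c J"
proof -
  have "sum r I = (\<Sum>i\<in>I. \<Sum>j\<in>J. f (i, j))" using assms by (auto simp: tables_def intro!: sum.cong)
  also have "\<dots> = (\<Sum>j\<in>J. \<Sum>i\<in>I. f (i, j))" by (rule sum.swap)
  also have "\<dots> = sum c J" using assms by (auto simp: tables_def intro!: sum.cong)
  finally show ?thesis .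
qed

lemma exists_block_balanced_below:
  fixes F :: "('a \<Rightarrow> nat) \<Rightarrow> nat"
  assumes fin: "finite H" "finite L" and disj: "H \<inter> L = {}"
    and transfer: "\<And>r a b. a \<in> H \<union> L \<Longrightarrow> b \<in> H \<union> L \<Longrightarrow> r a \<ge> r b + 2 \<Longrightarrow>
      F r \<le> F (r(a := r a - 1, b := r b + 1))"
    and r: "sum r H \<le> card H * tH" "sum r L \<le> card L * tL"
  shows "\<exists>r'. (\<forall>i\<in>H \<union> L. r' i \<le> by_block H tH tL i) \<and> sum r' (H \<union> L) = sum r (H \<union> L) \<and> F r \<le> F r'"
proof -
  obtain r1 where r1: "\<forall>i\<in>H. r1 i \<le> tH" "\<forall>i. i \<notin> H \<longrightarrow> r1 i = r i" "sum r1 H = sum r H" "F r \<le> F r1"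
    using exists_balanced_below[of H F r tH] fin r transfer by auto
  have s1: "sum r1 L = sum r L" using r1(2) disj by (intro sum.cong) auto
  obtain r2 where r2: "\<forall>i\<in>L. r2 i \<le> tL" "\<forall>i. i \<notin> L \<longrightarrow> r2 i = r1 i" "sum r2 L = sum r1 L" "F r1 \<le> F r2"
    using exists_balanced_below[of L F r1 tL] fin r s1 transfer by auto
  have s2: "sum r2 H = sum r1 H" using r2(2) disj by (intro sum.cong) auto
  have "\<forall>i\<in>H \<union> L. r2 i \<le> by_block H tH tL i"
    using r1 r2 disj by (auto simp: by_block_def)
  moreover have "sum r2 (H \<union> L) = sum r (H \<union> L)"
    using fin disj r1 r2 s1 s2 by (simp add: sum.union_disjoint)
  moreover have "F r \<le> F r2" using r1 r2 by simp
  ultimately show ?thesis by blast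
qed

text \<open>The rows are levelled within each block, then the columns, and finally the remaining deficits are filled
  up unit by unit.\<close>

lemma card_tables_le_block_margins:
  fixes r c :: "'a \<Rightarrow> nat"
  assumes fin: "finite H" "finite L" and disj: "H \<inter> L = {}" and I: "I = H \<union> L"
    and tot: "sum r I = sum c I"
    and r: "sum r H \<le> card H * tH" "sum r L \<le> card L * tL"
    and c: "sum c H \<le> card H * tH" "sum c L \<le> card L * tL"
  shows "card (tables I I r c) \<le> card (tables I I (by_block H tH tL) (by_block H tH tL))"
proof -
  have finI: "finite I" using fin I by simp
  obtain r' where r': "\<forall>i\<in>I. r' i \<le> by_block H tH tL i" "sum r' I = sum r I"
      "card (tables I I r c) \<le> card (tables I I r' c)"
    using exists_block_balanced_below[OF fin disj _ r, of "\<lambda>r. card (tables I I r c)"]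
      card_tables_transfer_row[OF finI finI] unfolding I by blast
  obtain c' where c': "\<forall>i\<in>I. c' i \<le> by_block H tH tL i" "sum c' I = sum c I"
      "card (tables I I c r') \<le> card (tables I I c' r')"
    using exists_block_balanced_below[OF fin disj _ c, of "\<lambda>c. card (tables I I c r')"]
      card_tables_transfer_row[OF finI finI] unfolding I by blast
  have "card (tables I I r' c') \<le> card (tables I I (by_block H tH tL) (by_block H tH tL))"
    by (rule card_tables_mono_margins) (use finI r' c' tot in auto)
  then show ?thesis
    using r'(3) c'(3) by (simp add: card_tables_transpose[of I I c r'] card_tables_transpose[of I I c' r'])
qed

section \<open>Sums of independent geometric variables\<close>

lemma (in prob_space) variance_sum_indep:
  fixes X :: "'i \<Rightarrow> 'a \<Rightarrow> real"
  assumes fin: "finite A" and indep: "indep_vars (\<lambda>_. borel) X A"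
    and sq: "\<And>i. i \<in> A \<Longrightarrow> integrable M (\<lambda>x. (X i x)\<^sup>2)"
  shows "integrable M (\<lambda>x. (\<Sum>i\<in>A. X i x)\<^sup>2)"
    and "variance (\<lambda>x. \<Sum>i\<in>A. X i x) = (\<Sum>i\<in>A. variance (X i))"
proof -
  have rv[measurable]: "X i \<in> borel_measurable M" if "i \<in> A" for i
    using indep that by (auto simp: indep_vars_def)
  have int: "integrable M (X i)" if "i \<in> A" for i
    using square_integrable_imp_integrable[OF rv[OF that]] sq[OF that] by simp
  define W where "W = (\<lambda>i x. X i x - expectation (X i))"
  have indepW: "indep_vars (\<lambda>_. borel) W A"
    unfolding W_def by (rule indep_vars_compose2[OF indep]) auto
  have intW: "integrable M (W i)" and EW: "expectation (W i) = 0" if "i \<in> A" for i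
    using int[OF that] by (auto simp: W_def prob_space)
  have sqW: "integrable M (\<lambda>x. (W i x)\<^sup>2)" if "i \<in> A" for i
    unfolding W_def power2_diff using int[OF that] sq[OF that] by auto
  have prod: "integrable M (\<lambda>x. W i x * W j x) \<and>
      expectation (\<lambda>x. W i x * W j x) = (if i = j then variance (X i) else 0)"
    if "i \<in> A" "j \<in> A" for i j
  proof (cases "i = j")
    case True
    then show ?thesis using sqW[OF that(1)] by (simp add: power2_eq_square W_def)
  next
    case False
    have ind: "indep_vars (\<lambda>_. borel) W {i, j}"
      by (rule indep_vars_subset[OF indepW]) (use that in auto)
    have "integrable M (\<lambda>x. \<Prod>k\<in>{i, j}. W k x)"
      by (rule indep_vars_integrable[OF _ ind]) (use intW that in auto)
    moreover have "expectation (\<lambda>x. \<Prod>k\<in>{i, j}. W k x) = (\<Prod>k\<in>{i, j}. expectation (W k))"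
      by (rule indep_vars_lebesgue_integral[OF _ ind]) (use intW that in auto)
    ultimately show ?thesis using False EW that by simp
  qed
  have sqsum: "(\<Sum>i\<in>A. W i x)\<^sup>2 = (\<Sum>i\<in>A. \<Sum>j\<in>A. W i x * W j x)" for x
    by (simp add: power2_eq_square sum_product)
  have W2: "integrable M (\<lambda>x. (\<Sum>i\<in>A. W i x)\<^sup>2)"
    unfolding sqsum using prod by auto
  have Esum: "expectation (\<lambda>x. \<Sum>i\<in>A. X i x) = (\<Sum>i\<in>A. expectation (X i))"
    by (rule Bochner_Integration.integral_sum) (use int in auto)
  have XW: "(\<Sum>i\<in>A. X i x) = (\<Sum>i\<in>A. W i x) + (\<Sum>i\<in>A. expectation (X i))" for x
    by (simp add: W_def sum_subtractf)
  have "integrable M (\<lambda>x. (\<Sum>i\<in>A. W i x))" using intW by auto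
  with W2 show "integrable M (\<lambda>x. (\<Sum>i\<in>A. X i x)\<^sup>2)"
    unfolding XW power2_sum by auto
  have "variance (\<lambda>x. \<Sum>i\<in>A. X i x) = expectation (\<lambda>x. (\<Sum>i\<in>A. W i x)\<^sup>2)"
    by (simp add: Esum W_def sum_subtractf)
  also have "\<dots> = (\<Sum>i\<in>A. \<Sum>j\<in>A. expectation (\<lambda>x. W i x * W j x))"
    unfolding sqsum using prod
    by (simp add: Bochner_Integration.integral_sum Bochner_Integration.integrable_sum cong: sum.cong)
  also have "\<dots> = (\<Sum>i\<in>A. \<Sum>j\<in>A. if i = j then variance (X i) else 0)"
    using prod by (intro sum.cong refl) auto
  also have "\<dots> = (\<Sum>i\<in>A. variance (X i))"
    using fin by simp
  finally show "variance (\<lambda>x. \<Sum>i\<in>A. X i x) = (\<Sum>i\<in>A. variance (X i))" .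
qed

text \<open>The distribution \<open>neg_binomial_pmf 3 p\<close> has total mass \<open>1\<close>, which evaluates the expectation of
  \<open>(k + 1) * (k + 2)\<close> under the geometric distribution as \<open>2 / p\<^sup>2\<close>. This bounds the variance with a
  constant that is good enough for Chebyshev's inequality.\<close>

lemma geometric_second_moment:
  fixes p :: real
  assumes p: "0 < p" "p \<le> 1"
  shows "integrable (geometric_pmf p) (\<lambda>k. (real k)\<^sup>2)"
    and "measure_pmf.variance (geometric_pmf p) real \<le> 2 / p\<^sup>2"
proof -
  have "integrable (count_space UNIV) (pmf (neg_binomial_pmf 3 p))"
    using pmf_abs_summable[of "neg_binomial_pmf 3 p" UNIV] unfolding abs_summable_on_def .
  moreover have "(\<integral>k. pmf (neg_binomial_pmf 3 p) k \<partial>count_space UNIV) = 1"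
    using infsetsum_pmf_eq_1[of "neg_binomial_pmf 3 p" UNIV] by (simp add: infsetsum_def)
  moreover have "pmf (geometric_pmf p) k * ((real k + 1) * (real k + 2)) =
      2 / p\<^sup>2 * pmf (neg_binomial_pmf 3 p) k" for k
  proof -
    have "(k + 2) choose k = (k + 2) choose 2" using binomial_symmetric[of k "k + 2"] by simp
    moreover have "2 * ((k + 2) choose 2) = (k + 2) * (k + 1)"
      unfolding choose_two by (subst dvd_mult_div_cancel) auto
    ultimately have "2 * ((k + 2) choose k) = (k + 2) * (k + 1)" by (simp only:)
    then have "real (2 * ((k + 2) choose k)) = real ((k + 2) * (k + 1))" by (simp only:)
    then have "real ((k + 2) choose k) = (real k + 2) * (real k + 1) / 2"
      unfolding of_nat_mult of_nat_add by simp
    then show ?thesis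
      using pmf_neg_binomial[of p 3 k] p by (simp add: power2_eq_square power3_eq_cube field_simps)
  qed
  ultimately have 1: "integrable (count_space UNIV) (\<lambda>k. pmf (geometric_pmf p) k * ((real k + 1) * (real k + 2)))"
    and 2: "(\<integral>k. pmf (geometric_pmf p) k * ((real k + 1) * (real k + 2)) \<partial>count_space UNIV) = 2 / p\<^sup>2"
    by simp_all
  have i1: "integrable (geometric_pmf p) (\<lambda>k. (real k + 1) * (real k + 2))"
    unfolding measure_pmf_eq_density by (subst integrable_density) (use 1 in auto)
  have e1: "measure_pmf.expectation (geometric_pmf p) (\<lambda>k. (real k + 1) * (real k + 2)) = 2 / p\<^sup>2"
    unfolding measure_pmf_eq_density by (subst integral_density) (use 2 in auto)
  show i2: "integrable (geometric_pmf p) (\<lambda>k. (real k)\<^sup>2)"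
    by (rule Bochner_Integration.integrable_bound[OF i1]) (auto simp: power2_eq_square algebra_simps)
  have "measure_pmf.variance (geometric_pmf p) real \<le> measure_pmf.expectation (geometric_pmf p) (\<lambda>k. (real k)\<^sup>2)"
    using measure_pmf.variance_eq[of "geometric_pmf p" real] i2 integrable_real_geometric_pmf[of p] p by simp
  also have "\<dots> \<le> measure_pmf.expectation (geometric_pmf p) (\<lambda>k. (real k + 1) * (real k + 2))"
    by (rule integral_mono[OF i2 i1]) (auto simp: power2_eq_square algebra_simps)
  finally show "measure_pmf.variance (geometric_pmf p) real \<le> 2 / p\<^sup>2" using e1 by simp
qed

lemma Pi_geometric_sum_deviation:
  fixes q :: "'a \<Rightarrow> real"
  assumes fin: "finite A" and BA: "B \<subseteq> A" and q: "\<And>a. a \<in> A \<Longrightarrow> 0 < q a \<and> q a < 1" and \<kappa>: "\<kappa> > 0"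
  shows "measure_pmf.prob (Pi_pmf A 0 (\<lambda>a. geometric_pmf (1 - q a)))
      {f. \<bar>real (\<Sum>a\<in>B. f a) - (\<Sum>a\<in>B. q a / (1 - q a))\<bar> \<ge> \<kappa>} \<le> (\<Sum>a\<in>B. 2 / (1 - q a)\<^sup>2) / \<kappa>\<^sup>2"
proof -
  define P where "P = Pi_pmf A 0 (\<lambda>a. geometric_pmf (1 - q a))"
  define X where "X = (\<lambda>a (f :: 'a \<Rightarrow> nat). real (f a))"
  have comp: "map_pmf (\<lambda>f. f a) P = geometric_pmf (1 - q a)" if "a \<in> A" for a
    unfolding P_def using fin that by (subst Pi_pmf_component) auto
  have sq: "integrable P (\<lambda>f. (X a f)\<^sup>2)" if "a \<in> A" for a
  proof -
    have "integrable (map_pmf (\<lambda>f. f a) P) (\<lambda>k. (real k)\<^sup>2)"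
      unfolding comp[OF that] by (rule geometric_second_moment) (use q[OF that] in auto)
    then show ?thesis by (simp add: X_def)
  qed
  have E: "measure_pmf.expectation P (X a) = q a / (1 - q a)" if "a \<in> A" for a
  proof -
    have "measure_pmf.expectation P (X a) = measure_pmf.expectation (map_pmf (\<lambda>f. f a) P) real"
      unfolding X_def by (rule integral_map_pmf[symmetric])
    then show ?thesis unfolding comp[OF that] using expectation_geometric_pmf[of "1 - q a"] q[OF that] by simp
  qed
  have V: "measure_pmf.variance P (X a) \<le> 2 / (1 - q a)\<^sup>2" if "a \<in> A" for a
  proof -
    have "measure_pmf.variance P (X a) = measure_pmf.variance (map_pmf (\<lambda>f. f a) P) real"
      unfolding X_def integral_map_pmf ..
    then show ?thesis unfolding comp[OF that] using geometric_second_moment(2)[of "1 - q a"] q[OF that] by simp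
  qed
  have int: "integrable P (X a)" if "a \<in> A" for a
    using measure_pmf.square_integrable_imp_integrable[OF _ sq[OF that]] by simp
  have finB: "finite B" using fin BA finite_subset by auto
  have "prob_space.indep_vars P (\<lambda>_. count_space UNIV) (\<lambda>a f. f a) A"
    unfolding P_def by (rule indep_vars_Pi_pmf[OF fin])
  then have "prob_space.indep_vars P (\<lambda>_. borel) X A"
    unfolding X_def by (rule prob_space.indep_vars_compose2[OF measure_pmf.prob_space_axioms]) auto
  then have ind: "prob_space.indep_vars P (\<lambda>_. borel) X B" by (rule prob_space.indep_vars_subset[OF measure_pmf.prob_space_axioms]) (rule BA)
  have I: "integrable P (\<lambda>f. (\<Sum>a\<in>B. X a f)\<^sup>2)"
    and Var: "measure_pmf.variance P (\<lambda>f. \<Sum>a\<in>B. X a f) = (\<Sum>a\<in>B. measure_pmf.variance P (X a))"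
    by (rule prob_space.variance_sum_indep[OF measure_pmf.prob_space_axioms finB ind]; use sq BA in auto)+
  have Es: "measure_pmf.expectation P (\<lambda>f. \<Sum>a\<in>B. X a f) = (\<Sum>a\<in>B. q a / (1 - q a))"
    using E int BA by (subst Bochner_Integration.integral_sum) (auto intro!: sum.cong)
  have "measure_pmf.prob P {f\<in>space P. \<bar>(\<Sum>a\<in>B. X a f) - measure_pmf.expectation P (\<lambda>f. \<Sum>a\<in>B. X a f)\<bar> \<ge> \<kappa>}
      \<le> measure_pmf.variance P (\<lambda>f. \<Sum>a\<in>B. X a f) / \<kappa>\<^sup>2"
    by (rule measure_pmf.Chebyshev_inequality[OF _ I \<kappa>]) simp
  also have "\<dots> \<le> (\<Sum>a\<in>B. 2 / (1 - q a)\<^sup>2) / \<kappa>\<^sup>2"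
    unfolding Var using V BA by (intro divide_right_mono sum_mono) auto
  finally show ?thesis unfolding Es by (simp add: X_def P_def)
qed

section \<open>Total variation distance and geometric distributions\<close>

text \<open>The ratio of consecutive probabilities in the geometric distribution with mean \<open>z\<close>.\<close>

definition geom_ratio :: "real \<Rightarrow> real" where
  "geom_ratio z = z / (1 + z)"

lemma geom_ratio_bounds:
  assumes "z > 0" shows "0 < geom_ratio z" "geom_ratio z < 1"
  using assms by (auto simp: geom_ratio_def)

lemma geom_ratio_odds:
  assumes "z > 0" shows "geom_ratio z / (1 - geom_ratio z) = z"
  using assms by (simp add: geom_ratio_def field_simps)

lemma geom_ratio_diff:
  assumes "a > 0" "b > 0"
  shows "geom_ratio a - geom_ratio b = (a - b) / ((1 + a) * (1 + b))"
  using assms by (simp add: geom_ratio_def divide_simps) (simp add: algebra_simps)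

lemma geom_ratio_le_iff:
  assumes "a > 0" "b > 0"
  shows "geom_ratio a \<le> geom_ratio b \<longleftrightarrow> a \<le> b"
proof -
  have "geom_ratio a \<le> geom_ratio b \<longleftrightarrow> (a - b) / ((1 + a) * (1 + b)) \<le> 0"
    unfolding geom_ratio_diff[OF assms, symmetric] by simp
  also have "\<dots> \<longleftrightarrow> a - b \<le> 0"
    using mult_pos_pos[of "1 + a" "1 + b"] assms unfolding divide_le_0_iff by argo
  finally show ?thesis by simp
qed

lemma geom_ratio_lipschitz:
  assumes "a > 0" "b > 0"
  shows "\<bar>geom_ratio a - geom_ratio b\<bar> \<le> \<bar>a - b\<bar>"
proof -
  have "(1 + a) * (1 + b) \<ge> 1 * 1" using assms by (intro mult_mono) auto
  then have "\<bar>a - b\<bar> / ((1 + a) * (1 + b)) \<le> \<bar>a - b\<bar> / 1"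
    using assms by (intro divide_left_mono) auto
  then show ?thesis using assms by (simp add: geom_ratio_diff abs_mult)
qed

lemma Geom_eq_geometric_pmf:
  assumes "z > 0" shows "Geom z = geometric_pmf (1 - geom_ratio z)"
  using assms by (simp add: Geom_def geom_ratio_def field_simps)

lemma
  fixes p q :: "'a pmf"
  shows summable_on_pmf_diff: "(\<lambda>x. \<bar>pmf p x - pmf q x\<bar>) summable_on UNIV"
    and infsum_pmf_diff: "(\<Sum>\<^sub>\<infinity>x. \<bar>pmf p x - pmf q x\<bar>) =
      2 * (measure_pmf.prob p {x. pmf p x > pmf q x} - measure_pmf.prob q {x. pmf p x > pmf q x})"
proof -
  define A where "A = {x. pmf p x > pmf q x}"
  have s: "Infinite_Set_Sum.abs_summable_on (\<lambda>x. \<bar>pmf p x - pmf q x\<bar>) X" for X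
    using abs_summable_on_diff[OF pmf_abs_summable[of p X] pmf_abs_summable[of q X]]
    by (simp flip: real_norm_def)
  then show "(\<lambda>x. \<bar>pmf p x - pmf q x\<bar>) summable_on UNIV"
    by (meson abs_summable_equivalent abs_summable_summable)
  have d1: "(\<Sum>\<^sub>ax\<in>A. \<bar>pmf p x - pmf q x\<bar>) = measure_pmf.prob p A - measure_pmf.prob q A"
    unfolding measure_pmf_conv_infsetsum
    by (subst infsetsum_diff[symmetric]) (auto simp: A_def pmf_abs_summable intro!: infsetsum_cong)
  have d2: "(\<Sum>\<^sub>ax\<in>-A. \<bar>pmf p x - pmf q x\<bar>) = measure_pmf.prob q (-A) - measure_pmf.prob p (-A)"
    unfolding measure_pmf_conv_infsetsum
    by (subst infsetsum_diff[symmetric]) (auto simp: A_def pmf_abs_summable intro!: infsetsum_cong)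
  have "(\<Sum>\<^sub>\<infinity>x. \<bar>pmf p x - pmf q x\<bar>) = (\<Sum>\<^sub>ax\<in>A \<union> -A. \<bar>pmf p x - pmf q x\<bar>)"
    using infsetsum_infsum[OF s[of UNIV]] by simp
  also have "\<dots> = (\<Sum>\<^sub>ax\<in>A. \<bar>pmf p x - pmf q x\<bar>) + (\<Sum>\<^sub>ax\<in>-A. \<bar>pmf p x - pmf q x\<bar>)"
    by (rule infsetsum_Un_disjoint) (auto intro: s)
  also have "\<dots> = 2 * (measure_pmf.prob p A - measure_pmf.prob q A)"
    unfolding d1 d2 using measure_pmf.prob_compl[of A p] measure_pmf.prob_compl[of A q]
    by (simp add: Compl_eq_Diff_UNIV)
  finally show "(\<Sum>\<^sub>\<infinity>x. \<bar>pmf p x - pmf q x\<bar>) =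
      2 * (measure_pmf.prob p {x. pmf p x > pmf q x} - measure_pmf.prob q {x. pmf p x > pmf q x})"
    by (simp add: A_def)
qed

lemma dTV_triangle: "dTV p r \<le> dTV p q + dTV q r"
proof -
  have "dTV p r \<le> (\<Sum>\<^sub>\<infinity>x. \<bar>pmf p x - pmf q x\<bar> + \<bar>pmf q x - pmf r x\<bar>)"
    unfolding dTV_def by (intro infsum_mono summable_on_add summable_on_pmf_diff) auto
  also have "\<dots> = dTV p q + dTV q r"
    unfolding dTV_def by (intro infsum_add summable_on_pmf_diff)
  finally show ?thesis .
qed

lemma dTV_nonneg: "dTV p q \<ge> 0"
  unfolding dTV_def by (intro infsum_nonneg) auto

lemma dTV_commute: "dTV p q = dTV q p"
  unfolding dTV_def by (simp add: abs_minus_commute)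

lemma dTV_le_2: "dTV p q \<le> 2"
proof -
  define A where "A = {x. pmf p x > pmf q x}"
  have "measure_pmf.prob p A - measure_pmf.prob q A \<le> 1 - 0" by (intro diff_mono) auto
  then show ?thesis unfolding dTV_def infsum_pmf_diff A_def[symmetric] by simp
qed

text \<open>With ratios \<open>u \<le> v\<close> the probabilities at \<open>k\<close> differ by \<open>(v - u) * u ^ k - (1 - v) * (v ^ k - u ^ k)\<close>, a
  difference of two nonnegative terms, each with sum \<open>(v - u) / (1 - u) \<le> b - a\<close>.\<close>

lemma dTV_Geom_le:
  assumes "a > 0" "b > 0"
  shows "dTV (Geom a) (Geom b) \<le> 2 * \<bar>a - b\<bar>"
proof -
  have *: "dTV (Geom a) (Geom b) \<le> 2 * (b - a)" if ab: "0 < a" "a \<le> b" for a b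
  proof -
    define u v where "u = geom_ratio a" and "v = geom_ratio b"
    have uv: "0 < u" "u \<le> v" "v < 1"
      using ab geom_ratio_bounds[of a] geom_ratio_bounds[of b] geom_ratio_le_iff[of a b] by (auto simp: u_def v_def)
    have pmfs: "pmf (Geom a) k = (1 - u) * u ^ k" "pmf (Geom b) k = (1 - v) * v ^ k" for k
      using ab uv by (simp_all add: Geom_eq_geometric_pmf u_def[symmetric] v_def[symmetric])
    define f where "f = (\<lambda>k. (v - u) * u ^ k + (1 - v) * (v ^ k - u ^ k))"
    have "f sums ((v - u) * (1 / (1 - u)) + (1 - v) * (1 / (1 - v) - 1 / (1 - u)))"
      unfolding f_def using uv by (intro sums_add sums_mult sums_diff geometric_sums) auto
    also have "(v - u) * (1 / (1 - u)) + (1 - v) * (1 / (1 - v) - 1 / (1 - u)) = 2 * ((v - u) / (1 - u))"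
      using uv by (simp add: divide_simps)
    finally have sums: "f sums (2 * ((v - u) / (1 - u)))" .
    have f0: "f k \<ge> 0" for k
      using uv power_mono[of u v k] by (simp add: f_def)
    have hs: "(f has_sum (2 * ((v - u) / (1 - u)))) UNIV"
      using sums f0 by (intro norm_summable_imp_has_sum) (auto simp: sums_iff)
    have le: "\<bar>pmf (Geom a) k - pmf (Geom b) k\<bar> \<le> f k" for k
    proof -
      have "pmf (Geom a) k - pmf (Geom b) k = (v - u) * u ^ k - (1 - v) * (v ^ k - u ^ k)"
        by (simp add: pmfs algebra_simps)
      moreover have "(v - u) * u ^ k \<ge> 0" "(1 - v) * (v ^ k - u ^ k) \<ge> 0"
        using uv power_mono[of u v k] by auto
      ultimately show ?thesis unfolding f_def by linarith
    qed
    have "dTV (Geom a) (Geom b) \<le> infsum f UNIV"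
      unfolding dTV_def using hs le by (intro infsum_mono summable_on_pmf_diff) (auto simp: has_sum_imp_summable)
    also have "\<dots> = 2 * ((v - u) / (1 - u))" by (rule infsumI[OF hs])
    also have "(v - u) / (1 - u) = (b - a) / (1 + b)"
      using ab by (simp add: u_def v_def geom_ratio_def divide_simps) (simp add: algebra_simps)
    also have "(b - a) / (1 + b) \<le> (b - a) / 1"
      using ab by (intro divide_left_mono) auto
    finally show ?thesis by simp
  qed
  show ?thesis
    using *[of a b] *[of b a] assms dTV_commute[of "Geom a" "Geom b"] by (cases "a \<le> b") auto
qed

section \<open>Tables with independent geometric entries\<close>

text \<open>The ratio of entry \<open>(i, j)\<close> has the product form \<open>w i * w j\<close> in order that the probability of a table
  depends on its margins only.\<close>

definition random_table :: "'a set \<Rightarrow> ('a \<Rightarrow> real) \<Rightarrow> ('a \<times> 'a \<Rightarrow> nat) pmf" where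
  "random_table I w = Pi_pmf (I \<times> I) 0 (\<lambda>p. geometric_pmf (1 - w (fst p) * w (snd p)))"

lemma mult_weights_bounds:
  fixes w :: "'a \<Rightarrow> real"
  assumes "\<And>i. i \<in> I \<Longrightarrow> 0 < w i \<and> w i < 1" "i \<in> I" "j \<in> I"
  shows "0 < w i * w j" "w i * w j < 1"
  using assms(1)[OF assms(2)] assms(1)[OF assms(3)] mult_strict_mono[of "w i" 1 "w j" 1] by auto

lemma pmf_random_table:
  fixes w :: "'a \<Rightarrow> real"
  assumes fin: "finite I" and w: "\<And>i. i \<in> I \<Longrightarrow> 0 < w i \<and> w i < 1"
    and f: "f \<in> tables I I r c"
  shows "pmf (random_table I w) f =
    (\<Prod>p\<in>I \<times> I. 1 - w (fst p) * w (snd p)) * ((\<Prod>i\<in>I. w i ^ r i) * (\<Prod>j\<in>I. w j ^ c j))"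
proof -
  have "pmf (random_table I w) f = (\<Prod>p\<in>I \<times> I. pmf (geometric_pmf (1 - w (fst p) * w (snd p))) (f p))"
    unfolding random_table_def using fin f by (subst pmf_Pi) (auto simp: tables_def)
  also have "\<dots> = (\<Prod>p\<in>I \<times> I. (1 - w (fst p) * w (snd p)) * (w (fst p) ^ f p * w (snd p) ^ f p))"
  proof (intro prod.cong refl)
    fix p assume "p \<in> I \<times> I"
    then have "fst p \<in> I" "snd p \<in> I" by auto
    from mult_weights_bounds[of I w, OF w this] have "0 < 1 - w (fst p) * w (snd p)" "1 - w (fst p) * w (snd p) \<le> 1"
      by auto
    then show "pmf (geometric_pmf (1 - w (fst p) * w (snd p))) (f p) =
        (1 - w (fst p) * w (snd p)) * (w (fst p) ^ f p * w (snd p) ^ f p)"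
      by (simp add: power_mult_distrib)
  qed
  also have "\<dots> = (\<Prod>p\<in>I \<times> I. 1 - w (fst p) * w (snd p)) *
      ((\<Prod>p\<in>I \<times> I. w (fst p) ^ f p) * (\<Prod>p\<in>I \<times> I. w (snd p) ^ f p))"
    by (simp add: prod.distrib)
  also have "(\<Prod>p\<in>I \<times> I. w (fst p) ^ f p) = (\<Prod>i\<in>I. \<Prod>j\<in>I. w i ^ f (i, j))"
    by (simp add: prod.cartesian_product case_prod_unfold)
  also have "\<dots> = (\<Prod>i\<in>I. w i ^ r i)"
    using f by (auto simp: tables_def simp flip: power_sum)
  also have "(\<Prod>p\<in>I \<times> I. w (snd p) ^ f p) = (\<Prod>i\<in>I. \<Prod>j\<in>I. w j ^ f (i, j))"
    by (simp add: prod.cartesian_product case_prod_unfold)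
  also have "\<dots> = (\<Prod>j\<in>I. \<Prod>i\<in>I. w j ^ f (i, j))" by (rule prod.swap)
  also have "\<dots> = (\<Prod>j\<in>I. w j ^ c j)"
    using f by (auto simp: tables_def simp flip: power_sum)
  finally show ?thesis .
qed

lemma prob_random_table:
  fixes w :: "'a \<Rightarrow> real"
  assumes fin: "finite I" and w: "\<And>i. i \<in> I \<Longrightarrow> 0 < w i \<and> w i < 1"
    and S: "S \<subseteq> tables I I r c"
  shows "measure_pmf.prob (random_table I w) S = real (card S) *
    ((\<Prod>p\<in>I \<times> I. 1 - w (fst p) * w (snd p)) * ((\<Prod>i\<in>I. w i ^ r i) * (\<Prod>j\<in>I. w j ^ c j)))"
proof -
  have "finite S" using S finite_tables[OF fin fin] finite_subset by blast
  then have "measure_pmf.prob (random_table I w) S = sum (pmf (random_table I w)) S"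
    by (rule measure_measure_pmf_finite)
  also have "\<dots> = (\<Sum>f\<in>S. (\<Prod>p\<in>I \<times> I. 1 - w (fst p) * w (snd p)) * ((\<Prod>i\<in>I. w i ^ r i) * (\<Prod>j\<in>I. w j ^ c j)))"
    by (intro sum.cong refl pmf_random_table fin w) (use S in auto)
  finally show ?thesis by simp
qed

text \<open>Since the probability of a table depends on its margins only, the random table is uniformly distributed
  when it is conditioned on its margins.\<close>

lemma card_ratio_eq_prob_ratio:
  fixes w :: "'a \<Rightarrow> real"
  assumes fin: "finite I" and w: "\<And>i. i \<in> I \<Longrightarrow> 0 < w i \<and> w i < 1"
    and S: "S \<subseteq> tables I I r c"
  shows "real (card S) / real (card (tables I I r c)) =
    measure_pmf.prob (random_table I w) S / measure_pmf.prob (random_table I w) (tables I I r c)"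
proof -
  have "(\<Prod>p\<in>I \<times> I. 1 - w (fst p) * w (snd p)) > 0"
    using mult_weights_bounds[OF w] by (intro prod_pos) auto
  moreover have "(\<Prod>i\<in>I. w i ^ r i) > 0" "(\<Prod>j\<in>I. w j ^ c j) > 0"
    using w by (auto intro!: prod_pos)
  ultimately show ?thesis
    by (simp add: prob_random_table[OF fin w S] prob_random_table[OF fin w order.refl])
qed

lemma prod_by_block_power:
  fixes x y :: real
  assumes "finite H" "finite L" "H \<inter> L = {}"
  shows "(\<Prod>i\<in>H \<union> L. by_block H x y i ^ r i) = x ^ sum r H * y ^ sum r L"
proof -
  have "(\<Prod>i\<in>H \<union> L. by_block H x y i ^ r i) =
      (\<Prod>i\<in>H. by_block H x y i ^ r i) * (\<Prod>i\<in>L. by_block H x y i ^ r i)"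
    using assms by (intro prod.union_disjoint)
  also have "(\<Prod>i\<in>H. by_block H x y i ^ r i) = x ^ sum r H"
    by (simp add: by_block_def power_sum)
  also have "(\<Prod>i\<in>L. by_block H x y i ^ r i) = (\<Prod>i\<in>L. y ^ r i)"
    using assms by (intro prod.cong) (auto simp: by_block_def)
  finally show ?thesis by (simp add: power_sum)
qed

text \<open>Wide enough to be likely by Chebyshev's inequality when \<open>D\<close> is a few standard deviations, and narrow
  enough that reaching the targets costs only \<open>D\<close> factors of weight per total. Totals above the targets are
  excluded because the number of tables is only known to grow when totals are raised.\<close>

definition near_margins :: "'a set \<Rightarrow> 'a set \<Rightarrow> nat \<Rightarrow> nat \<Rightarrow> nat \<Rightarrow> ('a \<times> 'a \<Rightarrow> nat) set" where
  "near_margins H L TH TL D = {f. \<forall>S\<in>{H \<times> (H \<union> L), (H \<union> L) \<times> H}. sum f S \<le> TH \<and> TH \<le> sum f S + D} \<inter>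
     {f. \<forall>S\<in>{L \<times> (H \<union> L), (H \<union> L) \<times> L}. sum f S \<le> TL \<and> TL \<le> sum f S + D}"

text \<open>All row and column sums of a table in the event are at most \<open>M\<close>, so at most \<open>(M + 1) ^ (2 * card I)\<close>
  margins occur. For each of them, the prescribed margins have at least as many tables, and
  the weight of a single table changes by at most the factor \<open>(x * y) ^ (2 * D)\<close>, as the four block totals
  change by at most \<open>D\<close> each.\<close>

lemma prob_near_margins_le:
  fixes x y :: real
  assumes fin: "finite H" "finite L" and disj: "H \<inter> L = {}" and I: "I = H \<union> L"
    and xy: "0 < x" "x < 1" "0 < y" "y < 1"
    and t: "t = by_block H tH tL" and w: "w = by_block H x y"
    and M: "M = card H * tH + card L * tL"
  shows "measure_pmf.prob (random_table I w) (near_margins H L (card H * tH) (card L * tL) D) * (x * y) ^ (2 * D)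
      \<le> real (M + 1) ^ (2 * card I) * measure_pmf.prob (random_table I w) (tables I I t t)"
proof -
  define E where "E = near_margins H L (card H * tH) (card L * tL) D"
  define P where "P = random_table I w"
  define R where "R = (\<Pi>\<^sub>E i\<in>I. {..M})"
  define T where "T = (\<lambda>(r, c). tables I I r c)"
  have finI: "finite I" using fin I by simp
  have w01: "0 < w i \<and> w i < 1" for i using xy by (simp add: w by_block_def)
  have finR: "finite R" unfolding R_def using finI by (intro finite_PiE) auto
  have cardR: "card R = (M + 1) ^ card I" unfolding R_def using finI by (simp add: card_PiE)
  have block_sums: "sum f (H \<times> I) = sum r H \<and> sum f (L \<times> I) = sum r L \<and> sum f (I \<times> H) = sum c H \<and> sum f (I \<times> L) = sum c L"
    if "f \<in> tables I I r c" for f r c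
  proof (intro conjI)
    have cart: "sum f (A \<times> B) = (\<Sum>i\<in>A. \<Sum>j\<in>B. f (i, j))" for A B
      by (simp add: sum.cartesian_product)
    have cart': "sum f (A \<times> B) = (\<Sum>j\<in>B. \<Sum>i\<in>A. f (i, j))" for A B
      unfolding cart by (rule sum.swap)
    show "sum f (H \<times> I) = sum r H" "sum f (L \<times> I) = sum r L"
      unfolding cart using that by (auto simp: tables_def I intro!: sum.cong)
    show "sum f (I \<times> H) = sum c H" "sum f (I \<times> L) = sum c L"
      unfolding cart' using that by (auto simp: tables_def I intro!: sum.cong)
  qed
  have cover: "E \<inter> set_pmf P \<subseteq> (\<Union>rc\<in>R \<times> R. E \<inter> T rc)"
  proof
    fix f assume f: "f \<in> E \<inter> set_pmf P"
    then have f0: "f p = 0" if "p \<notin> I \<times> I" for p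
      using set_Pi_pmf_subset[of "I \<times> I" 0 "\<lambda>p. geometric_pmf (1 - w (fst p) * w (snd p))"] finI that
      unfolding P_def random_table_def by blast
    define r where "r = (\<lambda>i\<in>I. \<Sum>j\<in>I. f (i, j))"
    define c where "c = (\<lambda>j\<in>I. \<Sum>i\<in>I. f (i, j))"
    have ft: "f \<in> tables I I r c" using f0 by (simp add: tables_def r_def c_def)
    have bnd: "sum r H \<le> card H * tH" "sum r L \<le> card L * tL" "sum c H \<le> card H * tH" "sum c L \<le> card L * tL"
      using f block_sums[OF ft] by (auto simp: E_def near_margins_def I)
    have "r i \<le> M" if "i \<in> I" for i
    proof -
      have "r i \<le> sum r I" by (rule member_le_sum) (use that finI in auto)
      also have "\<dots> = sum r H + sum r L" unfolding I using fin disj by (simp add: sum.union_disjoint)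
      finally show ?thesis using bnd by (simp add: M)
    qed
    moreover have "c i \<le> M" if "i \<in> I" for i
    proof -
      have "c i \<le> sum c I" by (rule member_le_sum) (use that finI in auto)
      also have "\<dots> = sum c H + sum c L" unfolding I using fin disj by (simp add: sum.union_disjoint)
      finally show ?thesis using bnd by (simp add: M)
    qed
    ultimately have "(r, c) \<in> R \<times> R"
      unfolding R_def r_def c_def by (auto simp: PiE_def)
    then show "f \<in> (\<Union>rc\<in>R \<times> R. E \<inter> T rc)" using ft f by (auto simp: T_def)
  qed
  define Q where "Q = (\<Prod>p\<in>I \<times> I. 1 - w (fst p) * w (snd p))"
  have Q: "Q > 0" unfolding Q_def using mult_weights_bounds[of I w] w01 by (intro prod_pos) auto
  have piece: "measure_pmf.prob P (E \<inter> T rc) * (x * y) ^ (2 * D) \<le> measure_pmf.prob P (tables I I t t)" for rc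
  proof (cases "E \<inter> T rc = {}")
    case False
    obtain r c where rc: "rc = (r, c)" by force
    from False obtain f where f: "f \<in> E" "f \<in> tables I I r c" by (auto simp: T_def rc)
    have bs: "sum r H \<le> card H * tH" "sum r L \<le> card L * tL" "sum c H \<le> card H * tH" "sum c L \<le> card L * tL"
       "card H * tH \<le> sum r H + D" "card L * tL \<le> sum r L + D" "card H * tH \<le> sum c H + D" "card L * tL \<le> sum c L + D"
      using f block_sums[OF f(2)] by (auto simp: E_def near_margins_def I)
    have card: "card (tables I I r c) \<le> card (tables I I t t)"
      unfolding t by (rule card_tables_le_block_margins[OF fin disj I sum_tables_total[OF f(2)]]) (use bs in auto)
    have "(x * y) ^ (2 * D) = (x ^ D * y ^ D) * (x ^ D * y ^ D)"
      by (metis mult_2 power_add power_mult_distrib)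
    then have "(x ^ sum r H * y ^ sum r L) * (x ^ sum c H * y ^ sum c L) * (x * y) ^ (2 * D)
        = (x ^ (sum r H + D) * y ^ (sum r L + D)) * (x ^ (sum c H + D) * y ^ (sum c L + D))"
      by (simp only: power_add mult_ac)
    also have "\<dots> \<le> (x ^ (card H * tH) * y ^ (card L * tL)) * (x ^ (card H * tH) * y ^ (card L * tL))"
      using xy bs by (intro mult_mono power_decreasing) auto
    finally have wt: "((x ^ sum r H * y ^ sum r L) * (x ^ sum c H * y ^ sum c L)) * (x * y) ^ (2 * D) \<le>
      (x ^ (card H * tH) * y ^ (card L * tL)) * (x ^ (card H * tH) * y ^ (card L * tL))" .
    have st: "sum t H = card H * tH" "sum t L = card L * tL"
    proof -
      show "sum t H = card H * tH" by (simp add: t by_block_def)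
      have "sum t L = (\<Sum>i\<in>L. tL)" using disj by (intro sum.cong) (auto simp: t by_block_def)
      then show "sum t L = card L * tL" by simp
    qed
    have pr: "measure_pmf.prob P (tables I I r c) = real (card (tables I I r c)) * (Q *
        ((x ^ sum r H * y ^ sum r L) * (x ^ sum c H * y ^ sum c L)))" for r c
      unfolding P_def prob_random_table[OF finI w01 order.refl] Q_def[symmetric]
      unfolding w I prod_by_block_power[OF fin disj] ..
    have "measure_pmf.prob P (E \<inter> T rc) * (x * y) ^ (2 * D) \<le> measure_pmf.prob P (tables I I r c) * (x * y) ^ (2 * D)"
      using xy by (intro mult_right_mono measure_pmf.finite_measure_mono) (auto simp: rc T_def)
    also have "\<dots> = real (card (tables I I r c)) * (Q *
        (((x ^ sum r H * y ^ sum r L) * (x ^ sum c H * y ^ sum c L)) * (x * y) ^ (2 * D)))"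
      unfolding pr by (simp only: mult.assoc)
    also have "\<dots> \<le> real (card (tables I I t t)) * (Q *
        ((x ^ (card H * tH) * y ^ (card L * tL)) * (x ^ (card H * tH) * y ^ (card L * tL))))"
      by (rule mult_mono[OF _ mult_left_mono[OF wt]]) (use card Q xy in auto)
    also have "\<dots> = measure_pmf.prob P (tables I I t t)"
      unfolding pr st ..
    finally show ?thesis .
  qed simp
  have "measure_pmf.prob P E = measure_pmf.prob P (E \<inter> set_pmf P)"
    by (simp add: measure_Int_set_pmf)
  also have "\<dots> \<le> measure_pmf.prob P (\<Union>rc\<in>R \<times> R. E \<inter> T rc)"
    using cover by (intro measure_pmf.finite_measure_mono) auto
  also have "\<dots> \<le> (\<Sum>rc\<in>R \<times> R. measure_pmf.prob P (E \<inter> T rc))"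
    using finR by (intro measure_pmf.finite_measure_subadditive_finite) auto
  finally have "measure_pmf.prob P E * (x * y) ^ (2 * D) \<le> (\<Sum>rc\<in>R \<times> R. measure_pmf.prob P (E \<inter> T rc)) * (x * y) ^ (2 * D)"
    using xy by (intro mult_right_mono) auto
  also have "\<dots> \<le> (\<Sum>rc\<in>R \<times> R. measure_pmf.prob P (tables I I t t))"
    unfolding sum_distrib_right by (intro sum_mono piece)
  also have "\<dots> = real (M + 1) ^ (2 * card I) * measure_pmf.prob P (tables I I t t)"
    by (simp add: card_cartesian_product cardR power_add mult_2 power_mult_distrib)
  finally show ?thesis by (simp add: E_def P_def)
qed

text \<open>Chebyshev's inequality for the four block totals, each with failure probability at most \<open>1/8\<close>. The means
  \<open>\<mu>H\<close> and \<open>\<mu>L\<close> lie below the targets by at least the admitted deviations \<open>\<kappa>H\<close> and \<open>\<kappa>L\<close>.\<close>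

lemma prob_near_margins_ge_half:
  fixes x y zhh zhl zll \<mu>H \<mu>L \<kappa>H \<kappa>L :: real
  assumes fin: "finite H" "finite L" and disj: "H \<inter> L = {}" and I: "I = H \<union> L"
    and xy: "0 < x" "x < 1" "0 < y" "y < 1" and w: "w = by_block H x y"
    and z: "zhh = x * x / (1 - x * x)" "zhl = x * y / (1 - x * y)" "zll = y * y / (1 - y * y)"
    and \<mu>H: "\<mu>H = card H * (card H * zhh + card L * zhl)"
    and \<mu>L: "\<mu>L = card L * (card H * zhl + card L * zll)"
    and \<kappa>: "\<kappa>H > 0" "\<kappa>L > 0"
    and VH: "card H * (card H * (2 * (1 + zhh)\<^sup>2) + card L * (2 * (1 + zhl)\<^sup>2)) \<le> \<kappa>H\<^sup>2 / 8"
    and VL: "card L * (card H * (2 * (1 + zhl)\<^sup>2) + card L * (2 * (1 + zll)\<^sup>2)) \<le> \<kappa>L\<^sup>2 / 8"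
    and TH: "\<mu>H + \<kappa>H \<le> real TH" "real TH \<le> \<mu>H - \<kappa>H + real D"
    and TL: "\<mu>L + \<kappa>L \<le> real TL" "real TL \<le> \<mu>L - \<kappa>L + real D"
  shows "measure_pmf.prob (random_table I w) (near_margins H L TH TL D) \<ge> 1 / 2"
proof -
  define P where "P = random_table I w"
  define q where "q = (\<lambda>p. w (fst p) * w (snd p))"
  have finI: "finite I" using fin I by simp
  have w01: "0 < w i \<and> w i < 1" for i using xy by (simp add: w by_block_def)
  have q: "0 < q p \<and> q p < 1" for p
    using mult_weights_bounds[of UNIV w] w01 by (simp add: q_def)
  have one: "1 / (1 - u) = 1 + u / (1 - u)" if "u < 1" for u :: real
    using that by (simp add: field_simps)
  have inv: "2 / (1 - u)\<^sup>2 = 2 * (1 + u / (1 - u))\<^sup>2" if "u < 1" for u :: real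
    unfolding one[OF that, symmetric] by (simp add: power_divide)
  have lt1: "x * x < 1" "x * y < 1" "y * y < 1"
    using xy mult_strict_mono[of x 1 x 1] mult_strict_mono[of x 1 y 1] mult_strict_mono[of y 1 y 1] by auto
  have strip: "(\<Sum>p\<in>A \<times> I. g (q p)) = card A * (card H * g (u * x) + card L * g (u * y))"
              "(\<Sum>p\<in>I \<times> A. g (q p)) = card A * (card H * g (u * x) + card L * g (u * y))"
    if "finite A" "\<And>i. i \<in> A \<Longrightarrow> w i = u" for A u and g :: "real \<Rightarrow> real"
  proof -
    have inner: "(\<Sum>j\<in>I. g (u * w j)) = card H * g (u * x) + card L * g (u * y)"
    proof -
      have "(\<Sum>j\<in>I. g (u * w j)) = (\<Sum>j\<in>H. g (u * w j)) + (\<Sum>j\<in>L. g (u * w j))"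
        unfolding I using fin disj by (rule sum.union_disjoint)
      also have "(\<Sum>j\<in>H. g (u * w j)) = (\<Sum>j\<in>H. g (u * x))" by (simp add: w by_block_def)
      also have "(\<Sum>j\<in>L. g (u * w j)) = (\<Sum>j\<in>L. g (u * y))"
        using disj by (intro sum.cong) (auto simp: w by_block_def)
      finally show ?thesis by simp
    qed
    have "(\<Sum>p\<in>A \<times> I. g (q p)) = (\<Sum>i\<in>A. \<Sum>j\<in>I. g (w i * w j))"
      by (simp add: sum.cartesian_product q_def case_prod_unfold)
    also have "\<dots> = (\<Sum>i\<in>A. \<Sum>j\<in>I. g (u * w j))" using that by (intro sum.cong) auto
    finally show "(\<Sum>p\<in>A \<times> I. g (q p)) = card A * (card H * g (u * x) + card L * g (u * y))"
      by (simp add: inner)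
    have "(\<Sum>p\<in>I \<times> A. g (q p)) = (\<Sum>i\<in>I. \<Sum>j\<in>A. g (w i * w j))"
      by (simp add: sum.cartesian_product q_def case_prod_unfold)
    also have "\<dots> = (\<Sum>j\<in>A. \<Sum>i\<in>I. g (w i * w j))" by (rule sum.swap)
    also have "\<dots> = (\<Sum>j\<in>A. \<Sum>i\<in>I. g (u * w i))" using that by (intro sum.cong) (auto simp: mult.commute)
    finally show "(\<Sum>p\<in>I \<times> A. g (q p)) = card A * (card H * g (u * x) + card L * g (u * y))"
      by (simp add: inner)
  qed
  have wH: "w i = x" if "i \<in> H" for i using that by (simp add: w by_block_def)
  have wL: "w i = y" if "i \<in> L" for i using that disj by (auto simp: w by_block_def)
  have dev: "measure_pmf.prob P {f. \<bar>real (sum f S) - \<mu>\<bar> \<ge> \<kappa>} \<le> 1 / 8"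
    if "S \<subseteq> I \<times> I" "(\<Sum>p\<in>S. q p / (1 - q p)) = \<mu>" "(\<Sum>p\<in>S. 2 / (1 - q p)\<^sup>2) \<le> \<kappa>\<^sup>2 / 8" "\<kappa> > 0" for S \<mu> \<kappa>
  proof -
    have "measure_pmf.prob P {f. \<bar>real (sum f S) - \<mu>\<bar> \<ge> \<kappa>} \<le> (\<Sum>p\<in>S. 2 / (1 - q p)\<^sup>2) / \<kappa>\<^sup>2"
      using Pi_geometric_sum_deviation[of "I \<times> I" S q \<kappa>] finI that q
      by (simp add: P_def random_table_def q_def)
    also have "\<dots> \<le> (\<kappa>\<^sup>2 / 8) / \<kappa>\<^sup>2" using that by (intro divide_right_mono) auto
    finally show ?thesis using that by simp
  qed
  have devH: "measure_pmf.prob P {f. \<bar>real (sum f S) - \<mu>H\<bar> \<ge> \<kappa>H} \<le> 1 / 8" if "S = H \<times> I \<or> S = I \<times> H" for S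
  proof (rule dev)
    show "(\<Sum>p\<in>S. q p / (1 - q p)) = \<mu>H"
      using that strip[OF fin(1) wH, of "\<lambda>q. q / (1 - q)"] by (auto simp: \<mu>H z)
    show "(\<Sum>p\<in>S. 2 / (1 - q p)\<^sup>2) \<le> \<kappa>H\<^sup>2 / 8"
      using that strip[OF fin(1) wH, of "\<lambda>q. 2 / (1 - q)\<^sup>2"] VH lt1 by (auto simp: z inv)
  qed (use that I \<kappa> in auto)
  have devL: "measure_pmf.prob P {f. \<bar>real (sum f S) - \<mu>L\<bar> \<ge> \<kappa>L} \<le> 1 / 8" if "S = L \<times> I \<or> S = I \<times> L" for S
  proof (rule dev)
    show "(\<Sum>p\<in>S. q p / (1 - q p)) = \<mu>L"
      using that strip[OF fin(2) wL, of "\<lambda>q. q / (1 - q)"] by (auto simp: \<mu>L z mult.commute[of y x])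
    show "(\<Sum>p\<in>S. 2 / (1 - q p)\<^sup>2) \<le> \<kappa>L\<^sup>2 / 8"
      using that strip[OF fin(2) wL, of "\<lambda>q. 2 / (1 - q)\<^sup>2"] VL lt1 by (auto simp: z inv mult.commute[of y x])
  qed (use that I \<kappa> in auto)
  define bad where "bad = (\<lambda>S \<mu> \<kappa>. {f :: 'a \<times> 'a \<Rightarrow> nat. \<bar>real (sum f S) - \<mu>\<bar> \<ge> \<kappa>})"
  have "- near_margins H L TH TL D \<subseteq> (bad (H \<times> I) \<mu>H \<kappa>H \<union> bad (I \<times> H) \<mu>H \<kappa>H) \<union> (bad (L \<times> I) \<mu>L \<kappa>L \<union> bad (I \<times> L) \<mu>L \<kappa>L)"
  proof
    fix f assume f: "f \<in> - near_margins H L TH TL D"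
    have ok: "n \<le> T \<and> T \<le> n + D" if "\<bar>real n - \<mu>\<bar> < \<kappa>" "\<mu> + \<kappa> \<le> real T" "real T \<le> \<mu> - \<kappa> + real D" for n T \<mu> \<kappa>
    proof -
      have "real n \<le> real T" "real T \<le> real (n + D)" using that by auto
      then show ?thesis by (simp only: of_nat_le_iff)
    qed
    show "f \<in> (bad (H \<times> I) \<mu>H \<kappa>H \<union> bad (I \<times> H) \<mu>H \<kappa>H) \<union> (bad (L \<times> I) \<mu>L \<kappa>L \<union> bad (I \<times> L) \<mu>L \<kappa>L)"
    proof (rule ccontr)
      assume "\<not> ?thesis"
      then have a: "\<bar>real (sum f (H \<times> I)) - \<mu>H\<bar> < \<kappa>H" "\<bar>real (sum f (I \<times> H)) - \<mu>H\<bar> < \<kappa>H"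
         "\<bar>real (sum f (L \<times> I)) - \<mu>L\<bar> < \<kappa>L" "\<bar>real (sum f (I \<times> L)) - \<mu>L\<bar> < \<kappa>L"
        unfolding bad_def by (auto simp del: of_nat_sum)
      from ok[OF a(1) TH] ok[OF a(2) TH] ok[OF a(3) TL] ok[OF a(4) TL] f show False
        by (simp add: near_margins_def I)
    qed
  qed
  then have "measure_pmf.prob P (- near_margins H L TH TL D) \<le>
      measure_pmf.prob P ((bad (H \<times> I) \<mu>H \<kappa>H \<union> bad (I \<times> H) \<mu>H \<kappa>H) \<union> (bad (L \<times> I) \<mu>L \<kappa>L \<union> bad (I \<times> L) \<mu>L \<kappa>L))"
    by (intro measure_pmf.finite_measure_mono) auto
  also have "\<dots> \<le> (measure_pmf.prob P (bad (H \<times> I) \<mu>H \<kappa>H) + measure_pmf.prob P (bad (I \<times> H) \<mu>H \<kappa>H)) +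
      (measure_pmf.prob P (bad (L \<times> I) \<mu>L \<kappa>L) + measure_pmf.prob P (bad (I \<times> L) \<mu>L \<kappa>L))"
    by (intro order.trans[OF measure_Un_le] add_mono measure_Un_le) auto
  also have "\<dots> \<le> (1 / 8 + 1 / 8) + (1 / 8 + 1 / 8)"
    unfolding bad_def by (intro add_mono devH devL) auto
  finally show ?thesis
    using measure_pmf.prob_compl[of "near_margins H L TH TL D" P] by (simp add: P_def Compl_eq_Diff_UNIV)
qed

section \<open>Entries of a block\<close>

text \<open>Exchanging rows \<open>a\<close> and \<open>i\<close> and columns \<open>b\<close> and \<open>j\<close> preserves the margins. Applied in both directions, this
  shows that all entries of a block have the same distribution.\<close>

lemma card_tables_entry_le:
  assumes fin: "finite I" "finite J" and ij: "a \<in> I" "i \<in> I" "b \<in> J" "j \<in> J"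
    and r: "r a = r i" and c: "c b = c j"
  shows "card {f \<in> tables I J r c. f (i, j) \<in> S} \<le> card {f \<in> tables I J r c. f (a, b) \<in> S}"
proof (rule card_inj_on_le)
  define \<sigma> where "\<sigma> = Transposition.transpose a i"
  define \<tau> where "\<tau> = Transposition.transpose b j"
  define g where "g = (\<lambda>f :: 'a \<times> 'b \<Rightarrow> nat. f \<circ> map_prod \<sigma> \<tau>)"
  have gg: "g (g f) = f" for f
    by (auto simp: g_def \<sigma>_def \<tau>_def fun_eq_iff)
  show "inj_on g {f \<in> tables I J r c. f (i, j) \<in> S}"
    by (rule inj_onI) (metis gg)
  have \<sigma>: "\<sigma> permutes I" and \<tau>: "\<tau> permutes J"
    using ij by (auto simp: \<sigma>_def \<tau>_def intro: permutes_swap_id)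
  have r\<sigma>: "r (\<sigma> k) = r k" and c\<tau>: "c (\<tau> l) = c l" for k l
    using r c by (auto simp: \<sigma>_def \<tau>_def Transposition.transpose_def)
  show "g ` {f \<in> tables I J r c. f (i, j) \<in> S} \<subseteq> {f \<in> tables I J r c. f (a, b) \<in> S}"
  proof safe
    fix f assume f: "f \<in> tables I J r c" "f (i, j) \<in> S"
    have 1: "(\<Sum>l\<in>J. g f (k, l)) = r k" if "k \<in> I" for k
    proof -
      have "(\<Sum>l\<in>J. g f (k, l)) = (\<Sum>l\<in>J. f (\<sigma> k, \<tau> l))" by (simp add: g_def)
      also have "\<dots> = (\<Sum>l\<in>J. f (\<sigma> k, l))"
        using sum.permute[OF \<tau>, of "\<lambda>l. f (\<sigma> k, l)"] by (simp add: o_def)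
      also have "\<dots> = r k" using f that r\<sigma> permutes_in_image[OF \<sigma>] by (simp add: tables_def)
      finally show ?thesis .
    qed
    have 2: "(\<Sum>k\<in>I. g f (k, l)) = c l" if "l \<in> J" for l
    proof -
      have "(\<Sum>k\<in>I. g f (k, l)) = (\<Sum>k\<in>I. f (\<sigma> k, \<tau> l))" by (simp add: g_def)
      also have "\<dots> = (\<Sum>k\<in>I. f (k, \<tau> l))"
        using sum.permute[OF \<sigma>, of "\<lambda>k. f (k, \<tau> l)"] by (simp add: o_def)
      also have "\<dots> = c l" using f that c\<tau> permutes_in_image[OF \<tau>] by (simp add: tables_def)
      finally show ?thesis .
    qed
    have 3: "g f p = 0" if "p \<notin> I \<times> J" for p
      using that f permutes_in_image[OF \<sigma>] permutes_in_image[OF \<tau>]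
      by (cases p) (auto simp: g_def tables_def)
    show "g f \<in> tables I J r c" using 1 2 3 by (simp add: tables_def)
    show "g f (a, b) \<in> S" using f by (simp add: g_def \<sigma>_def \<tau>_def)
  qed
qed (use finite_tables[OF fin] in auto)

lemma random_table_Hoeffding:
  fixes w :: "'a \<Rightarrow> real" and q s :: real
  assumes fin: "finite I" and w: "\<And>i. i \<in> I \<Longrightarrow> 0 < w i \<and> w i < 1"
    and A: "A \<subseteq> I \<times> I" "A \<noteq> {}" and q: "\<And>p. p \<in> A \<Longrightarrow> w (fst p) * w (snd p) = q" and s: "s \<ge> 0"
  shows "measure_pmf.prob (random_table I w)
      {f. (\<Sum>p\<in>A. indicator S (f p)) / card A \<ge> measure_pmf.prob (geometric_pmf (1 - q)) S + s}
    \<le> exp (- 2 * real (card A) * s\<^sup>2)"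
proof -
  define P where "P = random_table I w"
  define X where "X = (\<lambda>p (f :: 'a \<times> 'a \<Rightarrow> nat). indicator S (f p) :: real)"
  obtain p0 where p0: "p0 \<in> A" using A by auto
  have finA: "finite A" using A fin finite_subset by blast
  have comp: "map_pmf (\<lambda>f. f p) P = geometric_pmf (1 - q)" if "p \<in> A" for p
    unfolding P_def random_table_def using fin that A q by (subst Pi_pmf_component) auto
  have distr: "distr P borel (X p) = distr (geometric_pmf (1 - q)) borel (indicator S :: nat \<Rightarrow> real)" if "p \<in> A" for p
  proof -
    have "distr P borel (X p) = distr (map_pmf (\<lambda>f. f p) P) borel (indicator S :: nat \<Rightarrow> real)"
      unfolding map_pmf_rep_eq by (subst distr_distr) (auto simp: X_def o_def)
    then show ?thesis by (simp add: comp[OF that])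
  qed
  interpret Hoeffding_ineq_iid P A X "X p0" 0 1 "measure_pmf.expectation P (X p0)"
  proof unfold_locales
    have "prob_space.indep_vars P (\<lambda>_. count_space UNIV) (\<lambda>p f. f p) (I \<times> I)"
      unfolding P_def random_table_def by (rule indep_vars_Pi_pmf) (use fin in auto)
    then have "prob_space.indep_vars P (\<lambda>_. borel) X (I \<times> I)"
      unfolding X_def by (rule prob_space.indep_vars_compose2[OF measure_pmf.prob_space_axioms]) auto
    then show "prob_space.indep_vars P (\<lambda>_. borel) X A"
      by (rule prob_space.indep_vars_subset[OF measure_pmf.prob_space_axioms]) (rule A)
    show "distr P borel (X p) = distr P borel (X p0)" if "p \<in> A" for p
      by (simp only: distr[OF that] distr[OF p0])
    show "measure_pmf.expectation P (X p0) \<equiv> measure_pmf.expectation P (X p0)" .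
  qed (use finA in \<open>auto simp: X_def indicator_def\<close>)
  have "measure_pmf.expectation P (X p0) = measure_pmf.expectation (map_pmf (\<lambda>f. f p0) P) (indicator S)"
    unfolding X_def by (rule integral_map_pmf[symmetric])
  also have "\<dots> = measure_pmf.prob (geometric_pmf (1 - q)) S"
    by (simp add: comp[OF p0])
  finally have E: "measure_pmf.expectation P (X p0) = measure_pmf.prob (geometric_pmf (1 - q)) S" .
  show ?thesis
    using Hoeffding_ineq_ge'[OF s _ A(2)] unfolding E by (simp add: X_def P_def)
qed

text \<open>Averaged over the block, the left-hand side is the mean over all tables of the fraction of entries in \<open>S\<close>.
  This fraction is at most \<open>1\<close> on the tables where it exceeds its typical value by \<open>s\<close>, and these tables
  are rare by Hoeffding's inequality and conditional uniformity.\<close>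

lemma card_tables_entry_ratio_le:
  fixes w :: "'a \<Rightarrow> real" and s :: real
  assumes fin: "finite I" and w: "\<And>i. i \<in> I \<Longrightarrow> 0 < w i \<and> w i < 1"
    and X: "X \<subseteq> I" "a \<in> X" "\<And>i. i \<in> X \<Longrightarrow> r i = r a \<and> w i = w a"
    and Y: "Y \<subseteq> I" "b \<in> Y" "\<And>j. j \<in> Y \<Longrightarrow> c j = c b \<and> w j = w b"
    and s: "s \<ge> 0" and ne: "tables I I r c \<noteq> {}"
  shows "real (card {f \<in> tables I I r c. f (a, b) \<in> S}) / real (card (tables I I r c)) \<le>
    measure_pmf.prob (geometric_pmf (1 - w a * w b)) S + s +
    exp (- 2 * real (card X * card Y) * s\<^sup>2) / measure_pmf.prob (random_table I w) (tables I I r c)"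
proof -
  define T where "T = tables I I r c"
  define A where "A = X \<times> Y"
  define \<mu> where "\<mu> = measure_pmf.prob (geometric_pmf (1 - w a * w b)) S"
  define N where "N = (\<lambda>f :: 'a \<times> 'a \<Rightarrow> nat. \<Sum>p\<in>A. indicator S (f p) :: real)"
  define G where "G = {f. N f / card A \<ge> \<mu> + s}"
  have finT: "finite T" and T0: "card T > 0"
    using finite_tables[OF fin fin, of r c] ne by (auto simp: T_def card_gt_0_iff)
  have A: "A \<subseteq> I \<times> I" "A \<noteq> {}" "card A = card X * card Y" using X Y by (auto simp: A_def card_cartesian_product)
  have finA: "finite A" using A fin finite_subset by blast
  then have A0: "card A > 0" using A(2) by (metis card_gt_0_iff)
  have N_le: "N f \<le> card A" for f
    using sum_mono[of A "\<lambda>p. indicator S (f p)" "\<lambda>_. 1 :: real"] by (simp add: N_def)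
  have \<mu>s: "\<mu> + s \<ge> 0" using s by (simp add: \<mu>_def)
  have same: "card {f \<in> T. f p \<in> S} = card {f \<in> T. f (a, b) \<in> S}" if pA: "p \<in> A" for p
  proof -
    obtain i j where p: "p = (i, j)" by force
    then have i: "i \<in> X" and j: "j \<in> Y" using pA by (auto simp: A_def)
    have "a \<in> I" "i \<in> I" "b \<in> I" "j \<in> I" using X(1,2) Y(1,2) i j by auto
    moreover have "r a = r i" "c b = c j" using X(3)[OF i] Y(3)[OF j] by simp_all
    ultimately show ?thesis
      unfolding T_def p by (intro antisym card_tables_entry_le fin) auto
  qed
  have "card A * real (card {f \<in> T. f (a, b) \<in> S}) = (\<Sum>p\<in>A. real (card {f \<in> T. f p \<in> S}))"
    using same by simp
  also have "\<dots> = (\<Sum>p\<in>A. \<Sum>f\<in>T. indicator S (f p))"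
  proof (intro sum.cong refl)
    fix p assume "p \<in> A"
    have "(\<Sum>f\<in>T. indicator S (f p) :: real) = (\<Sum>f\<in>{f\<in>T. f p \<in> S}. 1)"
      using finT by (intro sum.mono_neutral_cong_right) (auto simp: indicator_def)
    then show "real (card {f \<in> T. f p \<in> S}) = (\<Sum>f\<in>T. indicator S (f p))" by simp
  qed
  also have "\<dots> = (\<Sum>f\<in>T. N f)" unfolding N_def by (rule sum.swap)
  also have "\<dots> \<le> (\<Sum>f\<in>T. card A * (\<mu> + s) + (if f \<in> G then real (card A) else 0))"
  proof (rule sum_mono)
    fix f assume "f \<in> T"
    show "N f \<le> card A * (\<mu> + s) + (if f \<in> G then real (card A) else 0)"
    proof (cases "f \<in> G")
      case True
      then show ?thesis using N_le[of f] \<mu>s by (simp add: add_increasing)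
    next
      case False
      then have "N f / card A < \<mu> + s" by (simp add: G_def)
      then have "N f < (\<mu> + s) * card A" using A0 by (simp add: divide_less_eq)
      then show ?thesis using False by (simp add: mult.commute)
    qed
  qed
  also have "\<dots> = card A * (card T * (\<mu> + s) + card (T \<inter> G))"
    using finT by (simp add: sum.distrib sum.If_cases Int_def algebra_simps)
  finally have "real (card {f \<in> T. f (a, b) \<in> S}) \<le> card T * (\<mu> + s) + card (T \<inter> G)"
    using A0 by simp
  then have "real (card {f \<in> T. f (a, b) \<in> S}) / card T \<le> (card T * (\<mu> + s) + card (T \<inter> G)) / card T"
    by (intro divide_right_mono) auto
  also have "\<dots> = \<mu> + s + real (card (T \<inter> G)) / card T"
    using T0 by (simp add: field_simps)
  also have "real (card (T \<inter> G)) / card T =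
      measure_pmf.prob (random_table I w) (T \<inter> G) / measure_pmf.prob (random_table I w) T"
    unfolding T_def by (rule card_ratio_eq_prob_ratio[OF fin w]) auto
  finally have 1: "real (card {f \<in> T. f (a, b) \<in> S}) / card T \<le> \<mu> + s +
      measure_pmf.prob (random_table I w) (T \<inter> G) / measure_pmf.prob (random_table I w) T" .
  have "measure_pmf.prob (random_table I w) (T \<inter> G) \<le> measure_pmf.prob (random_table I w) G"
    by (intro measure_pmf.finite_measure_mono) auto
  also have "\<dots> \<le> exp (- 2 * real (card A) * s\<^sup>2)"
    unfolding G_def N_def \<mu>_def
  proof (rule random_table_Hoeffding[OF fin w A(1,2) _ s])
    fix p assume p: "p \<in> A"
    show "w (fst p) * w (snd p) = w a * w b"
      using X(3)[of "fst p"] Y(3)[of "snd p"] p unfolding A_def mem_Times_iff by simp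
  qed
  finally have 2: "measure_pmf.prob (random_table I w) (T \<inter> G) / measure_pmf.prob (random_table I w) T \<le>
      exp (- 2 * real (card A) * s\<^sup>2) / measure_pmf.prob (random_table I w) T"
    by (intro divide_right_mono measure_nonneg)
  show ?thesis
    using 1 2 unfolding A(3) T_def \<mu>_def by linarith
qed

text \<open>The preceding bound is one-sided, which suffices: the total variation distance is twice the excess of
  probability on the set where the entry has the larger point probabilities.\<close>

lemma dTV_entry_le:
  fixes w :: "nat \<Rightarrow> real" and s :: real
  assumes m: "m = num_heavy n \<delta>"
    and I: "I = {..<m + n}" and w: "\<And>i. i \<in> I \<Longrightarrow> 0 < w i \<and> w i < 1"
    and X: "X \<subseteq> I" "a \<in> X" "\<And>i. i \<in> X \<Longrightarrow> margin n \<delta> B C i = margin n \<delta> B C a \<and> w i = w a"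
    and Y: "Y \<subseteq> I" "b \<in> Y" "\<And>j. j \<in> Y \<Longrightarrow> margin n \<delta> B C j = margin n \<delta> B C b \<and> w j = w b"
    and s: "s \<ge> 0"
  shows "dTV (entry_pmf n \<delta> B C (a + 1) (b + 1)) (geometric_pmf (1 - w a * w b)) \<le>
    2 * (s + exp (- 2 * real (card X * card Y) * s\<^sup>2) /
      measure_pmf.prob (random_table I w) (tables I I (margin n \<delta> B C) (margin n \<delta> B C)))"
proof -
  define t where "t = margin n \<delta> B C"
  define T where "T = tables I I t t"
  define N where "N = m + n"
  define h where "h = (\<lambda>X :: nat mat. \<lambda>p. if p \<in> I \<times> I then X $$ p else 0)"
  have finI: "finite I" by (simp add: I)
  have ab: "a < N" "b < N" using X Y by (auto simp: I N_def)
  have CT: "contingency_tables n \<delta> B C = {X \<in> carrier_mat N N.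
          (\<forall>i<N. (\<Sum>j<N. X $$ (i, j)) = t i) \<and> (\<forall>j<N. (\<Sum>i<N. X $$ (i, j)) = t j)}"
    by (simp add: contingency_tables_def Let_def N_def t_def m)
  have bij: "bij_betw h (contingency_tables n \<delta> B C) T"
  proof (rule bij_betw_byWitness[where f' = "\<lambda>f. mat N N f"])
    show "\<forall>X\<in>contingency_tables n \<delta> B C. mat N N (h X) = X"
      by (auto simp: CT h_def I N_def intro!: eq_matI)
    show "\<forall>f\<in>T. h (mat N N f) = f"
      by (auto simp: T_def tables_def h_def I N_def fun_eq_iff)
    show "h ` contingency_tables n \<delta> B C \<subseteq> T"
      by (auto simp: T_def tables_def CT h_def I N_def)
    show "(\<lambda>f. mat N N f) ` T \<subseteq> contingency_tables n \<delta> B C"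
      by (auto simp: T_def tables_def CT I N_def)
  qed
  have ne: "T \<noteq> {}" using bij contingency_tables_nonempty[of n \<delta> B C]
    by (metis bij_betw_empty2)
  have prob: "measure_pmf.prob (entry_pmf n \<delta> B C (a + 1) (b + 1)) S =
      real (card {f \<in> T. f (a, b) \<in> S}) / real (card T)" for S
  proof -
    have "measure_pmf.prob (entry_pmf n \<delta> B C (a + 1) (b + 1)) S =
        measure_pmf.prob (pmf_of_set (contingency_tables n \<delta> B C)) {X. X $$ (a, b) \<in> S}"
      by (simp add: entry_pmf_def vimage_def)
    also have "\<dots> = real (card (contingency_tables n \<delta> B C \<inter> {X. X $$ (a, b) \<in> S})) / card (contingency_tables n \<delta> B C)"
      by (rule measure_pmf_of_set) (auto simp: finite_contingency_tables contingency_tables_nonempty)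
    also have "card (contingency_tables n \<delta> B C) = card T" by (rule bij_betw_same_card[OF bij])
    also have "card (contingency_tables n \<delta> B C \<inter> {X. X $$ (a, b) \<in> S}) = card {f \<in> T. f (a, b) \<in> S}"
    proof (rule bij_betw_same_card)
      have "h ` (contingency_tables n \<delta> B C \<inter> {X. X $$ (a, b) \<in> S}) = {f \<in> T. f (a, b) \<in> S}"
      proof -
        have "h X (a, b) = X $$ (a, b)" for X using ab by (simp add: h_def I N_def)
        then have "h ` (contingency_tables n \<delta> B C \<inter> {X. X $$ (a, b) \<in> S}) =
            {f \<in> h ` contingency_tables n \<delta> B C. f (a, b) \<in> S}" by auto
        then show ?thesis by (simp only: bij_betw_imp_surj_on[OF bij])
      qed
      then show "bij_betw h (contingency_tables n \<delta> B C \<inter> {X. X $$ (a, b) \<in> S}) {f \<in> T. f (a, b) \<in> S}"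
        by (rule bij_betw_subset[OF bij inf_le1])
    qed
    finally show ?thesis .
  qed
  have "real (card {f \<in> T. f (a, b) \<in> S}) / real (card T) \<le>
    measure_pmf.prob (geometric_pmf (1 - w a * w b)) S + s +
    exp (- 2 * real (card X * card Y) * s\<^sup>2) / measure_pmf.prob (random_table I w) T" for S
    unfolding T_def
    by (rule card_tables_entry_ratio_le[OF finI w X(1,2) _ Y(1,2) _ s])
      (use X(3) Y(3) ne in \<open>auto simp: t_def T_def\<close>)
  note * = this[of "{x. pmf (geometric_pmf (1 - w a * w b)) x < pmf (entry_pmf n \<delta> B C (a + 1) (b + 1)) x}"]
  show ?thesis
    unfolding dTV_def infsum_pmf_diff prob t_def[symmetric] T_def[symmetric]
    using * by argo
qed

section \<open>A lower bound for the probability of the margins\<close>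

lemma real_nat_floor_bounds:
  fixes u :: real assumes "u \<ge> 0"
  shows "u - 1 \<le> real (nat \<lfloor>u\<rfloor>)" "real (nat \<lfloor>u\<rfloor>) \<le> u"
  using assms by linarith+

lemma margin_by_block: "margin n \<delta> B C = by_block {..<num_heavy n \<delta>} (nat \<lfloor>B * C * n\<rfloor>) (nat \<lfloor>C * n\<rfloor>)"
  by (auto simp: margin_def by_block_def fun_eq_iff)

definition prob_margins :: "real \<Rightarrow> real \<Rightarrow> nat \<Rightarrow> nat \<Rightarrow> real \<Rightarrow> real \<Rightarrow> real" where
  "prob_margins B C n m x y = measure_pmf.prob (random_table ({..<m} \<union> {m..<m + n}) (by_block {..<m} x y))
     (let t = by_block {..<m} (nat \<lfloor>B * C * n\<rfloor>) (nat \<lfloor>C * n\<rfloor>) in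
      tables ({..<m} \<union> {m..<m + n}) ({..<m} \<union> {m..<m + n}) t t)"

text \<open>Weights for which the lower bound on \<open>prob_margins\<close> works with constants that do not depend on \<open>n\<close>.\<close>

definition usable_weights :: "real \<Rightarrow> real \<Rightarrow> real \<Rightarrow> nat \<Rightarrow> nat \<Rightarrow> nat \<Rightarrow> real \<Rightarrow> real \<Rightarrow> bool" where
  "usable_weights B C c K n m x y \<longleftrightarrow> 0 < x \<and> x < 1 \<and> 0 < y \<and> y < 1 \<and> c \<le> x * y \<and> m \<le> n \<and>
     1 / 2 \<le> measure_pmf.prob (random_table ({..<m} \<union> {m..<m + n}) (by_block {..<m} x y))
       (near_margins {..<m} {m..<m + n} (m * nat \<lfloor>B * C * n\<rfloor>) (n * nat \<lfloor>C * n\<rfloor>) (K * n))"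

text \<open>The number of margins is at most \<open>(n ^ 3) ^ (4 * n) = exp (12 * n * ln n)\<close>, and the loss of weight
  \<open>(x * y) ^ (2 * K0 * n)\<close> is only exponential in \<open>n\<close>.\<close>

lemma prob_tables_ge_exp:
  fixes B C c0 :: real and K0 :: nat
  assumes BC: "B > 0" "C > 0" and c0: "0 < c0" "c0 \<le> 1"
  shows "\<exists>K \<ge> 1. \<forall>\<^sub>F n in sequentially. \<forall>m x y.
     usable_weights B C c0 K0 n m x y \<longrightarrow>
     exp (- K * (n * ln n)) \<le> prob_margins B C n m x y"
proof (intro exI conjI)
  define a where "a = - ln c0"
  \<comment> \<open>\<open>12\<close> for the number of margins, \<open>1\<close> for the factor \<open>1/2\<close>, the rest for the loss of weight\<close>
  define K where "K = 13 + 2 * K0 * a"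
  have a: "a \<ge> 0" using c0 by (simp add: a_def)
  show "K \<ge> 1" using a by (simp add: K_def)
  have ev1: "\<forall>\<^sub>F n in sequentially. real n ^ 2 * (B * C + C) + 1 \<le> real n ^ 3" by real_asymp
  have ev2: "\<forall>\<^sub>F n in sequentially. real n \<le> n * ln n" by real_asymp
  show "\<forall>\<^sub>F n in sequentially. \<forall>m x y.
     usable_weights B C c0 K0 n m x y \<longrightarrow>
     exp (- K * (n * ln n)) \<le> prob_margins B C n m x y"
    using ev1 ev2 eventually_ge_at_top[of 1]
  proof eventually_elim
    case (elim n)
    show ?case
    proof (intro allI impI)
      fix m x y
      assume usable: "usable_weights B C c0 K0 n m x y"
      define D where "D = K0 * n"
      have asm: "0 < x \<and> x < 1 \<and> 0 < y \<and> y < 1 \<and> c0 \<le> x * y \<and> m \<le> n \<and> D \<le> K0 * n \<and>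
       1 / 2 \<le> measure_pmf.prob (random_table ({..<m} \<union> {m..<m + n}) (by_block {..<m} x y))
         (near_margins {..<m} {m..<m + n} (m * nat \<lfloor>B * C * n\<rfloor>) (n * nat \<lfloor>C * n\<rfloor>) D)"
        using usable unfolding usable_weights_def D_def by auto
      define tH tL where "tH = nat \<lfloor>B * C * n\<rfloor>" and "tL = nat \<lfloor>C * n\<rfloor>"
      define I where "I = {..<m} \<union> {m..<m + n}"
      define t where "t = by_block {..<m} tH tL"
      define p where "p = measure_pmf.prob (random_table I (by_block {..<m} x y)) (tables I I t t)"
      define M where "M = m * tH + n * tL"
      have fl: "real tH \<le> B * C * n" "real tL \<le> C * n"
        using real_nat_floor_bounds[of "B * C * n"] real_nat_floor_bounds[of "C * n"] BC
        by (auto simp: tH_def tL_def)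
      have n: "ln (real n) \<ge> 0" using elim(3) by simp
      have main: "measure_pmf.prob (random_table I (by_block {..<m} x y)) (near_margins {..<m} {m..<m + n} (m * tH) (n * tL) D) * (x * y) ^ (2 * D)
          \<le> real (M + 1) ^ (2 * card I) * p"
        using prob_near_margins_le[of "{..<m}" "{m..<m+n}" I x y t tH tL _ M D] asm
        by (simp add: I_def t_def M_def p_def ivl_disj_int)
      have "1 / 2 * (x * y) ^ (2 * D) \<le> real (M + 1) ^ (2 * card I) * p"
        using asm by (intro order.trans[OF mult_right_mono main]) (auto simp: I_def tH_def tL_def)
      moreover have "(x * y) ^ (2 * D) \<ge> exp (- (2 * K0 * a) * n)"
      proof -
        have "exp (- (2 * K0 * a) * n) = exp (real (2 * (K0 * n)) * ln c0)" by (simp add: a_def algebra_simps)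
        also have "\<dots> = c0 ^ (2 * (K0 * n))" using c0 by (simp only: exp_of_nat_mult exp_ln)
        also have "\<dots> \<le> c0 ^ (2 * D)" using asm c0 by (intro power_decreasing) auto
        also have "\<dots> \<le> (x * y) ^ (2 * D)" using asm c0 by (intro power_mono) auto
        finally show ?thesis .
      qed
      moreover have "real (M + 1) ^ (2 * card I) \<le> exp (12 * (n * ln n))"
      proof -
        have "real (M + 1) = m * real tH + n * real tL + 1" by (simp add: M_def)
        also have "\<dots> \<le> n * (B * C * n) + n * (C * n) + 1"
          using fl asm by (intro add_mono mult_mono) auto
        also have "\<dots> = real n ^ 2 * (B * C + C) + 1" by (simp add: power2_eq_square algebra_simps)
        also have "\<dots> \<le> real n ^ 3" by (rule elim(1))
        finally have M3: "real (M + 1) \<le> real n ^ 3" .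
        have "card I = m + n" by (simp add: I_def card_Un_disjoint ivl_disj_int)
        then have "2 * card I \<le> 4 * n" using asm by simp
        have "real (M + 1) ^ (2 * card I) \<le> real (M + 1) ^ (4 * n)"
          using \<open>2 * card I \<le> 4 * n\<close> by (intro power_increasing) auto
        also have "\<dots> \<le> (real n ^ 3) ^ (4 * n)" using M3 by (intro power_mono) auto
        also have "\<dots> = exp (ln (real n)) ^ (12 * n)" using elim(3) by (simp flip: power_mult)
        also have "\<dots> = exp (real (12 * n) * ln n)" by (simp only: exp_of_nat_mult)
        finally show ?thesis by (simp add: mult.assoc)
      qed
      moreover have "p \<ge> 0" by (simp add: p_def)
      ultimately have "1 / 2 * exp (- (2 * K0 * a) * n) \<le> exp (12 * (n * ln n)) * p"
        using mult_right_mono[of "real (M + 1) ^ (2 * card I)" "exp (12 * (n * ln n))" p] by linarith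
      then have "exp (- 12 * (n * ln n)) * (1 / 2 * exp (- (2 * K0 * a) * n)) \<le> exp (- 12 * (n * ln n)) * (exp (12 * (n * ln n)) * p)"
        by (intro mult_left_mono) auto
      also have "\<dots> = p" by (simp flip: exp_add mult.assoc)
      finally have p1: "exp (- 12 * (n * ln n)) * (1 / 2 * exp (- (2 * K0 * a) * n)) \<le> p" .
      have half: "exp (- (n * ln n)) \<le> (1 / 2 :: real)"
      proof -
        have "exp (1 :: real) \<ge> 2" using exp_ge_add_one_self[of 1] by simp
        have "1 \<le> n * ln n" using elim(2,3) by linarith
        then have "exp (- (n * ln n)) \<le> exp (-1 :: real)" by simp
        also have "\<dots> \<le> 1 / 2" using \<open>exp 1 \<ge> 2\<close> by (simp add: exp_minus field_simps)
        finally show ?thesis .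
      qed
      have "exp (- K * (n * ln n)) = exp (- 12 * (n * ln n)) * (exp (- (n * ln n)) * exp (- (2 * K0 * a) * (n * ln n)))"
        unfolding K_def by (simp add: algebra_simps flip: exp_add)
      also have "\<dots> \<le> exp (- 12 * (n * ln n)) * (1 / 2 * exp (- (2 * K0 * a) * n))"
        using half elim(2) a by (intro mult_left_mono mult_mono) (auto intro!: mult_left_mono)
      also have "\<dots> \<le> p" by (rule p1)
      finally show "exp (- K * (n * ln n)) \<le> prob_margins B C n m x y"
        by (simp add: prob_margins_def p_def I_def t_def tH_def tL_def Let_def)
    qed
  qed
qed

lemma dTV_entries_le:
  fixes x y zhh zhl zll e s :: real
  assumes xy: "0 < x" "x < 1" "0 < y" "y < 1"
    and m: "m = num_heavy n \<delta>" "1 \<le> m" "m \<le> n"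
    and z: "zhh > 0" "zhl > 0" "zll > 0"
       "x * x = geom_ratio zhh" "x * y = geom_ratio zhl" "y * y = geom_ratio zll"
    and e: "0 < e" "e \<le> prob_margins B C n m x y"
    and s: "s \<ge> 0"
  shows "dTV (entry_pmf n \<delta> B C (n + 1) (n + 1)) (Geom zll) \<le> 2 * (s + exp (- 2 * real (n * n) * s\<^sup>2) / e)"
    and "dTV (entry_pmf n \<delta> B C 1 (n + 1)) (Geom zhl) \<le> 2 * (s + exp (- 2 * real (m * n) * s\<^sup>2) / e)"
    and "dTV (entry_pmf n \<delta> B C 1 1) (Geom zhh) \<le> 2 * (s + exp (- 2 * real (m * m) * s\<^sup>2) / e)"
proof -
  define I where "I = {..<m + n}"
  define w where "w = by_block {..<m} x y"
  define p where "p = measure_pmf.prob (random_table I w) (tables I I (margin n \<delta> B C) (margin n \<delta> B C))"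
  have I: "{..<m} \<union> {m..<m + n} = I" by (auto simp: I_def)
  have ep: "e \<le> p" using e(2) unfolding prob_margins_def I Let_def p_def w_def margin_by_block m(1)[symmetric] .
  have w: "0 < w i \<and> w i < 1" for i using xy by (simp add: w_def by_block_def)
  have gen: "dTV (entry_pmf n \<delta> B C (a + 1) (b + 1)) (geometric_pmf (1 - w a * w b)) \<le> 2 * (s + exp (- 2 * real (k * l) * s\<^sup>2) / e)"
    if "(X = {..<m} \<and> k = m \<or> X = {m..<m + n} \<and> k = n) \<and> a \<in> X" "(Y = {..<m} \<and> l = m \<or> Y = {m..<m + n} \<and> l = n) \<and> b \<in> Y" for X Y a b k l
  proof -
    have X: "X \<subseteq> I" "\<And>i. i \<in> X \<Longrightarrow> margin n \<delta> B C i = margin n \<delta> B C a \<and> w i = w a" "card X = k"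
      and Y: "Y \<subseteq> I" "\<And>i. i \<in> Y \<Longrightarrow> margin n \<delta> B C i = margin n \<delta> B C b \<and> w i = w b" "card Y = l"
      using that unfolding margin_by_block m(1)[symmetric] by (auto simp: I_def w_def by_block_def)
    have "dTV (entry_pmf n \<delta> B C (a + 1) (b + 1)) (geometric_pmf (1 - w a * w b)) \<le> 2 * (s + exp (- 2 * real (k * l) * s\<^sup>2) / p)"
      unfolding X(3)[symmetric] Y(3)[symmetric] p_def
      by (rule dTV_entry_le[OF m(1) I_def w X(1) _ X(2) Y(1) _ Y(2) s]) (use that in auto)
    also have "\<dots> \<le> 2 * (s + exp (- 2 * real (k * l) * s\<^sup>2) / e)"
      using ep e(1) by (intro mult_left_mono add_left_mono divide_left_mono) auto
    finally show ?thesis .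
  qed
  have w0: "w 0 = x" "w n = y" using m by (auto simp: w_def by_block_def)
  show "dTV (entry_pmf n \<delta> B C (n + 1) (n + 1)) (Geom zll) \<le> 2 * (s + exp (- 2 * real (n * n) * s\<^sup>2) / e)"
    using gen[of "{m..<m+n}" n n "{m..<m+n}" n n] m z by (simp add: w0 Geom_eq_geometric_pmf)
  show "dTV (entry_pmf n \<delta> B C 1 (n + 1)) (Geom zhl) \<le> 2 * (s + exp (- 2 * real (m * n) * s\<^sup>2) / e)"
    using gen[of "{..<m}" m 0 "{m..<m+n}" n n] m z by (simp add: w0 Geom_eq_geometric_pmf)
  show "dTV (entry_pmf n \<delta> B C 1 1) (Geom zhh) \<le> 2 * (s + exp (- 2 * real (m * m) * s\<^sup>2) / e)"
    using gen[of "{..<m}" m 0 "{..<m}" m 0] m z by (simp add: w0 Geom_eq_geometric_pmf)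
qed

section \<open>Balanced means\<close>

lemma num_heavy_bounds:
  assumes "0 \<le> \<delta>" "\<delta> \<le> 1" "n \<ge> 1"
  shows "1 \<le> num_heavy n \<delta>" "num_heavy n \<delta> \<le> n" "real (num_heavy n \<delta>) \<le> n powr \<delta>" "n powr \<delta> / 2 \<le> real (num_heavy n \<delta>)"
proof -
  have 1: "1 \<le> real n powr \<delta>" using assms by (simp add: ge_one_powr_ge_zero)
  have 2: "real n powr \<delta> \<le> real n" using assms powr_mono[of \<delta> 1 "real n"] by simp
  have 3: "real n powr \<delta> - 1 < real (num_heavy n \<delta>)" "real (num_heavy n \<delta>) \<le> n powr \<delta>"
    unfolding num_heavy_def using 1 by linarith+
  show "1 \<le> num_heavy n \<delta>" using 1 by (simp add: num_heavy_def le_nat_floor)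
  then have "1 \<le> real (num_heavy n \<delta>)" by simp
  then show "n powr \<delta> / 2 \<le> real (num_heavy n \<delta>)" using 3 by linarith
  have "real (num_heavy n \<delta>) \<le> real n" using 3 2 by linarith
  then show "num_heavy n \<delta> \<le> n" by simp
  show "real (num_heavy n \<delta>) \<le> n powr \<delta>" by (rule 3)
qed

lemma heavy_ratio_bounds:
  assumes "0 < \<delta>" "\<delta> < 1" "n \<ge> 1"
  shows "real (num_heavy n \<delta>) / n \<le> real n powr (\<delta> - 1)" "1 / real (num_heavy n \<delta>) \<le> 2 * real n powr (- \<delta>)"
    "1 / real n \<le> real n powr (\<delta> - 1)"
proof -
  note b = num_heavy_bounds[of \<delta> n]
  have p: "real n powr \<delta> > 0" using assms by simp
  show "real (num_heavy n \<delta>) / n \<le> real n powr (\<delta> - 1)"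
    using b assms by (simp add: powr_diff divide_right_mono)
  have "1 / real (num_heavy n \<delta>) \<le> 1 / (real n powr \<delta> / 2)"
    using b p assms by (intro divide_left_mono) auto
  then show "1 / real (num_heavy n \<delta>) \<le> 2 * real n powr (- \<delta>)" by (simp add: powr_minus divide_simps)
  have "real n powr 0 \<le> real n powr \<delta>" using assms by (intro powr_mono) auto
  then show "1 / real n \<le> real n powr (\<delta> - 1)" using assms by (simp add: powr_diff divide_right_mono)
qed

lemma heavy_light_tendsto:
  fixes K K' :: real
  assumes "0 < \<delta>" "\<delta> < 1"
  shows "(\<lambda>n. K / num_heavy n \<delta> + K' / n) \<longlonglongrightarrow> 0"
    and "(\<lambda>n. K / n + K' * (num_heavy n \<delta> / n)) \<longlonglongrightarrow> 0"
proof -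
  have a: "(\<lambda>n. 1 / num_heavy n \<delta>) \<longlonglongrightarrow> 0"
  proof (rule tendsto_sandwich[OF _ _ tendsto_const])
    show "(\<lambda>n. 2 * real n powr (- \<delta>)) \<longlonglongrightarrow> 0" using assms by real_asymp
    show "\<forall>\<^sub>F n in sequentially. 1 / num_heavy n \<delta> \<le> 2 * real n powr (- \<delta>)"
      by (rule eventually_mono[OF eventually_ge_at_top[of 1]]) (use heavy_ratio_bounds assms in auto)
  qed simp
  have b: "(\<lambda>n. num_heavy n \<delta> / n) \<longlonglongrightarrow> 0"
  proof (rule tendsto_sandwich[OF _ _ tendsto_const])
    show "(\<lambda>n. real n powr (\<delta> - 1)) \<longlonglongrightarrow> 0" using assms by real_asymp
    show "\<forall>\<^sub>F n in sequentially. num_heavy n \<delta> / n \<le> real n powr (\<delta> - 1)"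
      by (rule eventually_mono[OF eventually_ge_at_top[of 1]]) (use heavy_ratio_bounds assms in auto)
  qed simp
  have c: "(\<lambda>n. 1 / real n) \<longlonglongrightarrow> 0" by real_asymp
  show "(\<lambda>n. K / num_heavy n \<delta> + K' / n) \<longlonglongrightarrow> 0"
    using tendsto_add[OF tendsto_mult_right_zero[OF a, of K] tendsto_mult_right_zero[OF c, of K']] by simp
  show "(\<lambda>n. K / n + K' * (num_heavy n \<delta> / n)) \<longlonglongrightarrow> 0"
    using tendsto_add[OF tendsto_mult_right_zero[OF c, of K] tendsto_mult_right_zero[OF b, of K']] by simp
qed

text \<open>The first equation says that the three ratios have the form \<open>x * x\<close>, \<open>x * y\<close> and \<open>y * y\<close>. The other two say
  that the expected sums of a heavy and of a light row fall short of \<open>B * C * n\<close> and \<open>C * n\<close> by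
  \<open>K * n / m + 1\<close> and \<open>K + 1\<close>. Summed over the block, the shortfall is \<open>K * n\<close>, which is to dominate the
  standard deviation of the block total, plus one unit per row, which covers the rounding of the margins.\<close>

definition balanced_means :: "real \<Rightarrow> real \<Rightarrow> real \<Rightarrow> nat \<Rightarrow> nat \<Rightarrow> real \<Rightarrow> real \<Rightarrow> real \<Rightarrow> bool" where
  "balanced_means B C K n m h zh zl \<longleftrightarrow> h > 0 \<and> zh > 0 \<and> zl > 0 \<and>
     geom_ratio zh * geom_ratio zl = (geom_ratio h)\<^sup>2 \<and>
     n * h + m * zh = B * C * n - (K * n / m + 1) \<and>
     m * h + n * zl = C * n - (K + 1)"

text \<open>The linear equations express \<open>zh\<close> and \<open>zl\<close> as decreasing functions of \<open>h\<close>. At \<open>h = 0\<close> the product of their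
  ratios exceeds the squared ratio of \<open>h\<close>, and at the value of \<open>h\<close> where \<open>zh\<close> vanishes it is smaller.\<close>

lemma balanced_means_exist:
  fixes B C K :: real
  assumes m: "m > 0" and n: "n > 0" and BC: "B > 0" "C > 0" "K \<ge> 0"
    and H: "K * n / m + 1 < B * C * n" and L: "m * (B * C) + (K + 1) < C * n"
  shows "\<exists>h zh zl. balanced_means B C K n m h zh zl"
proof -
  define b where "b = B * C - (K * n / m + 1) / n"
  define zh where "zh = (\<lambda>h :: real. (b - h) * n / m)"
  define zl where "zl = (\<lambda>h :: real. (C * n - (K + 1) - m * h) / n)"
  define F where "F = (\<lambda>h. geom_ratio (zh h) * geom_ratio (zl h) - (geom_ratio h)\<^sup>2)"
  have b: "0 < b" "b \<le> B * C" using H n BC by (auto simp: b_def field_simps)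
  have zh0: "zh h \<ge> 0" if "h \<le> b" for h using that by (simp add: zh_def)
  have zl0: "zl h > 0" if "h \<le> b" for h :: real
  proof -
    have "m * h \<le> m * (B * C)" using that b by (intro mult_left_mono) auto
    then have "C * n - (K + 1) - m * h > 0" using L by linarith
    then show ?thesis using n by (simp add: zl_def)
  qed
  have contz: "continuous_on {0..b} zh" "continuous_on {0..b} zl"
    unfolding zh_def zl_def using m n by (auto intro!: continuous_intros)
  have cont: "continuous_on {0..b} F"
    unfolding F_def geom_ratio_def
  proof (intro continuous_intros contz)
    show "\<forall>h\<in>{0..b}. 1 + zh h \<noteq> 0" using zh0 by (smt (verit) atLeastAtMost_iff)
    show "\<forall>h\<in>{0..b}. 1 + zl h \<noteq> 0" using zl0 by (smt (verit) atLeastAtMost_iff)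
    show "\<forall>h\<in>{0..b}. 1 + h \<noteq> 0" by auto
  qed
  have F0: "F 0 > 0"
  proof -
    have "zh 0 > 0" "zl 0 > 0" using b m n zl0[of 0] by (auto simp: zh_def)
    then show ?thesis using geom_ratio_bounds(1) by (simp add: F_def geom_ratio_def)
  qed
  have Fb: "F b < 0"
    using b(1) by (simp add: F_def zh_def geom_ratio_def)
  obtain h where h: "0 \<le> h" "h \<le> b" "F h = 0"
    using IVT2'[of F b 0 0] F0 Fb b cont by auto
  then have h': "0 < h" "h < b" using F0 Fb by (auto simp: less_le)
  have "balanced_means B C K n m h (zh h) (zl h)"
    unfolding balanced_means_def
  proof (intro conjI)
    show "h > 0" by fact
    show "zh h > 0" using h' m n by (simp add: zh_def)
    show "zl h > 0" using h zl0 by simp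
    show "geom_ratio (zh h) * geom_ratio (zl h) = (geom_ratio h)\<^sup>2" using h by (simp add: F_def)
    have "m * zh h = (b - h) * n" using m by (simp add: zh_def)
    then have "n * h + m * zh h = n * b" by (simp add: algebra_simps)
    also have "\<dots> = B * C * n - (K * n / m + 1)" unfolding b_def right_diff_distrib using n by simp
    finally show "n * h + m * zh h = B * C * n - (K * n / m + 1)" .
    show "m * h + n * zl h = C * n - (K + 1)" using n by (simp add: zl_def)
  qed
  then show ?thesis by blast
qed

lemma balanced_means_bounds:
  fixes B C K :: real
  assumes bal: "balanced_means B C K n m h zh zl"
    and m: "m > 0" and n: "n > 0" and K: "K \<ge> 0"
  shows "h \<le> B * C" "m * zh \<le> B * C * n" "zl \<le> C"
    "C - zl \<le> (K + 1) / n + B * C * (m / n)"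
    "B * C - h = (K / m + 1 / n) + m / n * zh"
proof -
  have p: "h > 0" "zh > 0" "zl > 0" and eH: "n * h + m * zh = B * C * n - (K * n / m + 1)"
    and eL: "m * h + n * zl = C * n - (K + 1)"
    using bal by (auto simp: balanced_means_def)
  have Kn: "K * n / m \<ge> 0" using K by simp
  have "n * h \<le> n * (B * C)" using eH Kn p m
    by (smt (verit, best) mult.commute mult_nonneg_nonneg of_nat_0_le_iff)
  then show hBC: "h \<le> B * C" using n by simp
  show "m * zh \<le> B * C * n" using eH Kn p
    by (smt (verit, best) mult_nonneg_nonneg of_nat_0_le_iff)
  have "n * zl \<le> n * C" using eL K p
    by (smt (verit, best) mult.commute mult_nonneg_nonneg of_nat_0_le_iff)
  then show "zl \<le> C" using n by simp
  have "C - zl = (C * n - n * zl) / n" using n by (simp add: field_simps)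
  also have "C * n - n * zl = (K + 1) + h * m" using eL by (simp add: algebra_simps)
  finally have "C - zl = (K + 1) / n + h * (m / n)" by (simp add: add_divide_distrib)
  also have "(K + 1) / n + h * (m / n) \<le> (K + 1) / n + B * C * (m / n)"
    using hBC by (intro add_left_mono mult_right_mono) auto
  finally show "C - zl \<le> (K + 1) / n + B * C * (m / n)" .
  have "n * (B * C - h) = n * ((K / m + 1 / n) + m / n * zh)"
    using eH n by (simp add: algebra_simps)
  then show "B * C - h = (K / m + 1 / n) + m / n * zh" using n by simp
qed

text \<open>The mean \<open>h\<close> cannot be small: a small \<open>h\<close> would force \<open>zh\<close>, and hence the product of the two ratios, to
  be large. This keeps \<open>x * y\<close> away from \<open>0\<close>.\<close>

lemma balanced_means_ratio_lower:
  fixes B C K :: real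
  assumes bal: "balanced_means B C K n m h zh zl"
    and m: "m > 0" "m \<le> n" and BC: "B > 0" "C > 0" and K: "K \<ge> 0"
    and H: "K / m + 1 / n \<le> B * C / 4" and L: "(K + 1) / n + B * C * (m / n) \<le> C / 2"
  shows "geom_ratio h \<ge> min (geom_ratio (B * C / 4)) (sqrt (geom_ratio (B * C / 2) * geom_ratio (C / 2)))"
proof (cases "h \<le> B * C / 4")
  case False
  moreover have "h > 0" using bal by (simp add: balanced_means_def)
  ultimately have "geom_ratio (B * C / 4) \<le> geom_ratio h"
    using BC by (subst geom_ratio_le_iff) auto
  then show ?thesis by simp
next
  case True
  have n: "n > 0" using m by simp
  have p: "h > 0" "zh > 0" "zl > 0" and e: "geom_ratio zh * geom_ratio zl = (geom_ratio h)\<^sup>2"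
    using bal by (auto simp: balanced_means_def)
  note bd = balanced_means_bounds[OF bal m(1) n K]
  have zl: "zl \<ge> C / 2" using bd(4) L by linarith
  have "m / n * zh \<ge> B * C / 2" using bd(5) True H by linarith
  moreover have "m / n * zh \<le> 1 * zh" using m n p by (intro mult_right_mono) auto
  ultimately have zh: "zh \<ge> B * C / 2" by linarith
  have "geom_ratio (B * C / 2) * geom_ratio (C / 2) \<le> geom_ratio zh * geom_ratio zl"
    using zh zl p BC geom_ratio_le_iff[of "B * C / 2" zh] geom_ratio_le_iff[of "C / 2" zl]
      geom_ratio_bounds[of "C / 2"] geom_ratio_bounds[of zh]
    by (intro mult_mono) auto
  then have "sqrt (geom_ratio (B * C / 2) * geom_ratio (C / 2)) \<le> sqrt ((geom_ratio h)\<^sup>2)"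
    unfolding e by (rule real_sqrt_le_mono)
  then show ?thesis using geom_ratio_bounds[OF p(1)] by simp
qed

text \<open>Since \<open>m * zh\<close> is at most \<open>B * C * n\<close>, the variances of all block totals are \<open>O(n\<^sup>2)\<close>, even when \<open>zh\<close> is of
  order \<open>n / m\<close>; so deviations of order \<open>n\<close> suffice.\<close>

lemma balanced_means_near_margins:
  fixes B C :: real and K :: nat
  assumes bal: "balanced_means B C (real K) n m h zh zl"
    and m: "m > 0" "m \<le> n" and BC: "B > 0" "C > 0" and K: "8 * (1 + C + B * C) \<le> real K"
    and H: "H = {..<m}" and L: "L = {m..<m + n}"
    and x: "x = sqrt (geom_ratio zh)" and y: "y = sqrt (geom_ratio zl)"
  shows "measure_pmf.prob (random_table (H \<union> L) (by_block H x y))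
    (near_margins H L (m * nat \<lfloor>B * C * n\<rfloor>) (n * nat \<lfloor>C * n\<rfloor>) ((2 * K + 1) * n)) \<ge> 1 / 2"
proof -
  have n: "n > 0" using m by simp
  have p: "h > 0" "zh > 0" "zl > 0" and e: "geom_ratio zh * geom_ratio zl = (geom_ratio h)\<^sup>2"
    and eH: "n * h + m * zh = B * C * n - (K * n / m + 1)" and eL: "m * h + n * zl = C * n - (K + 1)"
    using bal by (auto simp: balanced_means_def)
  note bd = balanced_means_bounds[OF bal m(1) n]
  have q: "0 < geom_ratio zh" "geom_ratio zh < 1" "0 < geom_ratio zl" "geom_ratio zl < 1"
    using geom_ratio_bounds p by auto
  have xy: "x * x = geom_ratio zh" "y * y = geom_ratio zl" "x * y = geom_ratio h"
  proof -
    show "x * x = geom_ratio zh" "y * y = geom_ratio zl" using q by (auto simp: x y)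
    have "x * y = sqrt ((geom_ratio h)\<^sup>2)" unfolding e[symmetric] by (simp add: x y real_sqrt_mult)
    then show "x * y = geom_ratio h" using geom_ratio_bounds[OF p(1)] by simp
  qed
  define T where "T = (1 + C + B * C)"
  have T: "1 + B * C \<le> T" "1 + C \<le> T" "T > 0" using BC by (auto simp: T_def add_pos_pos)
  have sq: "a\<^sup>2 \<le> (c * T)\<^sup>2" if "0 \<le> a" "a \<le> c * T" for a c using that by (intro power_mono) auto
  have cards: "card H = m" "card L = n" by (auto simp: H L)
  have K32: "4 * (n * T)\<^sup>2 \<le> (real K * n)\<^sup>2 / 8"
  proof -
    have "8 * (n * T) \<le> real K * n" using mult_right_mono[OF K, of n] by (simp add: T_def mult_ac)
    then have "(8 * (n * T))\<^sup>2 \<le> (real K * n)\<^sup>2" using T by (intro power_mono) auto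
    then have "64 * (n * T)\<^sup>2 \<le> (real K * n)\<^sup>2" unfolding power_mult_distrib[of 8] by simp
    then show ?thesis using zero_le_power2[of "n * T"] by linarith
  qed
  have n1: "n * (1 + h) \<le> n * T" "n * (1 + zl) \<le> n * T"
    using bd(1,3) T by (auto intro!: mult_left_mono)
  have m1: "m * (1 + zh) \<le> n * T"
  proof -
    have "m * (1 + zh) \<le> n + B * C * n" using bd(2) m by (simp add: algebra_simps)
    also have "\<dots> = n * (1 + B * C)" by (simp add: algebra_simps)
    also have "\<dots> \<le> n * T" using T by (intro mult_left_mono) auto
    finally show ?thesis .
  qed
  have mn: "real m * n * (1 + h)\<^sup>2 \<le> (n * T)\<^sup>2"
  proof -
    have "real m * n * (1 + h)\<^sup>2 \<le> real n * n * (1 + h)\<^sup>2" using m by (intro mult_right_mono) auto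
    also have "\<dots> = (n * (1 + h))\<^sup>2" by (simp add: power2_eq_square)
    also have "\<dots> \<le> (n * T)\<^sup>2" using n1 p by (intro sq) auto
    finally show ?thesis .
  qed
  have VH: "card H * (card H * (2 * (1 + zh)\<^sup>2) + card L * (2 * (1 + h)\<^sup>2)) \<le> (real K * n)\<^sup>2 / 8"
  proof -
    have "(m * (1 + zh))\<^sup>2 \<le> (n * T)\<^sup>2" using m1 p by (intro sq) auto
    then have "2 * (m * (1 + zh))\<^sup>2 + 2 * (real m * n * (1 + h)\<^sup>2) \<le> 4 * (n * T)\<^sup>2" using mn by linarith
    then have "2 * (m * (1 + zh))\<^sup>2 + 2 * (real m * n * (1 + h)\<^sup>2) \<le> (real K * n)\<^sup>2 / 8" using K32 by linarith
    then show ?thesis by (simp add: cards power2_eq_square algebra_simps)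
  qed
  have VL: "card L * (card H * (2 * (1 + h)\<^sup>2) + card L * (2 * (1 + zl)\<^sup>2)) \<le> (real K * n)\<^sup>2 / 8"
  proof -
    have "(n * (1 + zl))\<^sup>2 \<le> (n * T)\<^sup>2" using n1 p by (intro sq) auto
    then have "2 * (n * (1 + zl))\<^sup>2 + 2 * (real m * n * (1 + h)\<^sup>2) \<le> 4 * (n * T)\<^sup>2" using mn by linarith
    then have "2 * (n * (1 + zl))\<^sup>2 + 2 * (real m * n * (1 + h)\<^sup>2) \<le> (real K * n)\<^sup>2 / 8" using K32 by linarith
    then show ?thesis by (simp add: cards power2_eq_square algebra_simps)
  qed
  define \<mu>H where "\<mu>H = card H * (card H * zh + card L * h)"
  define \<mu>L where "\<mu>L = card L * (card H * h + card L * zl)"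
  have \<mu>H: "\<mu>H = m * (B * C * n - 1) - K * n"
  proof -
    have "\<mu>H = m * (B * C * n - (K * n / m + 1))" unfolding eH[symmetric] by (simp add: \<mu>H_def cards algebra_simps)
    then show ?thesis using m by (simp add: algebra_simps)
  qed
  have \<mu>L: "\<mu>L = n * (C * n - 1) - K * n"
  proof -
    have "\<mu>L = n * (C * n - (K + 1))" unfolding eL[symmetric] by (simp add: \<mu>L_def cards)
    then show ?thesis by (simp add: algebra_simps)
  qed
  have fl: "B * C * n - 1 \<le> nat \<lfloor>B * C * n\<rfloor>" "nat \<lfloor>B * C * n\<rfloor> \<le> B * C * n"
      "C * n - 1 \<le> nat \<lfloor>C * n\<rfloor>" "nat \<lfloor>C * n\<rfloor> \<le> C * n"
    using real_nat_floor_bounds[of "B * C * n"] real_nat_floor_bounds[of "C * n"] BC by auto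
  have mfl: "m * (B * C * n - 1) \<le> m * nat \<lfloor>B * C * n\<rfloor>" "m * nat \<lfloor>B * C * n\<rfloor> \<le> m * (B * C * n)"
     "n * (C * n - 1) \<le> n * nat \<lfloor>C * n\<rfloor>" "n * nat \<lfloor>C * n\<rfloor> \<le> n * (C * n)"
    unfolding of_nat_mult using fl by (intro mult_left_mono; simp)+
  show ?thesis
  proof (rule prob_near_margins_ge_half[where zhh = zh and zhl = h and zll = zl and \<mu>H = \<mu>H and \<mu>L = \<mu>L
        and \<kappa>H = "real K * n" and \<kappa>L = "real K * n"])
    show "0 < x" "x < 1" "0 < y" "y < 1" using q by (auto simp: x y)
    show "zh = x * x / (1 - x * x)" "h = x * y / (1 - x * y)" "zl = y * y / (1 - y * y)"
      using p by (simp_all add: xy geom_ratio_odds)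
    have "8 * T \<le> real K" unfolding T_def by (rule K)
    then have "real K > 0" using T(3) by linarith
    then show "real K * n > 0" using n by simp
    then show "real K * n > 0" .
    show "\<mu>H + real K * n \<le> real (m * nat \<lfloor>B * C * n\<rfloor>)" using mfl(1) \<mu>H by simp
    show "\<mu>L + real K * n \<le> real (n * nat \<lfloor>C * n\<rfloor>)" using mfl(3) \<mu>L by simp
    show "real (m * nat \<lfloor>B * C * n\<rfloor>) \<le> \<mu>H - real K * n + real ((2 * K + 1) * n)"
    proof -
      have "\<mu>H - real K * n + real ((2 * K + 1) * n) = m * (B * C * n) + (n - m)"
        using m unfolding \<mu>H by (simp add: algebra_simps of_nat_diff)
      then show ?thesis using mfl(2) by linarith
    qed
    show "real (n * nat \<lfloor>C * n\<rfloor>) \<le> \<mu>L - real K * n + real ((2 * K + 1) * n)"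
    proof -
      have "\<mu>L - real K * n + real ((2 * K + 1) * n) = n * (C * n)"
        unfolding \<mu>L by (simp add: algebra_simps)
      then show ?thesis using mfl(4) by linarith
    qed
    show "finite H" "finite L" "H \<inter> L = {}" by (simp_all add: H L ivl_disj_int)
    show "\<mu>H = card H * (card H * zh + card L * h)" by (rule \<mu>H_def)
    show "\<mu>L = card L * (card H * h + card L * zl)" by (rule \<mu>L_def)
  qed (rule refl VH VL)+
qed

section \<open>Limits of the balanced means\<close>

text \<open>With \<open>r = sqrt (1 + 1 / C)\<close> both sides equal \<open>1 / r\<^sup>2\<close>. This equation is the reason for the critical value.\<close>

lemma geom_ratio_Bcrit:
  assumes "C > 0"
  shows "(geom_ratio (Bcrit C * C))\<^sup>2 = geom_ratio C"
proof -
  define r where "r = sqrt (1 + 1 / C)"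
  have r2: "C * r\<^sup>2 = C + 1" and r: "r > 0"
    using assms by (auto simp: r_def field_simps add_pos_pos)
  have "1 + Bcrit C * C = 1 + C + C * r" by (simp add: Bcrit_def r_def algebra_simps)
  also have "\<dots> = r * (Bcrit C * C)" using r2 by (simp add: Bcrit_def r_def[symmetric] power2_eq_square algebra_simps)
  finally have "geom_ratio (Bcrit C * C) = (Bcrit C * C) / (r * (Bcrit C * C))" by (simp add: geom_ratio_def)
  also have "Bcrit C * C \<noteq> 0" using assms r by (simp add: Bcrit_def r_def[symmetric])
  then have "(Bcrit C * C) / (r * (Bcrit C * C)) = 1 / r" by simp
  finally have "(geom_ratio (Bcrit C * C))\<^sup>2 = 1 / r\<^sup>2" by (simp add: power_divide)
  also have "1 / r\<^sup>2 = C / (C * r\<^sup>2)" using assms by simp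
  finally show ?thesis unfolding r2 by (simp add: geom_ratio_def add.commute)
qed

lemma Bcrit_pos: "C > 0 \<Longrightarrow> Bcrit C > 0"
  by (simp add: Bcrit_def add_pos_nonneg)

text \<open>The limiting mean in the corner solves the balance equation at \<open>h = B * C\<close> and \<open>zl = C\<close>.\<close>

lemma geom_ratio_corner_limit:
  assumes BC: "B > 0" "C > 0" and sub: "B < Bcrit C"
  defines "R \<equiv> B\<^sup>2 * (1 + C) / ((Bcrit C - B) * (B + Bcrit C - 2))"
  shows "R > 0" "geom_ratio R * geom_ratio C = (geom_ratio (B * C))\<^sup>2"
proof -
  define r where "r = sqrt (1 + 1 / C)"
  have r2: "C * r\<^sup>2 = C + 1" and r: "r > 1"
    using BC by (auto simp: r_def field_simps)
  define d where "d = (Bcrit C - B) * (B + Bcrit C - 2)"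
  have d0: "d > 0" using sub BC r by (simp add: d_def Bcrit_def r_def[symmetric])
  have Cd: "C * d = 1 + 2 * B * C - B\<^sup>2 * C"
    using r2 by (simp add: d_def Bcrit_def r_def[symmetric] power2_eq_square algebra_simps)
  have Rd: "R = B\<^sup>2 * (1 + C) / d" by (simp add: R_def d_def)
  show R0: "R > 0" using BC d0 by (simp add: Rd)
  have "geom_ratio R = B\<^sup>2 * (1 + C) / (d + B\<^sup>2 * (1 + C))"
    using d0 R0 by (simp add: geom_ratio_def Rd divide_simps)
  also have "\<dots> = C * (B\<^sup>2 * (1 + C)) / (C * (d + B\<^sup>2 * (1 + C)))" using BC by simp
  also have "C * (d + B\<^sup>2 * (1 + C)) = (1 + B * C)\<^sup>2"
    using Cd by (simp add: power2_eq_square algebra_simps)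
  finally have "geom_ratio R = C * (B\<^sup>2 * (1 + C)) / (1 + B * C)\<^sup>2" .
  then show "geom_ratio R * geom_ratio C = (geom_ratio (B * C))\<^sup>2"
    using BC by (simp add: geom_ratio_def power_divide power_mult_distrib power2_eq_square add_pos_pos)
qed

lemma subcritical_geom_ratio:
  assumes BC: "B > 0" "C > 0" and sub: "B < Bcrit C"
  shows "(geom_ratio (B * C))\<^sup>2 < geom_ratio C"
proof -
  have "0 < geom_ratio (B * C)" using BC by (intro geom_ratio_bounds) auto
  moreover have "geom_ratio (B * C) < geom_ratio (Bcrit C * C)"
  proof -
    have "B * C < Bcrit C * C" "0 < B * C" "0 < Bcrit C * C" using BC sub Bcrit_pos[of C] by auto
    then show ?thesis using geom_ratio_le_iff[of "Bcrit C * C" "B * C"] by (simp add: not_le[symmetric])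
  qed
  ultimately have "(geom_ratio (B * C))\<^sup>2 < (geom_ratio (Bcrit C * C))\<^sup>2" by (intro power_strict_mono) auto
  then show ?thesis using BC by (simp add: geom_ratio_Bcrit)
qed

text \<open>The ratio of \<open>zh\<close> is at most \<open>(q (B * C))\<^sup>2 / q zl\<close>, where \<open>q\<close> denotes \<open>geom_ratio\<close>, and \<open>q zl\<close> is at least
  the midpoint \<open>v\<close> of \<open>(q (B * C))\<^sup>2\<close> and \<open>q C\<close> once \<open>zl\<close> is near \<open>C\<close>. So the ratio stays below a constant
  \<open>w < 1\<close>.\<close>

lemma subcritical_heavy_mean:
  fixes B C K :: real
  assumes bal: "balanced_means B C K n m h zh zl" and m: "m > 0" and n: "n > 0" and K: "K \<ge> 0"
    and BC: "B > 0" "C > 0" and sub: "B < Bcrit C"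
  defines "v \<equiv> (geom_ratio C + (geom_ratio (B * C))\<^sup>2) / 2"
  defines "w \<equiv> (geom_ratio (B * C))\<^sup>2 / v"
  assumes u: "(K + 1) / n + B * C * (m / n) \<le> (geom_ratio C - (geom_ratio (B * C))\<^sup>2) / 2"
  shows "v \<le> geom_ratio zl" "zh \<le> w / (1 - w)" "w < 1" "w > 0" "v > 0"
proof -
  have p: "h > 0" "zh > 0" "zl > 0" and e: "geom_ratio zh * geom_ratio zl = (geom_ratio h)\<^sup>2"
    using bal by (auto simp: balanced_means_def)
  note bd = balanced_means_bounds[OF bal m n K]
  have q0: "geom_ratio (B * C) > 0" using BC by (intro geom_ratio_bounds) auto
  have lt: "(geom_ratio (B * C))\<^sup>2 < v" using subcritical_geom_ratio[OF BC sub] by (simp add: v_def)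
  then show v0: "v > 0" using q0 by (metis less_trans zero_less_power)
  show w: "w < 1" "w > 0" using lt v0 q0 by (auto simp: w_def)
  have "geom_ratio C - geom_ratio zl \<le> C - zl"
    using geom_ratio_lipschitz[of C zl] p BC bd(3) by linarith
  then show vl: "v \<le> geom_ratio zl" using bd(4) u unfolding v_def by argo
  have "geom_ratio zh * v \<le> geom_ratio zh * geom_ratio zl"
    using vl geom_ratio_bounds[OF p(2)] by (intro mult_left_mono) auto
  also have "\<dots> \<le> (geom_ratio (B * C))\<^sup>2"
    unfolding e using bd(1) p BC geom_ratio_le_iff[of h "B * C"] geom_ratio_bounds[of h] by (intro power_mono) auto
  finally have qw: "geom_ratio zh \<le> w" using v0 by (simp add: w_def le_divide_eq)
  have "zh = geom_ratio zh / (1 - geom_ratio zh)" using p by (simp add: geom_ratio_odds)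
  also have "\<dots> \<le> w / (1 - w)" using qw w geom_ratio_bounds[OF p(2)] by (intro frac_le) auto
  finally show "zh \<le> w / (1 - w)" .
qed

text \<open>The ratios of \<open>zh\<close> and \<open>R\<close> are \<open>(q h)\<^sup>2 / q zl\<close> and \<open>(q (B * C))\<^sup>2 / q C\<close>, where \<open>q\<close> denotes \<open>geom_ratio\<close>.
  As \<open>q\<close> is Lipschitz with constant \<open>1\<close> and the denominators are at least \<open>v\<close> and equal to \<open>q C\<close>, they are
  close; the factors \<open>1 + Z\<close> and \<open>1 + R\<close> arise when passing back from ratios to means.\<close>

lemma subcritical_corner:
  fixes B C K :: real
  assumes bal: "balanced_means B C K n m h zh zl" and m: "m > 0" and n: "n > 0" and K: "K \<ge> 0"
    and BC: "B > 0" "C > 0" and Z: "zh \<le> Z" and v: "v > 0" "v \<le> geom_ratio zl"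
    and R: "R > 0" "geom_ratio R * geom_ratio C = (geom_ratio (B * C))\<^sup>2"
  shows "\<bar>zh - R\<bar> \<le> (1 + Z) * (1 + R) / (v * geom_ratio C) * (2 * (B * C - h) + (C - zl))"
proof -
  have p: "h > 0" "zh > 0" "zl > 0" and e: "geom_ratio zh * geom_ratio zl = (geom_ratio h)\<^sup>2"
    using bal by (auto simp: balanced_means_def)
  note bd = balanced_means_bounds[OF bal m n K]
  have BC0: "B * C > 0" using BC by simp
  define gC gB gh gl where g: "gC = geom_ratio C" "gB = geom_ratio (B * C)" "gh = geom_ratio h" "gl = geom_ratio zl"
  have b: "0 < gC" "gC < 1" "0 < gB" "gB < 1" "0 < gh" "gh < 1" "0 < gl" "gl < 1"
    unfolding g using geom_ratio_bounds BC BC0 p by auto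
  have dC: "\<bar>gl - gC\<bar> \<le> C - zl"
    using geom_ratio_lipschitz[of zl C] p BC bd(3) unfolding g by linarith
  have dh: "\<bar>gh - gB\<bar> \<le> B * C - h"
    using geom_ratio_lipschitz[of h "B * C"] p BC0 bd(1) unfolding g by linarith
  have eR: "geom_ratio R = gB\<^sup>2 / gC" using R b by (simp add: g field_simps)
  have ez: "geom_ratio zh = gh\<^sup>2 / gl" using e b by (simp add: g field_simps)
  have "\<bar>geom_ratio zh - geom_ratio R\<bar> = \<bar>(gh\<^sup>2 - gB\<^sup>2) * gC - gB\<^sup>2 * (gl - gC)\<bar> / (gl * gC)"
  proof -
    have "geom_ratio zh - geom_ratio R = ((gh\<^sup>2 - gB\<^sup>2) * gC - gB\<^sup>2 * (gl - gC)) / (gl * gC)"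
      unfolding eR ez using b by (simp add: field_simps)
    then show ?thesis using b by (simp add: abs_mult)
  qed
  also have "\<bar>(gh\<^sup>2 - gB\<^sup>2) * gC - gB\<^sup>2 * (gl - gC)\<bar> \<le> 2 * (B * C - h) + (C - zl)"
  proof -
    have "\<bar>(gh\<^sup>2 - gB\<^sup>2) * gC\<bar> = \<bar>gh - gB\<bar> * ((gh + gB) * gC)"
      using b by (simp add: abs_mult power2_eq_square square_diff_square_factored mult_ac)
    also have "\<dots> \<le> (B * C - h) * (2 * 1)"
      using b dh by (intro mult_mono) auto
    finally have 1: "\<bar>(gh\<^sup>2 - gB\<^sup>2) * gC\<bar> \<le> 2 * (B * C - h)" by simp
    have "\<bar>gB\<^sup>2 * (gl - gC)\<bar> = gB\<^sup>2 * \<bar>gl - gC\<bar>" by (simp add: abs_mult)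
    also have "\<dots> \<le> 1 * (C - zl)" using b dC by (intro mult_mono) (auto simp: power_le_one)
    finally show ?thesis
      using 1 abs_triangle_ineq4[of "(gh\<^sup>2 - gB\<^sup>2) * gC" "gB\<^sup>2 * (gl - gC)"] by simp
  qed
  also have "(2 * (B * C - h) + (C - zl)) / (gl * gC) \<le> (2 * (B * C - h) + (C - zl)) / (v * gC)"
    using v b bd(1,3) g by (intro divide_left_mono mult_right_mono) auto
  finally have d: "\<bar>geom_ratio zh - geom_ratio R\<bar> \<le> (2 * (B * C - h) + (C - zl)) / (v * gC)"
    using b by (simp add: divide_right_mono)
  have "zh - R = (geom_ratio zh - geom_ratio R) * ((1 + zh) * (1 + R))"
    using p R by (simp add: geom_ratio_diff)
  then have "\<bar>zh - R\<bar> = \<bar>geom_ratio zh - geom_ratio R\<bar> * ((1 + zh) * (1 + R))"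
    using p R by (simp add: abs_mult)
  also have "\<dots> \<le> (2 * (B * C - h) + (C - zl)) / (v * gC) * ((1 + Z) * (1 + R))"
    using d p R Z by (intro mult_mono mult_right_mono) auto
  finally show ?thesis by (simp add: g mult_ac)
qed

text \<open>As \<open>h\<close> is bounded by \<open>Bcrit C * C < B * C\<close>, the heavy margins force \<open>zh\<close> to be of order \<open>n / m\<close>. Its ratio is
  thus \<open>1 - O(m / n)\<close>, and the balance equation becomes \<open>(q h)\<^sup>2 = q C - O(m / n)\<close>.\<close>

lemma supercritical_side:
  fixes B C K :: real
  assumes bal: "balanced_means B C K n m h zh zl" and m: "m > 0" and n: "n > 0" and K: "K \<ge> 0"
    and BC: "B > 0" "C > 0" and sup: "B > Bcrit C"
    and u: "K / m + 1 / n \<le> (B - Bcrit C) * C / 2"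
  shows "h \<le> Bcrit C * C"
    and "Bcrit C * C - h \<le> (1 + Bcrit C * C)\<^sup>2 / geom_ratio (Bcrit C * C) *
      ((K + 1) + B * C + 2 / ((B - Bcrit C) * C)) * (m / n)"
proof -
  have p: "h > 0" "zh > 0" "zl > 0" and e: "geom_ratio zh * geom_ratio zl = (geom_ratio h)\<^sup>2"
    using bal by (auto simp: balanced_means_def)
  note bd = balanced_means_bounds[OF bal m n K]
  define \<beta> where "\<beta> = Bcrit C * C"
  define d where "d = (B - Bcrit C) * C"
  have \<beta>: "\<beta> > 0" using BC Bcrit_pos by (simp add: \<beta>_def)
  have d: "d > 0" using sup BC by (simp add: d_def)
  have dB: "B * C = \<beta> + d" by (simp add: \<beta>_def d_def algebra_simps)
  define gC g\<beta> gh gl gz where g: "gC = geom_ratio C" "g\<beta> = geom_ratio \<beta>" "gh = geom_ratio h" "gl = geom_ratio zl" "gz = geom_ratio zh"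
  have b: "0 < gC" "gC < 1" "0 < g\<beta>" "g\<beta> < 1" "0 < gh" "gh < 1" "0 < gl" "gl < 1" "0 < gz" "gz < 1"
    unfolding g using geom_ratio_bounds BC \<beta> p by auto
  have crit: "g\<beta>\<^sup>2 = gC" using geom_ratio_Bcrit[OF BC(2)] by (simp add: g \<beta>_def)
  have eh: "gh\<^sup>2 = gz * gl" using e by (simp add: g)
  have "gz * gl \<le> 1 * gl" using b by (intro mult_right_mono) auto
  also have "gl \<le> gC" using bd(3) p BC geom_ratio_le_iff[of zl C] by (simp add: g)
  finally have "gh\<^sup>2 \<le> g\<beta>\<^sup>2" using eh crit by simp
  then have "gh \<le> g\<beta>" using b by (simp add: power2_le_iff_abs_le)
  then have h\<beta>: "h \<le> \<beta>" using geom_ratio_le_iff[OF p(1) \<beta>] by (simp add: g)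
  then show "h \<le> Bcrit C * C" by (simp add: \<beta>_def)
  have "d / 2 \<le> m / n * zh" using bd(5) u h\<beta> dB unfolding d_def[symmetric] by linarith
  then have "1 / zh \<le> 2 / d * (m / n)" using p d n by (simp add: field_simps)
  moreover have "1 - gz \<le> 1 / zh" using p by (simp add: g geom_ratio_def divide_simps)
  ultimately have gz: "1 - gz \<le> 2 / d * (m / n)" by linarith
  have gC: "gC - gl \<le> C - zl"
    using geom_ratio_lipschitz[of C zl] p BC bd(3) unfolding g by linarith
  have "(g\<beta> - gh) * g\<beta> \<le> (g\<beta> - gh) * (g\<beta> + gh)"
    using b \<open>gh \<le> g\<beta>\<close> by (intro mult_left_mono) auto
  also have "\<dots> = g\<beta>\<^sup>2 - gh\<^sup>2" by (simp add: power2_eq_square algebra_simps)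
  also have "\<dots> = (gC - gl) + gl * (1 - gz)" unfolding crit eh by (simp add: algebra_simps)
  also have "\<dots> \<le> (C - zl) + 1 * (2 / d * (m / n))"
    using gC gz b by (intro add_mono mult_mono) auto
  also have "\<dots> \<le> ((K + 1) + B * C + 2 / d) * (m / n)"
  proof -
    have "(K + 1) / n \<le> (K + 1) * (m / n)" using K m by (simp add: divide_right_mono)
    then have "(C - zl) + 1 * (2 / d * (m / n)) \<le> (K + 1) * (m / n) + B * C * (m / n) + 2 / d * (m / n)"
      using bd(4) by linarith
    then show ?thesis by (simp only: distrib_right)
  qed
  finally have 1: "(g\<beta> - gh) * g\<beta> \<le> ((K + 1) + B * C + 2 / d) * (m / n)" .
  have "\<beta> - h = (g\<beta> - gh) * ((1 + \<beta>) * (1 + h))" using p \<beta> by (simp add: g geom_ratio_diff)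
  also have "\<dots> \<le> (g\<beta> - gh) * (1 + \<beta>)\<^sup>2"
    unfolding power2_eq_square using h\<beta> p \<beta> \<open>gh \<le> g\<beta>\<close> by (intro mult_left_mono) auto
  also have "\<dots> = (1 + \<beta>)\<^sup>2 / g\<beta> * ((g\<beta> - gh) * g\<beta>)" using b by simp
  also have "\<dots> \<le> (1 + \<beta>)\<^sup>2 / g\<beta> * (((K + 1) + B * C + 2 / d) * (m / n))"
    using 1 b by (intro mult_left_mono) auto
  finally show "Bcrit C * C - h \<le> (1 + Bcrit C * C)\<^sup>2 / geom_ratio (Bcrit C * C) *
      ((K + 1) + B * C + 2 / ((B - Bcrit C) * C)) * (m / n)"
    by (simp add: g \<beta>_def d_def mult.assoc)
qed

section \<open>Concentration of the three kinds of entries\<close>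

text \<open>The bound for an entry of a block with \<open>S\<close> entries, when the margins have probability at least
  \<open>exp (- A * (n * ln n))\<close>.\<close>

definition concentrated :: "nat \<Rightarrow> real \<Rightarrow> nat \<Rightarrow> nat pmf \<Rightarrow> real \<Rightarrow> bool" where
  "concentrated n A S p z \<longleftrightarrow>
     (\<forall>s\<ge>0. dTV p (Geom z) \<le> 2 * (s + exp (A * (n * ln n) - 2 * real S * s\<^sup>2)))"

definition concentrated_means ::
    "real \<Rightarrow> real \<Rightarrow> real \<Rightarrow> real \<Rightarrow> real \<Rightarrow> nat \<Rightarrow> real \<Rightarrow> real \<Rightarrow> real \<Rightarrow> bool" where
  "concentrated_means B C \<delta> K A n h zh zl \<longleftrightarrow>
     balanced_means B C K n (num_heavy n \<delta>) h zh zl \<and>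
     concentrated n A (n * n) (entry_pmf n \<delta> B C (n + 1) (n + 1)) zl \<and>
     concentrated n A (num_heavy n \<delta> * n) (entry_pmf n \<delta> B C 1 (n + 1)) h \<and>
     concentrated n A (num_heavy n \<delta> * num_heavy n \<delta>) (entry_pmf n \<delta> B C 1 1) zh"

text \<open>The constant \<open>K\<close> is large enough for the shortfall \<open>K * n\<close> of the block totals to exceed their fluctuations,
  and \<open>c0\<close> bounds \<open>x * y\<close> from below; neither depends on \<open>n\<close>, so that \<open>A\<close> does not either.\<close>

lemma entries_concentrate:
  fixes B C \<delta> :: real
  assumes BC: "B > 0" "C > 0" and \<delta>: "0 < \<delta>" "\<delta> < 1"
  shows "\<exists>K A. K \<ge> 0 \<and> A \<ge> 1 \<and> (\<forall>\<^sub>F n in sequentially. \<exists>h zh zl.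
    concentrated_means B C \<delta> K A n h zh zl)"
proof -
  define K where "K = nat \<lceil>8 * (1 + C + B * C)\<rceil>"
  have K: "8 * (1 + C + B * C) \<le> real K" unfolding K_def by linarith
  define c0 where "c0 = min (geom_ratio (B * C / 4)) (sqrt (geom_ratio (B * C / 2) * geom_ratio (C / 2)))"
  have c0: "0 < c0" "c0 \<le> 1"
    unfolding c0_def using BC geom_ratio_bounds[of "B * C / 4"] geom_ratio_bounds[of "B * C / 2"] geom_ratio_bounds[of "C / 2"]
    by (auto simp: min_le_iff_disj)
  obtain A where A: "A \<ge> 1" and ev: "\<forall>\<^sub>F n in sequentially. \<forall>m x y.
     usable_weights B C c0 (2 * K + 1) n m x y \<longrightarrow>
     exp (- A * (n * ln n)) \<le> prob_margins B C n m x y"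
    using prob_tables_ge_exp[OF BC c0, of "2 * K + 1"] by blast
  have ev1: "\<forall>\<^sub>F n in sequentially. real K / num_heavy n \<delta> + 1 / n < B * C / 4"
    by (rule order_tendstoD(2)[OF heavy_light_tendsto(1)[OF \<delta>]]) (use BC in simp)
  have ev2: "\<forall>\<^sub>F n in sequentially. (real K + 1) / n + (B * C) * (num_heavy n \<delta> / n) < C / 2"
    by (rule order_tendstoD(2)[OF heavy_light_tendsto(2)[OF \<delta>]]) (use BC in simp)
  have "\<forall>\<^sub>F n in sequentially. \<exists>h zh zl.
    concentrated_means B C \<delta> K A n h zh zl"
    using ev ev1 ev2 eventually_ge_at_top[of 1]
  proof eventually_elim
    case (elim n)
    define m where "m = num_heavy n \<delta>"
    have m: "m \<ge> 1" "m \<le> n" using num_heavy_bounds[of \<delta> n] \<delta> elim(4) by (auto simp: m_def)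
    have n: "n > 0" using elim(4) by simp
    have s1: "real K / m + 1 / n < B * C / 4" and s2: "(real K + 1) / n + (B * C) * (m / n) < C / 2"
      using elim(2,3) by (auto simp: m_def)
    have pre1: "K * n / m + 1 < B * C * n"
    proof -
      have "real K / m + 1 / n < B * C" using s1 mult_pos_pos[OF BC] by linarith
      then have "(real K / m + 1 / n) * n < B * C * n" using n by simp
      then show ?thesis using n by (simp add: distrib_right)
    qed
    have pre2: "m * (B * C) + (real K + 1) < C * n"
    proof -
      have "(real K + 1) / n + (B * C) * (m / n) < C" using s2 BC by linarith
      then have "((real K + 1) / n + (B * C) * (m / n)) * n < C * n" using n by simp
      then show ?thesis unfolding distrib_right using n by (simp add: mult_ac)
    qed
    obtain h zh zl where bal: "balanced_means B C (real K) n m h zh zl"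
      using balanced_means_exist[of m n B C "real K"] m n BC pre1 pre2 by auto
    have p: "h > 0" "zh > 0" "zl > 0" and e: "geom_ratio zh * geom_ratio zl = (geom_ratio h)\<^sup>2"
      using bal by (auto simp: balanced_means_def)
    define x y where "x = sqrt (geom_ratio zh)" and "y = sqrt (geom_ratio zl)"
    have q: "0 < geom_ratio zh" "geom_ratio zh < 1" "0 < geom_ratio zl" "geom_ratio zl < 1"
      using geom_ratio_bounds p by auto
    have xy: "x * x = geom_ratio zh" "y * y = geom_ratio zl" "x * y = geom_ratio h"
    proof -
      show "x * x = geom_ratio zh" "y * y = geom_ratio zl" using q by (auto simp: x_def y_def)
      have "x * y = sqrt ((geom_ratio h)\<^sup>2)" unfolding e[symmetric] by (simp add: x_def y_def real_sqrt_mult)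
      then show "x * y = geom_ratio h" using geom_ratio_bounds[OF p(1)] by simp
    qed
    have xy01: "0 < x" "x < 1" "0 < y" "y < 1" using q by (auto simp: x_def y_def)
    have "c0 \<le> x * y"
      unfolding xy(3) c0_def
      by (rule balanced_means_ratio_lower[OF bal _ m(2) BC]) (use m s1 s2 in auto)
    moreover have "1 / 2 \<le> measure_pmf.prob (random_table ({..<m} \<union> {m..<m + n}) (by_block {..<m} x y))
       (near_margins {..<m} {m..<m + n} (m * nat \<lfloor>B * C * n\<rfloor>) (n * nat \<lfloor>C * n\<rfloor>) ((2 * K + 1) * n))"
      by (rule balanced_means_near_margins[OF bal _ m(2) BC K refl refl x_def y_def]) (use m in auto)
    ultimately have "usable_weights B C c0 (2 * K + 1) n m x y"
      unfolding usable_weights_def using xy01 m(2) by blast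
    then have low: "exp (- A * (n * ln n)) \<le> prob_margins B C n m x y"
      using elim(1) by blast
    have ex: "exp (- 2 * S * s\<^sup>2) / exp (- A * (n * ln n)) = exp (A * (n * ln n) - 2 * S * s\<^sup>2)" for S s :: real
      by (simp flip: exp_diff)
    note conc = dTV_entries_le[OF xy01 m_def m p(2,1,3) xy(1,3,2) exp_gt_zero low, unfolded ex]
    show ?case
      unfolding concentrated_means_def concentrated_def m_def[symmetric] using bal conc by blast
  qed
  then show ?thesis using A by (intro exI[of _ "real K"] exI[of _ A]) auto
qed

text \<open>For \<open>\<delta> = 0\<close> there is one heavy row, and the shortfall of order \<open>n / m\<close> in the balanced means would
  exceed its margin. Here the heavy margin is only \<open>O(n)\<close>, however, so its expected value need not be near
  the target: a small constant \<open>h\<close> does, as the missing weight costs a factor \<open>exp (O(n))\<close> only.\<close>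

lemma corner_concentrate_single_heavy:
  fixes B C :: real
  assumes BC: "B > 0" "C > 0"
  shows "\<exists>A K. A \<ge> 1 \<and> (\<forall>\<^sub>F n in sequentially. \<exists>zl>0. \<bar>zl - C\<bar> \<le> K / n \<and> concentrated n A (n * n) (entry_pmf n 0 B C (n + 1) (n + 1)) zl)"
proof -
  define K where "K = nat \<lceil>8 * (1 + C + B * C)\<rceil>"
  have K: "8 * (1 + C + B * C) \<le> real K" unfolding K_def by linarith
  \<comment> \<open>below \<open>B * C / 2\<close> to leave room for deviations of the heavy total, and below \<open>zl\<close> so that \<open>x \<le> y\<close>\<close>
  define h where "h = min (B * C) C / 4"
  have h: "h > 0" "h \<le> B * C / 4" "h \<le> C / 4" using BC by (auto simp: h_def)
  define c0 where "c0 = geom_ratio h"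
  have c0: "0 < c0" "c0 \<le> 1" unfolding c0_def using geom_ratio_bounds[OF h(1)] by auto
  obtain A where A: "A \<ge> 1" and ev: "\<forall>\<^sub>F n in sequentially. \<forall>m x y.
     usable_weights B C c0 (2 * K + 1) n m x y \<longrightarrow>
     exp (- A * (n * ln n)) \<le> prob_margins B C n m x y"
    using prob_tables_ge_exp[OF BC c0, of "2 * K + 1"] by blast
  have B0: "B * C > 0" using BC by simp
  have ev1: "\<forall>\<^sub>F n in sequentially. (real K + 1 + h) / n \<le> C / 2" using BC h by real_asymp
  have ev2: "\<forall>\<^sub>F n in sequentially. (real n + 1) * (2 * (1 + h)\<^sup>2) \<le> (B * C * n / 4)\<^sup>2 / 8"
  proof -
    have gen: "\<forall>\<^sub>F n in sequentially. (real n + 1) * c \<le> (b * n / 4)\<^sup>2 / 8" if "b > 0" "c > 0" for b c :: real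
      using that by real_asymp
    show ?thesis by (rule gen[of "B * C" "2 * (1 + h)\<^sup>2"]) (use B0 h(1) in auto)
  qed
  have ev3: "\<forall>\<^sub>F n in sequentially. (real n + 1) * (B * C / 4) + B * C * n / 4 \<le> B * C * n - 1" using B0 by real_asymp
  have "\<forall>\<^sub>F n in sequentially. \<exists>zl>0. \<bar>zl - C\<bar> \<le> (real K + 1 + h) / n \<and> concentrated n A (n * n) (entry_pmf n 0 B C (n + 1) (n + 1)) zl"
    using ev ev1 ev2 ev3 eventually_ge_at_top[of 1]
  proof eventually_elim
    case (elim n)
    define zl where "zl = C - (real K + 1 + h) / n"
    have n: "n > 0" using elim(5) by simp
    have zl: "C / 2 \<le> zl" "zl \<le> C" using elim(2) h n by (auto simp: zl_def)
    then have zl0: "zl > 0" "h \<le> zl" "h < zl" using BC h by linarith+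
    have heavy: "num_heavy n 0 = 1" using n by (simp add: num_heavy_def)
    define x y where "x = geom_ratio h / sqrt (geom_ratio zl)" and "y = sqrt (geom_ratio zl)"
    define zhh where "zhh = x * x / (1 - x * x)"
    have q: "0 < geom_ratio zl" "geom_ratio zl < 1" "0 < geom_ratio h" "geom_ratio h < 1" "geom_ratio h \<le> geom_ratio zl"
      using geom_ratio_bounds zl0 h geom_ratio_le_iff by auto
    have y01: "0 < y" "y < 1" using q by (auto simp: y_def)
    have yy: "y * y = geom_ratio zl" using q by (simp add: y_def)
    have xy: "x * y = geom_ratio h" using q by (simp add: x_def y_def)
    have x0: "0 < x" using q by (simp add: x_def)
    have "x * y \<le> y * y" using q by (simp add: xy yy)
    then have "x \<le> y" using y01 by simp
    then have x1: "x < 1" using y01 by simp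
    have xx: "x * x \<le> geom_ratio h"
      using mult_left_mono[OF \<open>x \<le> y\<close>, of x] x0 by (simp add: xy)
    have xx1: "0 < x * x" "x * x < 1" using x0 xx q by auto
    have zhh0: "zhh > 0" using xx1 by (simp add: zhh_def)
    have rz: "x * x = geom_ratio zhh" using xx1 by (simp add: geom_ratio_def zhh_def field_simps)
    have zhh: "zhh \<le> h" using xx geom_ratio_le_iff[OF zhh0 h(1)] by (simp add: rz)
    define H L where "H = {..<1::nat}" and "L = {1..<1 + n}"
    have cards: "card H = 1" "card L = n" by (auto simp: H_def L_def)
    define \<mu>H where "\<mu>H = card H * (card H * zhh + card L * h)"
    define \<mu>L where "\<mu>L = card L * (card H * h + card L * zl)"
    have \<mu>H: "0 \<le> \<mu>H" "\<mu>H \<le> (real n + 1) * (B * C / 4)"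
    proof -
      show "0 \<le> \<mu>H" using zhh0 h by (simp add: \<mu>H_def)
      have "\<mu>H \<le> (real n + 1) * h" using zhh by (simp add: \<mu>H_def cards algebra_simps)
      also have "\<dots> \<le> (real n + 1) * (B * C / 4)" using h by (intro mult_left_mono) auto
      finally show "\<mu>H \<le> (real n + 1) * (B * C / 4)" .
    qed
    have \<mu>L: "\<mu>L = n * (C * n - 1) - real K * n"
    proof -
      have "n * zl = n * C - (real K + 1 + h)"
        unfolding zl_def right_diff_distrib using n by simp
      then have "h + n * zl = C * n - (real K + 1)" by (simp add: mult.commute)
      then have "\<mu>L = n * (C * n - (real K + 1))" by (simp add: \<mu>L_def cards)
      then show ?thesis by (simp add: algebra_simps)
    qed
    have fl: "B * C * n - 1 \<le> nat \<lfloor>B * C * n\<rfloor>" "nat \<lfloor>B * C * n\<rfloor> \<le> B * C * n"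
        "C * n - 1 \<le> nat \<lfloor>C * n\<rfloor>" "nat \<lfloor>C * n\<rfloor> \<le> C * n"
      using real_nat_floor_bounds[of "B * C * n"] real_nat_floor_bounds[of "C * n"] BC by auto
    have mfl: "n * (C * n - 1) \<le> n * nat \<lfloor>C * n\<rfloor>" "n * nat \<lfloor>C * n\<rfloor> \<le> n * (C * n)"
      unfolding of_nat_mult using fl by (intro mult_left_mono; simp)+
    define T where "T = 1 + C + B * C"
    have T: "1 + h \<le> T" "1 + zl \<le> T" "T > 0" using BC B0 h zl unfolding T_def by linarith+
    have half: "1 / 2 \<le> measure_pmf.prob (random_table (H \<union> L) (by_block H x y))
       (near_margins H L (1 * nat \<lfloor>B * C * n\<rfloor>) (n * nat \<lfloor>C * n\<rfloor>) ((2 * K + 1) * n))"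
    proof (rule prob_near_margins_ge_half[where zhh = zhh and zhl = h and zll = zl and \<mu>H = \<mu>H and \<mu>L = \<mu>L
          and \<kappa>H = "B * C * n / 4" and \<kappa>L = "real K * n"])
      show "finite H" "finite L" "H \<inter> L = {}" by (auto simp: H_def L_def)
      show "0 < x" "x < 1" "0 < y" "y < 1" by fact+
      show "zhh = x * x / (1 - x * x)" by (rule zhh_def)
      show "h = x * y / (1 - x * y)" "zl = y * y / (1 - y * y)"
        using h zl0 by (simp_all add: xy yy geom_ratio_odds)
      show "\<mu>H = card H * (card H * zhh + card L * h)" by (rule \<mu>H_def)
      show "\<mu>L = card L * (card H * h + card L * zl)" by (rule \<mu>L_def)
      show "B * C * n / 4 > 0" using B0 n by simp
      have "8 * T \<le> real K" unfolding T_def by (rule K)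
      then have "real K > 0" using T(3) by linarith
      then show "real K * n > 0" using n by simp
      have "(1 + zhh)\<^sup>2 \<le> (1 + h)\<^sup>2" using zhh zhh0 by (intro power_mono) auto
      then have "card H * (card H * (2 * (1 + zhh)\<^sup>2) + card L * (2 * (1 + h)\<^sup>2)) \<le> (real n + 1) * (2 * (1 + h)\<^sup>2)"
        by (simp add: cards algebra_simps)
      then show "card H * (card H * (2 * (1 + zhh)\<^sup>2) + card L * (2 * (1 + h)\<^sup>2)) \<le> (B * C * n / 4)\<^sup>2 / 8"
        using elim(3) by linarith
      show "card L * (card H * (2 * (1 + h)\<^sup>2) + card L * (2 * (1 + zl)\<^sup>2)) \<le> (real K * n)\<^sup>2 / 8"
      proof -
        have "card L * (card H * (2 * (1 + h)\<^sup>2) + card L * (2 * (1 + zl)\<^sup>2)) \<le> real n * (real n * (2 * T\<^sup>2) + real n * (2 * T\<^sup>2))"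
          unfolding cards using T h zl zl0 n by (intro mult_mono add_mono power_mono) auto
        also have "\<dots> = 4 * (n * T)\<^sup>2" by (simp add: power2_eq_square algebra_simps)
        also have "8 * (n * T) \<le> real K * n" using mult_right_mono[OF \<open>8 * T \<le> real K\<close>, of n] by (simp add: mult_ac)
        then have "(8 * (n * T))\<^sup>2 \<le> (real K * n)\<^sup>2" using T by (intro power_mono) auto
        then have "64 * (n * T)\<^sup>2 \<le> (real K * n)\<^sup>2" unfolding power_mult_distrib[of 8] by simp
        then have "4 * (n * T)\<^sup>2 \<le> (real K * n)\<^sup>2 / 8" using zero_le_power2[of "n * T"] by linarith
        finally show ?thesis .
      qed
      show "\<mu>H + B * C * n / 4 \<le> real (1 * nat \<lfloor>B * C * n\<rfloor>)" using \<mu>H(2) elim(4) fl(1) by simp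
      show "real (1 * nat \<lfloor>B * C * n\<rfloor>) \<le> \<mu>H - B * C * n / 4 + real ((2 * K + 1) * n)"
      proof -
        have "B * C \<le> T" using BC by (simp add: T_def)
        then have "2 * (B * C) \<le> 2 * real K + 1" using \<open>8 * T \<le> real K\<close> T(3) by argo
        then have "2 * (B * C) * n \<le> (2 * real K + 1) * n" by (intro mult_right_mono) auto
        moreover have "real ((2 * K + 1) * n) = (2 * real K + 1) * n" by (simp add: algebra_simps)
        moreover have "0 \<le> B * C * n" using B0 by simp
        ultimately show ?thesis using \<mu>H(1) fl(2) by (simp only: mult_1)
      qed
      show "\<mu>L + real K * n \<le> real (n * nat \<lfloor>C * n\<rfloor>)" using mfl(1) \<mu>L by simp
      show "real (n * nat \<lfloor>C * n\<rfloor>) \<le> \<mu>L - real K * n + real ((2 * K + 1) * n)"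
      proof -
        have "\<mu>L - real K * n + real ((2 * K + 1) * n) = n * (C * n)"
          unfolding \<mu>L by (simp add: algebra_simps)
        then show ?thesis using mfl(2) by linarith
      qed
    qed (rule refl)+
    have "usable_weights B C c0 (2 * K + 1) n 1 x y"
      unfolding usable_weights_def xy c0_def
      by (intro conjI x0 x1 y01 elim(5) order.refl half[unfolded H_def L_def])
    note low = elim(1)[rule_format, OF this]
    have ex: "exp (- 2 * S * s\<^sup>2) / exp (- A * (n * ln n)) = exp (A * (n * ln n) - 2 * S * s\<^sup>2)" for S s :: real
      by (simp flip: exp_diff)
    have "concentrated n A (n * n) (entry_pmf n 0 B C (n + 1) (n + 1)) zl"
      using dTV_entries_le(1)[OF x0 x1 y01 heavy[symmetric] order.refl elim(5) zhh0 h(1) zl0(1) rz xy yy exp_gt_zero low]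
      unfolding concentrated_def ex by blast
    moreover have "\<bar>zl - C\<bar> \<le> (real K + 1 + h) / n" using h by (simp add: zl_def)
    ultimately show ?case using zl0 by blast
  qed
  then show ?thesis using A by blast
qed

section \<open>Rates of convergence\<close>

text \<open>For \<open>s = n powr (e + \<epsilon>)\<close> the hypothesis on the block size gives \<open>2 * S n * s\<^sup>2 \<ge> n powr (1 + 2 * \<epsilon>) / 2\<close>,
  which outweighs \<open>A * (n * ln n)\<close> and leaves an exponential term of at most \<open>1 / n \<le> s\<close>.\<close>

lemma bigo_of_concentration:
  fixes p :: "nat \<Rightarrow> nat pmf" and R :: "nat \<Rightarrow> real" and S :: "nat \<Rightarrow> nat" and e \<epsilon> \<delta> A G :: real
  assumes \<epsilon>: "\<epsilon> > 0" and e: "e \<ge> -1" and A: "A \<ge> 1"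
    and S: "\<forall>\<^sub>F n in sequentially. real n powr (1 - 2 * e) / 4 \<le> S n"
    and conc: "\<forall>\<^sub>F n in sequentially. \<exists>z>0. R n > 0 \<and>
       \<bar>z - R n\<bar> \<le> G * (real n powr (\<delta> - 1) + real n powr (e + \<epsilon>)) \<and>
       concentrated n A (S n) (p n) z"
  shows "(\<lambda>n. dTV (p n) (Geom (R n))) \<in> O(\<lambda>n. real n powr (\<delta> - 1) + real n powr (e + \<epsilon>))"
proof (rule bigoI)
  have "\<forall>\<^sub>F n in sequentially. (A + 1) * (n * ln n) \<le> real n powr (1 + 2 * \<epsilon>) / 2"
    using A \<epsilon> by real_asymp
  then show "\<forall>\<^sub>F n in sequentially. norm (dTV (p n) (Geom (R n))) \<le>
      (4 + 2 * G) * norm (real n powr (\<delta> - 1) + real n powr (e + \<epsilon>))"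
    using S conc eventually_ge_at_top[of 1]
  proof eventually_elim
    case (elim n)
    define s where "s = real n powr (e + \<epsilon>)"
    define b where "b = real n powr (\<delta> - 1)"
    have n: "real n \<ge> 1" using elim(4) by simp
    have sb: "s \<ge> 0" "b \<ge> 0" by (auto simp: s_def b_def)
    obtain z where z: "z > 0" "R n > 0" "\<bar>z - R n\<bar> \<le> G * (b + s)"
      "concentrated n A (S n) (p n) z"
      using elim(3) by (auto simp: s_def b_def)
    have "real n powr (1 + 2 * \<epsilon>) / 2 = 2 * (real n powr (1 - 2 * e) / 4) * s\<^sup>2"
      using n by (simp add: s_def power2_eq_square flip: powr_add)
    also have "\<dots> \<le> 2 * real (S n) * s\<^sup>2" using elim(2) by (intro mult_right_mono mult_left_mono) auto
    finally have "A * (n * ln n) - 2 * real (S n) * s\<^sup>2 \<le> - (n * ln n)"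
      using elim(1) by (simp add: algebra_simps)
    also have "\<dots> \<le> - ln n" using n mult_right_mono[of 1 "real n" "ln (real n)"] by simp
    finally have "exp (A * (n * ln n) - 2 * real (S n) * s\<^sup>2) \<le> exp (- ln n)" by simp
    also have "\<dots> = real n powr (-1)" using n by (simp add: exp_minus powr_minus)
    also have "\<dots> \<le> s" unfolding s_def using n e \<epsilon> by (intro powr_mono) auto
    finally have ex: "exp (A * (n * ln n) - 2 * real (S n) * s\<^sup>2) \<le> s" .
    have "dTV (p n) (Geom (R n)) \<le> dTV (p n) (Geom z) + dTV (Geom z) (Geom (R n))" by (rule dTV_triangle)
    also have "\<dots> \<le> 2 * (s + s) + 2 * (G * (b + s))"
    proof (rule add_mono)
      show "dTV (p n) (Geom z) \<le> 2 * (s + s)"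
        by (rule order.trans[OF z(4)[unfolded concentrated_def, rule_format, OF sb(1)]]) (use ex in simp)
      show "dTV (Geom z) (Geom (R n)) \<le> 2 * (G * (b + s))"
        by (rule order.trans[OF dTV_Geom_le[OF z(1,2)]]) (use z(3) in simp)
    qed
    also have "\<dots> \<le> (4 + 2 * G) * (b + s)" using sb by (simp add: algebra_simps)
    finally show ?case using dTV_nonneg[of "p n" "Geom (R n)"] sb by (simp add: s_def b_def)
  qed
qed

text \<open>At \<open>\<delta> = 1\<close> the first term of the bounds is constant.\<close>

lemma bigo_trivial:
  assumes "\<And>n. dTV (p n) (q n) \<le> 2"
  shows "(\<lambda>n. dTV (p n) (q n)) \<in> O(\<lambda>n. real n powr ((1::real) - 1) + real n powr g)"
proof (rule bigoI)
  show "\<forall>\<^sub>F n in sequentially. norm (dTV (p n) (q n)) \<le> 2 * norm (real n powr ((1::real) - 1) + real n powr g)"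
    using eventually_gt_at_top[of 0]
  proof eventually_elim
    case (elim n)
    have "dTV (p n) (q n) \<le> 2 * 1 + 2 * real n powr g"
      using assms[of n] by (intro add_increasing2) auto
    then show ?case using dTV_nonneg[of "p n" "q n"] elim by simp
  qed
qed

lemma bottom_right_bigo:
  fixes B C \<epsilon> \<delta> :: real
  assumes BC: "B > 0" "C > 0" and \<epsilon>: "\<epsilon> > 0" and \<delta>: "0 \<le> \<delta>" "\<delta> < 1"
  shows "(\<lambda>n. dTV (entry_pmf n \<delta> B C (n + 1) (n + 1)) (Geom C))
          \<in> O(\<lambda>n. real n powr (\<delta> - 1) + real n powr (- 1 / 2 + \<epsilon>))"
proof -
  have "\<exists>A G. A \<ge> 1 \<and> (\<forall>\<^sub>F n in sequentially. \<exists>z>0. C > 0 \<and>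
       \<bar>z - C\<bar> \<le> G * (real n powr (\<delta> - 1) + real n powr (- 1 / 2 + \<epsilon>)) \<and>
       concentrated n A (n * n) (entry_pmf n \<delta> B C (n + 1) (n + 1)) z)"
  proof (cases "\<delta> = 0")
    case True
    obtain A K where A: "A \<ge> 1" and ev: "\<forall>\<^sub>F n in sequentially. \<exists>zl>0. \<bar>zl - C\<bar> \<le> K / n \<and> concentrated n A (n * n) (entry_pmf n 0 B C (n + 1) (n + 1)) zl"
      using corner_concentrate_single_heavy[OF BC] by blast
    have "\<forall>\<^sub>F n in sequentially. \<exists>z>0. C > 0 \<and>
       \<bar>z - C\<bar> \<le> \<bar>K\<bar> * (real n powr (\<delta> - 1) + real n powr (- 1 / 2 + \<epsilon>)) \<and>
       concentrated n A (n * n) (entry_pmf n \<delta> B C (n + 1) (n + 1)) z"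
      using ev eventually_ge_at_top[of 1]
    proof eventually_elim
      case (elim n)
      have "K / n \<le> \<bar>K\<bar> * (1 / n)" by (simp add: divide_right_mono)
      also have "1 / n \<le> real n powr (\<delta> - 1) + real n powr (- 1 / 2 + \<epsilon>)"
        using elim(2) by (simp add: True powr_minus field_simps)
      finally have "K / n \<le> \<bar>K\<bar> * (real n powr (\<delta> - 1) + real n powr (- 1 / 2 + \<epsilon>))"
        by (simp add: mult_left_mono)
      then show ?case using elim(1) BC True by (metis order.trans)
    qed
    then show ?thesis using A by blast
  next
    case False
    then have \<delta>': "0 < \<delta>" "\<delta> < 1" using \<delta> by auto
    obtain K A where KA: "K \<ge> 0" "A \<ge> 1" and ev: "\<forall>\<^sub>F n in sequentially. \<exists>h zh zl.
      concentrated_means B C \<delta> K A n h zh zl"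
      using entries_concentrate[OF BC \<delta>'] by blast
    have "\<forall>\<^sub>F n in sequentially. \<exists>z>0. C > 0 \<and>
       \<bar>z - C\<bar> \<le> (K + 1 + B * C) * (real n powr (\<delta> - 1) + real n powr (- 1 / 2 + \<epsilon>)) \<and>
       concentrated n A (n * n) (entry_pmf n \<delta> B C (n + 1) (n + 1)) z"
      using ev eventually_ge_at_top[of 1]
    proof eventually_elim
      case (elim n)
      then obtain h zh zl where bal: "balanced_means B C K n (num_heavy n \<delta>) h zh zl" and d: "concentrated n A (n * n) (entry_pmf n \<delta> B C (n + 1) (n + 1)) zl"
        unfolding concentrated_means_def by blast
      note r = heavy_ratio_bounds[OF \<delta>' elim(2)]
      have "num_heavy n \<delta> > 0" using num_heavy_bounds[of \<delta> n] \<delta> elim(2) by simp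
      note bd = balanced_means_bounds[OF bal this _ KA(1)]
      have "\<bar>zl - C\<bar> \<le> (K + 1) * (1 / n) + B * C * (num_heavy n \<delta> / n)"
        using bd(3,4) elim(2) by simp
      also have "\<dots> \<le> (K + 1) * (real n powr (\<delta> - 1)) + B * C * (real n powr (\<delta> - 1))"
        using r KA BC by (intro add_mono mult_left_mono) auto
      also have "\<dots> = (K + 1 + B * C) * real n powr (\<delta> - 1)" by (simp add: algebra_simps)
      also have "\<dots> \<le> (K + 1 + B * C) * (real n powr (\<delta> - 1) + real n powr (- 1 / 2 + \<epsilon>))"
        using KA BC by (intro mult_left_mono) auto
      finally show ?case using d BC bal by (auto simp: balanced_means_def)
    qed
    then show ?thesis using KA by blast
  qed
  then obtain A G where A: "A \<ge> 1" and ev: "\<forall>\<^sub>F n in sequentially. \<exists>z>0. C > 0 \<and>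
       \<bar>z - C\<bar> \<le> G * (real n powr (\<delta> - 1) + real n powr (- 1 / 2 + \<epsilon>)) \<and>
       concentrated n A (n * n) (entry_pmf n \<delta> B C (n + 1) (n + 1)) z"
    by blast
  have S: "\<forall>\<^sub>F n in sequentially. real n powr (1 - 2 * (- 1 / 2)) / 4 \<le> real (n * n)"
    using eventually_ge_at_top[of 1] by eventually_elim (simp add: powr_numeral power2_eq_square)
  show ?thesis
    by (rule bigo_of_concentration[where R = "\<lambda>_. C" and S = "\<lambda>n. n * n" and G = G, OF \<epsilon> _ A S ev]) simp
qed

lemma sides_bigo:
  fixes B C \<epsilon> \<delta> R :: real
  assumes BC: "B > 0" "C > 0" and \<epsilon>: "\<epsilon> > 0" and \<delta>: "0 < \<delta>" "\<delta> < 1"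
    and R: "B < Bcrit C \<and> R = B * C \<or> B > Bcrit C \<and> R = Bcrit C * C"
  shows "(\<lambda>n. dTV (entry_pmf n \<delta> B C 1 (n + 1)) (Geom R))
          \<in> O(\<lambda>n. real n powr (\<delta> - 1) + real n powr (- \<delta> / 2 + \<epsilon>))"
proof -
  obtain K A where KA: "K \<ge> 0" "A \<ge> 1" and ev: "\<forall>\<^sub>F n in sequentially. \<exists>h zh zl.
      concentrated_means B C \<delta> K A n h zh zl"
    using entries_concentrate[OF BC \<delta>] by blast
  have R0: "R > 0" using R BC Bcrit_pos[of C] by auto
  have "\<exists>G. \<forall>\<^sub>F n in sequentially. \<forall>h zh zl. balanced_means B C K n (num_heavy n \<delta>) h zh zl \<longrightarrow>
      \<bar>h - R\<bar> \<le> G * (real n powr (\<delta> - 1) + real n powr (- \<delta> / 2 + \<epsilon>))"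
    using R
  proof
    assume sub: "B < Bcrit C \<and> R = B * C"
    define v where "v = (geom_ratio C + (geom_ratio (B * C))\<^sup>2) / 2"
    define w where "w = (geom_ratio (B * C))\<^sup>2 / v"
    define Z where "Z = w / (1 - w)"
    have "\<forall>\<^sub>F n in sequentially. (K + 1) / n + (B * C) * (num_heavy n \<delta> / n) < (geom_ratio C - (geom_ratio (B * C))\<^sup>2) / 2"
      by (rule order_tendstoD(2)[OF heavy_light_tendsto(2)[OF \<delta>]]) (use subcritical_geom_ratio[OF BC] sub in simp)
    then have "\<forall>\<^sub>F n in sequentially. \<forall>h zh zl. balanced_means B C K n (num_heavy n \<delta>) h zh zl \<longrightarrow>
      \<bar>h - R\<bar> \<le> (2 * K + 1 + Z) * (real n powr (\<delta> - 1) + real n powr (- \<delta> / 2 + \<epsilon>))"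
      using eventually_ge_at_top[of 1]
    proof eventually_elim
      case (elim n)
      show ?case
      proof (intro allI impI)
        fix h zh zl assume bal: "balanced_means B C K n (num_heavy n \<delta>) h zh zl"
        note r = heavy_ratio_bounds[OF \<delta> elim(2)]
        have m: "num_heavy n \<delta> > 0" using num_heavy_bounds[of \<delta> n] \<delta> elim(2) by simp
        have n: "n > 0" using elim(2) by simp
        note bd = balanced_means_bounds[OF bal m n KA(1)]
        note sc = subcritical_heavy_mean[OF bal m n KA(1) BC conjunct1[OF sub] less_imp_le[OF elim(1)],
            folded v_def, folded w_def, folded Z_def]
        have Z: "zh \<le> Z" "0 < Z" using sc by (auto simp: Z_def)
        have "real n powr (- \<delta>) \<le> real n powr (- \<delta> / 2 + \<epsilon>)" using \<delta> \<epsilon> n by (intro powr_mono) auto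
        then have r2: "1 / real (num_heavy n \<delta>) \<le> 2 * real n powr (- \<delta> / 2 + \<epsilon>)" using r(2) by linarith
        have "\<bar>h - R\<bar> = K * (1 / num_heavy n \<delta>) + 1 / n + (num_heavy n \<delta> / n) * zh"
          using bd(1,5) sub by simp
        also have "\<dots> \<le> K * (2 * real n powr (- \<delta> / 2 + \<epsilon>)) + real n powr (\<delta> - 1) + real n powr (\<delta> - 1) * Z"
          using r r2 KA Z bal by (intro add_mono mult_left_mono mult_mono) (auto simp: balanced_means_def)
        also have "\<dots> \<le> (2 * K + 1 + Z) * (real n powr (\<delta> - 1) + real n powr (- \<delta> / 2 + \<epsilon>))"
          using KA Z by (simp add: algebra_simps)
        finally show "\<bar>h - R\<bar> \<le> (2 * K + 1 + Z) * (real n powr (\<delta> - 1) + real n powr (- \<delta> / 2 + \<epsilon>))" .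
      qed
    qed
    then show ?thesis by blast
  next
    assume sup: "B > Bcrit C \<and> R = Bcrit C * C"
    define G where "G = (1 + Bcrit C * C)\<^sup>2 / geom_ratio (Bcrit C * C) * ((K + 1) + B * C + 2 / ((B - Bcrit C) * C))"
    have G: "G \<ge> 0" unfolding G_def using sup BC KA geom_ratio_bounds[OF R0]
      by (intro mult_nonneg_nonneg add_nonneg_nonneg divide_nonneg_nonneg) auto
    have "\<forall>\<^sub>F n in sequentially. K / num_heavy n \<delta> + 1 / n < (B - Bcrit C) * C / 2"
      by (rule order_tendstoD(2)[OF heavy_light_tendsto(1)[OF \<delta>]]) (use BC sup in simp)
    then have "\<forall>\<^sub>F n in sequentially. \<forall>h zh zl. balanced_means B C K n (num_heavy n \<delta>) h zh zl \<longrightarrow>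
      \<bar>h - R\<bar> \<le> G * (real n powr (\<delta> - 1) + real n powr (- \<delta> / 2 + \<epsilon>))"
      using eventually_ge_at_top[of 1]
    proof eventually_elim
      case (elim n)
      show ?case
      proof (intro allI impI)
        fix h zh zl assume bal: "balanced_means B C K n (num_heavy n \<delta>) h zh zl"
        note r = heavy_ratio_bounds[OF \<delta> elim(2)]
        have m: "num_heavy n \<delta> > 0" using num_heavy_bounds[of \<delta> n] \<delta> elim(2) by simp
        have n: "n > 0" using elim(2) by simp
        have "\<bar>h - R\<bar> \<le> G * (num_heavy n \<delta> / n)"
          using supercritical_side[OF bal m n KA(1) BC] sup elim(1) unfolding G_def by auto
        also have "\<dots> \<le> G * (real n powr (\<delta> - 1) + real n powr (- \<delta> / 2 + \<epsilon>))"
          using r(1) G by (intro mult_left_mono) (auto intro: order.trans)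
        finally show "\<bar>h - R\<bar> \<le> G * (real n powr (\<delta> - 1) + real n powr (- \<delta> / 2 + \<epsilon>))" .
      qed
    qed
    then show ?thesis by blast
  qed
  then obtain G where G: "\<forall>\<^sub>F n in sequentially. \<forall>h zh zl. balanced_means B C K n (num_heavy n \<delta>) h zh zl \<longrightarrow>
      \<bar>h - R\<bar> \<le> G * (real n powr (\<delta> - 1) + real n powr (- \<delta> / 2 + \<epsilon>))" by blast
  have conc: "\<forall>\<^sub>F n in sequentially. \<exists>z>0. R > 0 \<and>
       \<bar>z - R\<bar> \<le> G * (real n powr (\<delta> - 1) + real n powr (- \<delta> / 2 + \<epsilon>)) \<and>
       concentrated n A (num_heavy n \<delta> * n) (entry_pmf n \<delta> B C 1 (n + 1)) z"
    using ev G
  proof eventually_elim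
    case (elim n)
    then obtain h zh zl where bal: "balanced_means B C K n (num_heavy n \<delta>) h zh zl" and d: "concentrated n A (num_heavy n \<delta> * n) (entry_pmf n \<delta> B C 1 (n + 1)) h"
      unfolding concentrated_means_def by blast
    have "h > 0" using bal by (simp add: balanced_means_def)
    then show ?case using d bal elim(2) R0 by blast
  qed
  have S: "\<forall>\<^sub>F n in sequentially. real n powr (1 - 2 * (- \<delta> / 2)) / 4 \<le> real (num_heavy n \<delta> * n)"
    using eventually_ge_at_top[of 1]
  proof eventually_elim
    case (elim n)
    have "real n powr (1 - 2 * (- \<delta> / 2)) / 4 = real n powr \<delta> / 4 * n" using elim by (simp add: powr_add)
    also have "\<dots> \<le> real (num_heavy n \<delta>) * n"
      using num_heavy_bounds[of \<delta> n] \<delta> elim by (intro mult_right_mono) auto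
    finally show ?case by simp
  qed
  show ?thesis
    by (rule bigo_of_concentration[where R = "\<lambda>_. R" and S = "\<lambda>n. num_heavy n \<delta> * n" and G = G, OF \<epsilon> _ KA(2) S conc])
      (use \<delta> in simp)
qed

lemma top_left_block_size:
  assumes "0 < \<delta>" "\<delta> < 1"
  shows "\<forall>\<^sub>F n in sequentially. real n powr (1 - 2 * (1 / 2 - \<delta>)) / 4 \<le> real (num_heavy n \<delta> * num_heavy n \<delta>)"
  using eventually_ge_at_top[of 1]
proof eventually_elim
  case (elim n)
  have "real n powr (1 - 2 * (1 / 2 - \<delta>)) / 4 = (real n powr \<delta> / 2) * (real n powr \<delta> / 2)"
    using elim by (simp flip: powr_add)
  also have "\<dots> \<le> real (num_heavy n \<delta>) * real (num_heavy n \<delta>)"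
    using num_heavy_bounds[of \<delta> n] assms elim by (intro mult_mono) auto
  finally show ?case by simp
qed

lemma top_left_subcritical_bigo:
  fixes B C \<epsilon> \<delta> :: real
  assumes BC: "B > 0" "C > 0" and \<epsilon>: "\<epsilon> > 0" and \<delta>: "1 / 2 < \<delta>" "\<delta> < 1" and sub: "B < Bcrit C"
  shows "(\<lambda>n. dTV (entry_pmf n \<delta> B C 1 1) (Geom (B\<^sup>2 * (1 + C) / ((Bcrit C - B) * (B + Bcrit C - 2)))))
          \<in> O(\<lambda>n. real n powr (\<delta> - 1) + real n powr (1 / 2 - \<delta> + \<epsilon>))"
proof -
  have \<delta>': "0 < \<delta>" "\<delta> < 1" using \<delta> by auto
  obtain K A where KA: "K \<ge> 0" "A \<ge> 1" and ev: "\<forall>\<^sub>F n in sequentially. \<exists>h zh zl.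
      concentrated_means B C \<delta> K A n h zh zl"
    using entries_concentrate[OF BC \<delta>'] by blast
  define R where "R = B\<^sup>2 * (1 + C) / ((Bcrit C - B) * (B + Bcrit C - 2))"
  have R: "R > 0" "geom_ratio R * geom_ratio C = (geom_ratio (B * C))\<^sup>2"
    unfolding R_def by (rule geom_ratio_corner_limit[OF BC sub])+
  define v where "v = (geom_ratio C + (geom_ratio (B * C))\<^sup>2) / 2"
  define w where "w = (geom_ratio (B * C))\<^sup>2 / v"
  define Z where "Z = w / (1 - w)"
  define F where "F = (1 + Z) * (1 + R) / (v * geom_ratio C)"
  define G where "G = F * (5 * K + 3 + 2 * Z + B * C)"
  have "\<forall>\<^sub>F n in sequentially. (K + 1) / n + (B * C) * (num_heavy n \<delta> / n) < (geom_ratio C - (geom_ratio (B * C))\<^sup>2) / 2"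
    by (rule order_tendstoD(2)[OF heavy_light_tendsto(2)[OF \<delta>']]) (use subcritical_geom_ratio[OF BC] sub in simp)
  then have conc: "\<forall>\<^sub>F n in sequentially. \<exists>z>0. R > 0 \<and>
       \<bar>z - R\<bar> \<le> G * (real n powr (\<delta> - 1) + real n powr (1 / 2 - \<delta> + \<epsilon>)) \<and>
       concentrated n A (num_heavy n \<delta> * num_heavy n \<delta>) (entry_pmf n \<delta> B C 1 1) z"
    using ev eventually_ge_at_top[of 1]
  proof eventually_elim
    case (elim n)
    then obtain h zh zl where bal: "balanced_means B C K n (num_heavy n \<delta>) h zh zl" and d: "concentrated n A (num_heavy n \<delta> * num_heavy n \<delta>) (entry_pmf n \<delta> B C 1 1) zh"
      unfolding concentrated_means_def by blast
    note r = heavy_ratio_bounds[OF \<delta>' elim(3)]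
    have m: "num_heavy n \<delta> > 0" using num_heavy_bounds[of \<delta> n] \<delta> elim(3) by simp
    have n: "n > 0" using elim(3) by simp
    have p: "h > 0" "zh > 0" "zl > 0" using bal by (auto simp: balanced_means_def)
    note bd = balanced_means_bounds[OF bal m n KA(1)]
    note sc = subcritical_heavy_mean[OF bal m n KA(1) BC sub less_imp_le[OF elim(1)],
        folded v_def, folded w_def, folded Z_def]
    have Z: "Z > 0" using sc by (simp add: Z_def)
    have F: "F \<ge> 0" using Z R sc geom_ratio_bounds[OF BC(2)] by (simp add: F_def)
    define b s where "b = real n powr (\<delta> - 1)" and "s = real n powr (1 / 2 - \<delta> + \<epsilon>)"
    have bs: "b \<ge> 0" "s \<ge> 0" by (auto simp: b_def s_def)
    have "real n powr (- \<delta>) \<le> s" unfolding s_def using \<epsilon> n by (intro powr_mono) auto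
    then have r2: "1 / real (num_heavy n \<delta>) \<le> 2 * s" using r(2) by linarith
    have "B * C - h = K * (1 / num_heavy n \<delta>) + 1 / n + (num_heavy n \<delta> / n) * zh" using bd(5) by simp
    also have "\<dots> \<le> K * (2 * s) + b + b * Z"
      unfolding b_def using r r2 KA sc p by (intro add_mono mult_left_mono mult_mono) auto
    finally have dh: "B * C - h \<le> K * (2 * s) + b + b * Z" .
    have "C - zl \<le> (K + 1) * (1 / n) + B * C * (num_heavy n \<delta> / n)" using bd(4) by simp
    also have "\<dots> \<le> (K + 1) * b + B * C * b"
      unfolding b_def using r KA BC by (intro add_mono mult_left_mono) auto
    finally have dl: "C - zl \<le> (K + 1) * b + B * C * b" .
    have "\<bar>zh - R\<bar> \<le> F * (2 * (B * C - h) + (C - zl))"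
      unfolding F_def by (rule subcritical_corner[OF bal m n KA(1) BC sc(2,5,1) R])
    also have "\<dots> \<le> F * (2 * (K * (2 * s) + b + b * Z) + ((K + 1) * b + B * C * b))"
      using dh dl F by (intro mult_left_mono add_mono) auto
    also have "\<dots> \<le> F * ((5 * K + 3 + 2 * Z + B * C) * (b + s))"
    proof (intro mult_left_mono F)
      have "0 \<le> K * b" "0 \<le> K * s" "0 \<le> Z * s" "0 \<le> B * C * s" using KA BC Z bs by auto
      then show "2 * (K * (2 * s) + b + b * Z) + ((K + 1) * b + B * C * b) \<le> (5 * K + 3 + 2 * Z + B * C) * (b + s)"
        using bs by (simp add: algebra_simps)
    qed
    finally have "\<bar>zh - R\<bar> \<le> G * (b + s)" by (simp add: G_def mult.assoc)
    then show ?case using d p R unfolding b_def s_def by blast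
  qed
  show ?thesis unfolding R_def[symmetric]
    by (rule bigo_of_concentration[where R = "\<lambda>_. R" and S = "\<lambda>n. num_heavy n \<delta> * num_heavy n \<delta>" and G = G,
          OF \<epsilon> _ KA(2) top_left_block_size[OF \<delta>'] conc]) (use \<delta> in simp)
qed

text \<open>Here \<open>R n\<close> is the balanced mean \<open>zh = (B * C - h - K / m - 1 / n) * n / m\<close> itself, so the rate needs no
  comparison of means. The error \<open>O(m / n)\<close> of \<open>h\<close>, multiplied by \<open>n / m\<close>, is bounded. The shortfall
  contributes \<open>K * n / m\<^sup>2\<close>, and replacing \<open>m\<close> by \<open>n powr \<delta>\<close> a term of order \<open>n powr (1 - 2 * \<delta>)\<close>; both are
  bounded because \<open>\<delta> > 1/2\<close>.\<close>

lemma top_left_supercritical_bigo: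
  fixes B C \<epsilon> \<delta> :: real
  assumes BC: "B > 0" "C > 0" and \<epsilon>: "\<epsilon> > 0" and \<delta>: "1 / 2 < \<delta>" "\<delta> < 1" and sup: "B > Bcrit C"
  shows "\<exists>R :: nat \<Rightarrow> real. (\<forall>n. R n > 0) \<and>
     Bseq (\<lambda>n. R n - C * (B - Bcrit C) * real n powr (1 - \<delta>)) \<and>
     (\<lambda>n. dTV (entry_pmf n \<delta> B C 1 1) (Geom (R n)))
       \<in> O(\<lambda>n. real n powr (\<delta> - 1) + real n powr (1 / 2 - \<delta> + \<epsilon>))"
proof -
  have \<delta>': "0 < \<delta>" "\<delta> < 1" using \<delta> by auto
  obtain K A where KA: "K \<ge> 0" "A \<ge> 1" and ev: "\<forall>\<^sub>F n in sequentially. \<exists>h zh zl.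
      concentrated_means B C \<delta> K A n h zh zl"
    using entries_concentrate[OF BC \<delta>'] by blast
  define good where "good = (\<lambda>n z. z > 0 \<and> (\<exists>h zl. balanced_means B C K n (num_heavy n \<delta>) h z zl) \<and>
     concentrated n A (num_heavy n \<delta> * num_heavy n \<delta>) (entry_pmf n \<delta> B C 1 1) z)"
  have evg: "\<forall>\<^sub>F n in sequentially. \<exists>z. good n z"
    using ev
  proof eventually_elim
    case (elim n)
    then obtain h zh zl where bal: "balanced_means B C K n (num_heavy n \<delta>) h zh zl" and d: "concentrated n A (num_heavy n \<delta> * num_heavy n \<delta>) (entry_pmf n \<delta> B C 1 1) zh"
      unfolding concentrated_means_def by blast
    have "zh > 0" using bal by (simp add: balanced_means_def)
    then show ?case using bal d unfolding good_def by blast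
  qed
  \<comment> \<open>the default \<open>1\<close> only serves positivity for the finitely many small \<open>n\<close>\<close>
  define R where "R = (\<lambda>n. if \<exists>z. good n z then SOME z. good n z else 1)"
  have Rgood: "good n (R n)" if "\<exists>z. good n z" for n
    using that by (simp add: R_def someI_ex)
  have R0: "R n > 0" for n
  proof (cases "\<exists>z. good n z")
    case True
    then show ?thesis using Rgood[OF True] by (simp add: good_def)
  next
    case False
    then show ?thesis unfolding R_def if_not_P[OF False] by simp
  qed
  define G where "G = (1 + Bcrit C * C)\<^sup>2 / geom_ratio (Bcrit C * C) * ((K + 1) + B * C + 2 / ((B - Bcrit C) * C))"
  define D where "D = C * (B - Bcrit C)"
  have D: "D > 0" using BC sup by (simp add: D_def)
  have "\<forall>\<^sub>F n in sequentially. K / num_heavy n \<delta> + 1 / n < (B - Bcrit C) * C / 2"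
    by (rule order_tendstoD(2)[OF heavy_light_tendsto(1)[OF \<delta>']]) (use BC sup in simp)
  then have "\<forall>\<^sub>F n in sequentially. norm (R n - D * real n powr (1 - \<delta>)) \<le> G + (4 * K + 1) + 2 * D"
    using evg eventually_ge_at_top[of 1]
  proof eventually_elim
    case (elim n)
    define m where "m = num_heavy n \<delta>"
    from Rgood[OF elim(2)] obtain h zl where bal: "balanced_means B C K n m h (R n) zl"
      by (auto simp: good_def m_def)
    have mb: "1 \<le> m" "m \<le> n" "real m \<le> n powr \<delta>" "n powr \<delta> / 2 \<le> m" "n powr \<delta> \<le> m + 1"
    proof -
      show "1 \<le> m" "m \<le> n" "real m \<le> n powr \<delta>" "n powr \<delta> / 2 \<le> m"
        using num_heavy_bounds[of \<delta> n] \<delta> elim(3) by (auto simp: m_def)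
      have "0 \<le> n powr \<delta>" by simp
      then show "n powr \<delta> \<le> m + 1" unfolding m_def num_heavy_def by linarith
    qed
    have m: "m > 0" and n: "n > 0" using mb by auto
    note bd = balanced_means_bounds[OF bal m n KA(1)]
    have u: "K / m + 1 / n \<le> (B - Bcrit C) * C / 2" using elim(1) by (simp add: m_def)
    note ss = supercritical_side[OF bal m n KA(1) BC sup u]
    define g where "g = Bcrit C * C - h"
    have g: "0 \<le> g" "g \<le> G * (m / n)" using ss by (auto simp: g_def G_def)
    have n\<delta>: "real n powr \<delta> > 0" using n by simp
    \<comment> \<open>here \<open>\<delta> > 1/2\<close> enters: \<open>n\<close> is at most \<open>n powr (2 * \<delta>)\<close>\<close>
    have nm: "n / (real m * n powr \<delta>) \<le> 2" "real n / (real m * m) \<le> 4"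
    proof -
      have "real n powr 1 \<le> real n powr (\<delta> + \<delta>)" using n \<delta> by (intro powr_mono) auto
      then have nn: "real n \<le> n powr \<delta> * n powr \<delta>" unfolding powr_add using n by simp
      also have "n powr \<delta> * n powr \<delta> \<le> (2 * m) * n powr \<delta>" using mb by (intro mult_right_mono) auto
      finally show "n / (real m * n powr \<delta>) \<le> 2" using m n\<delta> by (simp add: pos_divide_le_eq mult_ac)
      have "n powr \<delta> * n powr \<delta> \<le> (2 * real m) * (2 * real m)" using mb by (intro mult_mono) auto
      with nn have "real n \<le> (2 * real m) * (2 * real m)" by (rule order.trans)
      then show "real n / (real m * m) \<le> 4" using m by (simp add: pos_divide_le_eq)
    qed
    have "m / n * R n = D + g - (K / m + 1 / n)"
      using bd(5) by (simp add: D_def g_def algebra_simps)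
    moreover define \<rho> where "\<rho> = real n / real m"
    moreover have "\<rho> * (m / n * R n) = R n" using m n by (simp add: \<rho>_def)
    ultimately have "R n = \<rho> * (D + g - (K / m + 1 / n))" by simp
    also have "\<dots> = D * \<rho> + g * \<rho> - (\<rho> * (K / m) + \<rho> * (1 / n))" by (simp add: algebra_simps)
    also have "\<rho> * (K / m) = K * (n / (real m * m))" by (simp add: \<rho>_def)
    also have "\<rho> * (1 / n) = 1 / m" using n by (simp add: \<rho>_def)
    finally have Rn: "R n = D * (n / m) + g * (n / m) - (K * (n / (real m * m)) + 1 / m)"
      by (simp only: \<rho>_def)
    have "g * (n / m) \<le> G * (m / n) * (n / m)" using g by (intro mult_right_mono) auto
    then have g2: "0 \<le> g * (n / m)" "g * (n / m) \<le> G" using g m n by auto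
    have k2: "0 \<le> K * (n / (real m * m)) + 1 / m" "K * (n / (real m * m)) + 1 / m \<le> 4 * K + 1"
    proof -
      show "0 \<le> K * (n / (real m * m)) + 1 / m" using KA by simp
      have "K * (n / (real m * m)) \<le> K * 4" using nm KA by (intro mult_left_mono) auto
      moreover have "1 / real m \<le> 1" using m by simp
      ultimately show "K * (n / (real m * m)) + 1 / m \<le> 4 * K + 1" by linarith
    qed
    have d2: "0 \<le> n / m - real n powr (1 - \<delta>)" "n / m - real n powr (1 - \<delta>) \<le> 2"
    proof -
      have "n / m - real n powr (1 - \<delta>) = (n powr \<delta> - m) * (n / (real m * n powr \<delta>))"
        using m n n\<delta> by (simp add: powr_diff field_simps)
      moreover have "0 \<le> (n powr \<delta> - m) * (n / (real m * n powr \<delta>))" using mb by simp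
      moreover have "(n powr \<delta> - m) * (n / (real m * n powr \<delta>)) \<le> 1 * 2"
        using mb nm by (intro mult_mono) auto
      ultimately show "0 \<le> n / m - real n powr (1 - \<delta>)" "n / m - real n powr (1 - \<delta>) \<le> 2" by auto
    qed
    have "R n - D * real n powr (1 - \<delta>) = D * (n / m - real n powr (1 - \<delta>)) + g * (n / m) - (K * (n / (real m * m)) + 1 / m)"
      unfolding Rn by (simp add: algebra_simps)
    moreover have "0 \<le> D * (n / m - real n powr (1 - \<delta>))" "D * (n / m - real n powr (1 - \<delta>)) \<le> D * 2"
      using d2 D by (auto intro: mult_left_mono)
    ultimately show ?case using g2 k2 unfolding real_norm_def by linarith
  qed
  then have "Bseq (\<lambda>n. R n - D * real n powr (1 - \<delta>))" by (intro BfunI)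
  moreover have "(\<lambda>n. dTV (entry_pmf n \<delta> B C 1 1) (Geom (R n)))
       \<in> O(\<lambda>n. real n powr (\<delta> - 1) + real n powr (1 / 2 - \<delta> + \<epsilon>))"
  proof (rule bigo_of_concentration[where S = "\<lambda>n. num_heavy n \<delta> * num_heavy n \<delta>" and G = 0,
          OF \<epsilon> _ KA(2) top_left_block_size[OF \<delta>']])
    show "\<forall>\<^sub>F n in sequentially. \<exists>z>0. R n > 0 \<and>
       \<bar>z - R n\<bar> \<le> 0 * (real n powr (\<delta> - 1) + real n powr (1 / 2 - \<delta> + \<epsilon>)) \<and>
       concentrated n A (num_heavy n \<delta> * num_heavy n \<delta>) (entry_pmf n \<delta> B C 1 1) z"
      using evg
    proof eventually_elim
      case (elim n)
      show ?case using Rgood[OF elim] by (intro exI[of _ "R n"]) (auto simp: good_def)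
    qed
  qed (use \<delta> in simp)
  ultimately show ?thesis using R0 unfolding D_def by blast
qed

theorem theorem2p1:
  fixes B C \<epsilon> :: real
  assumes "B > 0" and "C > 0" and "\<epsilon> > 0"
  shows
    "(\<forall>\<delta>. 0 \<le> \<delta> \<and> \<delta> \<le> 1 \<longrightarrow>
        (\<lambda>n. dTV (entry_pmf n \<delta> B C (n + 1) (n + 1)) (Geom C))
          \<in> O(\<lambda>n. real n powr (\<delta> - 1) + real n powr (- 1 / 2 + \<epsilon>)))
     \<and>
     (\<forall>\<delta>. 0 < \<delta> \<and> \<delta> \<le> 1 \<longrightarrow>
        (B < Bcrit C \<longrightarrow>
          (\<lambda>n. dTV (entry_pmf n \<delta> B C 1 (n + 1)) (Geom (B * C)))
            \<in> O(\<lambda>n. real n powr (\<delta> - 1) + real n powr (- \<delta> / 2 + \<epsilon>))) \<and>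
        (B > Bcrit C \<longrightarrow>
          (\<lambda>n. dTV (entry_pmf n \<delta> B C 1 (n + 1)) (Geom (Bcrit C * C)))
            \<in> O(\<lambda>n. real n powr (\<delta> - 1) + real n powr (- \<delta> / 2 + \<epsilon>))))
     \<and>
     (\<forall>\<delta>. 1 / 2 < \<delta> \<and> \<delta> < 1 \<longrightarrow>
        (B < Bcrit C \<longrightarrow>
          (\<lambda>n. dTV (entry_pmf n \<delta> B C 1 1)
                 (Geom (B\<^sup>2 * (1 + C) / ((Bcrit C - B) * (B + Bcrit C - 2)))))
            \<in> O(\<lambda>n. real n powr (\<delta> - 1) + real n powr (1 / 2 - \<delta> + \<epsilon>))) \<and>
        (B > Bcrit C \<longrightarrow>
          (\<exists>R :: nat \<Rightarrow> real.
             (\<forall>n. R n > 0) \<and>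
             Bseq (\<lambda>n. R n - C * (B - Bcrit C) * real n powr (1 - \<delta>)) \<and>
             (\<lambda>n. dTV (entry_pmf n \<delta> B C 1 1) (Geom (R n)))
               \<in> O(\<lambda>n. real n powr (\<delta> - 1) + real n powr (1 / 2 - \<delta> + \<epsilon>)))))"
proof (intro conjI allI impI)
  fix \<delta> :: real assume d: "0 \<le> \<delta> \<and> \<delta> \<le> 1"
  show "(\<lambda>n. dTV (entry_pmf n \<delta> B C (n + 1) (n + 1)) (Geom C))
          \<in> O(\<lambda>n. real n powr (\<delta> - 1) + real n powr (- 1 / 2 + \<epsilon>))"
  proof (cases "\<delta> = 1")
    case True
    then show ?thesis unfolding True by (intro bigo_trivial dTV_le_2)
  qed (use bottom_right_bigo assms d in auto)
next
  fix \<delta> :: real assume d: "0 < \<delta> \<and> \<delta> \<le> 1" and sub: "B < Bcrit C"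
  show "(\<lambda>n. dTV (entry_pmf n \<delta> B C 1 (n + 1)) (Geom (B * C)))
            \<in> O(\<lambda>n. real n powr (\<delta> - 1) + real n powr (- \<delta> / 2 + \<epsilon>))"
  proof (cases "\<delta> = 1")
    case True
    then show ?thesis unfolding True by (intro bigo_trivial dTV_le_2)
  qed (use sides_bigo assms d sub in auto)
next
  fix \<delta> :: real assume d: "0 < \<delta> \<and> \<delta> \<le> 1" and sup: "B > Bcrit C"
  show "(\<lambda>n. dTV (entry_pmf n \<delta> B C 1 (n + 1)) (Geom (Bcrit C * C)))
            \<in> O(\<lambda>n. real n powr (\<delta> - 1) + real n powr (- \<delta> / 2 + \<epsilon>))"
  proof (cases "\<delta> = 1")
    case True
    then show ?thesis unfolding True by (intro bigo_trivial dTV_le_2)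
  qed (use sides_bigo assms d sup in auto)
next
  fix \<delta> :: real assume d: "1 / 2 < \<delta> \<and> \<delta> < 1" and sub: "B < Bcrit C"
  show "(\<lambda>n. dTV (entry_pmf n \<delta> B C 1 1)
                 (Geom (B\<^sup>2 * (1 + C) / ((Bcrit C - B) * (B + Bcrit C - 2)))))
            \<in> O(\<lambda>n. real n powr (\<delta> - 1) + real n powr (1 / 2 - \<delta> + \<epsilon>))"
    by (rule top_left_subcritical_bigo) (use assms d sub in auto)
next
  fix \<delta> :: real assume d: "1 / 2 < \<delta> \<and> \<delta> < 1" and sup: "B > Bcrit C"
  show "\<exists>R :: nat \<Rightarrow> real.
             (\<forall>n. R n > 0) \<and>
             Bseq (\<lambda>n. R n - C * (B - Bcrit C) * real n powr (1 - \<delta>)) \<and>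
             (\<lambda>n. dTV (entry_pmf n \<delta> B C 1 1) (Geom (R n)))
               \<in> O(\<lambda>n. real n powr (\<delta> - 1) + real n powr (1 / 2 - \<delta> + \<epsilon>))"
    by (rule top_left_supercritical_bigo) (use assms d sup in auto)
qed

end
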